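(* Let $K = \mathbb{Q}(\sqrt{69})$ with ring of integers $\mathcal{O}_K$, and let $\mathfrak{p} = (23,\sqrt{69})$ be the prime ideal of $\mathcal{O}_K$ above $23$. For real $c>0$ let $f_{\mathfrak{p},c}$ be the weighted norm on $K$ attached to $\mathfrak{p}$ and $c$. Then the Euclidean window of $\mathfrak{p}$ is $w(\mathfrak{p}) = (25,\infty)$; the Euclidean minimum is $$M_1(\mathcal{O}_K,f_{\mathfrak{p},c}) = \max\Big\{\frac{25}{c},\ \frac{1}{23}\big(-600+75\sqrt{69}\,\big)\Big\}$$ for all $c \in w(\mathfrak{p})$; and $M_1(\mathcal{O}_K,f_{\mathfrak{p},c})$ is isolated exactly when $c \in \big[23,\ \frac{23}{15}(8+\sqrt{69}\,)\big)$.
   Context: Weighted norm: let $K$ be a number field, $\mathfrak{p}$ a prime ideal of $\mathcal{O}_K$ and $c>0$ a real number. Put $\phi(\mathfrak{q}) = N\mathfrak{q}$ (the absolute norm) for every prime ideal $\mathfrak{q}\neq\mathfrak{p}$ and $\phi(\mathfrak{p}) = c$, and extend $\phi$ multiplicatively to the group of fractional ideals. The weighted norm is $f_{\mathfrak{p},c}: K \to \mathbb{R}_{\ge 0}$, $f_{\mathfrak{p},c}(\alpha) = \phi(\alpha\mathcal{O}_K)$ for $\alpha\neq 0$, and $f_{\mathfrak{p},c}(0)=0$. Euclidean function: for an integral domain $R$, a function $f:R\to\mathbb{R}_{\ge 0}$ is a Euclidean function on $R$ if (i) $f(R)\cap[0,x]$ is finite for every $x\ge 0$; (ii) $f(r)=0$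 if and only if $r=0$; (iii) for all $a,b\in R$ with $b\ne 0$ there is $q\in R$ with $f(a-bq)<f(b)$. Euclidean window: $w(\mathfrak{p}) = \{c\in\mathbb{R} : f_{\mathfrak{p},c} \text{ is a Euclidean function on } \mathcal{O}_K\}$. Euclidean minimum: for the multiplicative function $f=f_{\mathfrak{p},c}$ and $\xi\in K$, $M(\xi,f)$ is the infimum of all $\kappa\in\mathbb{R}$ such that there is $q\in\mathcal{O}_K$ with $f(\xi-q)<\kappa$. The Euclidean minimum $M_1(\mathcal{O}_K,f) = M(\mathcal{O}_K,f)$ is the supremum of $M(\xi,f)$ over $\xi\in K$ (equivalently, the infimum of all $\kappa$ such that for all $a,b\in\mathcal{O}_K$, $b\neq 0$, there is $q \in\mathcal{O}_K$ with $f(a-bq)<\kappa f(b)$). Isolated: let $C_1$ be a set of representatives modulo $\mathcal{O}_K$ of all $\xi\in K$ with $M(\xi,f)=M_1(\mathcal{O}_K,f)$. Then $M_1(\mathcal{O}_K,f)$ is isolated if there is a real $\kappa_2<M_1(\mathcal{O}_K,f)$ such that $M(\xi,f)\le\kappa_2$ for all $\xi\in K$ that are not congruent modulo $\mathcal{O}_K$ to a point of $C_1$. *)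

theory Defs
  imports
    Complex_Main
    "HOL-Library.Extended_Real"
    "HOL-Computational_Algebra.Polynomial"
    "HOL-Algebra.Ideal_Product"
    "HOL-Algebra.QuotRing"
    "HOL-Algebra.Algebraic_Closure_Type"
begin

text \<open>
  A number field is given as a subfield \<open>K\<close> of an ambient field of characteristic 0
  (here, of the reals).
\<close>

definition ring_of_integers :: "'a::field_char_0 set \<Rightarrow> 'a set" where
  "ring_of_integers K = {x \<in> K. algebraic_int x}"

definition int_ring :: "'a::field_char_0 set \<Rightarrow> 'a ring" where
  "int_ring K = ring_of_type_algebra\<lparr>carrier := ring_of_integers K\<rparr>"

definition prime_ideals :: "'a::field_char_0 set \<Rightarrow> 'a set set" where
  "prime_ideals K = {\<qq>. primeideal \<qq> (int_ring K) \<and> \<qq> \<noteq> {0}}"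

definition abs_norm :: "'a::field_char_0 set \<Rightarrow> 'a set \<Rightarrow> nat" where
  "abs_norm K I = card (carrier (int_ring K Quot I))"

definition fractional_ideals :: "'a::field_char_0 set \<Rightarrow> 'a set set" where
  "fractional_ideals K =
     {(\<lambda>x. x / d) ` J | J d. ideal J (int_ring K) \<and> J \<noteq> {0} \<and> d \<in> ring_of_integers K \<and> d \<noteq> 0}"

text \<open>
  The product set \<^const>\<open>ideal_prod\<close> depends only on the addition and multiplication of its
  ring argument, not on the carrier, so it is also the product of fractional ideals.
\<close>

definition fractional_ideal_group :: "'a::field_char_0 set \<Rightarrow> 'a set monoid" where
  "fractional_ideal_group K =
     \<lparr>carrier = fractional_ideals K, monoid.mult = ideal_prod (int_ring K), one = ring_of_integers K\<rparr>"

definition pos_real_group :: "real monoid" where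
  "pos_real_group = \<lparr>carrier = {0<..}, monoid.mult = (*), one = 1\<rparr>"

definition weight_extension ::
  "'a::field_char_0 set \<Rightarrow> 'a set \<Rightarrow> real \<Rightarrow> ('a set \<Rightarrow> real) \<Rightarrow> bool" where
  "weight_extension K \<pp> c \<phi> \<longleftrightarrow>
     \<phi> \<in> hom (fractional_ideal_group K) pos_real_group \<and>
     (\<forall>\<qq>\<in>prime_ideals K. \<phi> \<qq> = (if \<qq> = \<pp> then c else real (abs_norm K \<qq>)))"

text \<open>
  The group of fractional ideals of a number field is freely generated by the nonzero prime
  ideals, so for \<open>c > 0\<close> the extension \<open>\<phi>\<close> exists and its values on fractional ideals are
  unique. The weighted norm is meant for \<open>c > 0\<close> and for arguments in \<open>K\<close> only.
\<close>

definition weighted_norm :: "'a::field_char_0 set \<Rightarrow> 'a set \<Rightarrow> real \<Rightarrow> 'a \<Rightarrow> real" where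
  "weighted_norm K \<pp> c \<alpha> =
     (if \<alpha> = 0 then 0
      else (THE x. \<exists>\<phi>. weight_extension K \<pp> c \<phi> \<and> x = \<phi> ((*) \<alpha> ` ring_of_integers K)))"

definition euclidean_function_on :: "'a::idom set \<Rightarrow> ('a \<Rightarrow> real) \<Rightarrow> bool" where
  "euclidean_function_on R f \<longleftrightarrow>
     (\<forall>r\<in>R. 0 \<le> f r) \<and>
     (\<forall>x\<ge>0. finite (f ` R \<inter> {0..x})) \<and>
     (\<forall>r\<in>R. f r = 0 \<longleftrightarrow> r = 0) \<and>
     (\<forall>a\<in>R. \<forall>b\<in>R. b \<noteq> 0 \<longrightarrow> (\<exists>q\<in>R. f (a - b * q) < f b))"

definition euclidean_window :: "'a::field_char_0 set \<Rightarrow> 'a set \<Rightarrow> real set" where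
  "euclidean_window K \<pp> =
     {c. c > 0 \<and> euclidean_function_on (ring_of_integers K) (weighted_norm K \<pp> c)}"

definition euclidean_min_at :: "'a::field_char_0 set \<Rightarrow> ('a \<Rightarrow> real) \<Rightarrow> 'a \<Rightarrow> real" where
  "euclidean_min_at K f \<xi> = Inf {\<kappa>. \<exists>q\<in>ring_of_integers K. f (\<xi> - q) < \<kappa>}"

text \<open>The supremum over \<open>K\<close> may be infinite, hence the extended reals.\<close>

definition euclidean_min :: "'a::field_char_0 set \<Rightarrow> ('a \<Rightarrow> real) \<Rightarrow> ereal" where
  "euclidean_min K f = (SUP \<xi>\<in>K. ereal (euclidean_min_at K f \<xi>))"

definition min_representatives :: "'a::field_char_0 set \<Rightarrow> ('a \<Rightarrow> real) \<Rightarrow> 'a set \<Rightarrow> bool" where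
  "min_representatives K f C \<longleftrightarrow>
     C \<subseteq> {\<xi> \<in> K. ereal (euclidean_min_at K f \<xi>) = euclidean_min K f} \<and>
     (\<forall>\<xi>\<in>K. ereal (euclidean_min_at K f \<xi>) = euclidean_min K f \<longrightarrow>
        (\<exists>!\<eta>. \<eta> \<in> C \<and> \<xi> - \<eta> \<in> ring_of_integers K))"

text \<open>The choice of the set of representatives is immaterial.\<close>

definition isolated_min :: "'a::field_char_0 set \<Rightarrow> ('a \<Rightarrow> real) \<Rightarrow> bool" where
  "isolated_min K f \<longleftrightarrow>
     (\<exists>C. min_representatives K f C \<and>
       (\<exists>\<kappa>\<^sub>2::real. ereal \<kappa>\<^sub>2 < euclidean_min K f \<and>
          (\<forall>\<xi>\<in>K. (\<forall>\<eta>\<in>C. \<xi> - \<eta> \<notin> ring_of_integers K) \<longrightarrow> euclidean_min_at K f \<xi> \<le> \<kappa>\<^sub>2)))"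

end

theory Submission
  imports Defs
begin

text \<open>
  Let \<open>F c z\<close> be the weighted norm of \<open>z\<close>. Since 23 is ramified, \<open>F c z\<close> is obtained from the rational number \<open>nm z\<close> by
  replacing each factor 23 by \<open>c\<close>. The proof determines, for every \<open>z\<close> in the field, how small \<open>F c (z - q)\<close> can be made
  by an integer \<open>q\<close>.

  At the critical point \<open>s = 4 sqrt 69 / 23\<close> and its negative, the minimum is \<open>25 / c\<close>: the norms of \<open>s - q\<close> have
  denominator 23 and absolute value at least \<open>25 / 23\<close> (\<open>F_critical_ge\<close>, \<open>F_critical_1\<close>). This makes 25 the lower end of
  the window.

  At all other points, for \<open>c \<ge> 23\<close>, the minimum is smaller than the constant \<open>kap = (75 sqrt 69 - 600) / 23\<close>
  (\<open>norm_covering\<close>). The weight can exceed the norm for integers \<open>q\<close> of one residue class modulo the prime above 23 only,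
  so it suffices to find \<open>q\<close> of small norm distance outside a given class. Points where this fails are called bad; the
  set of bad points of the plane is stable under translations and under the fundamental unit \<open>eps\<close>, which acts
  hyperbolically. A subdivision certificate confines the bad points to a neighbourhood of the integers, to
  a neighbourhood of the critical points, and to a piece of their unstable lines. A bad point near \<open>s\<close> other than \<open>s\<close> must
  leave along the unstable line, and the only possible exit leads close to an orbit that is heteroclinic from
  \<open>s\<close> to \<open>- s\<close>. Along that orbit the norm distance is exactly \<open>kap\<close> at a symmetric pair of positions; two inequalities,
  exchanged by the symmetry, contradict each other at every nearby point off the axes (\<open>no_exit\<close>). A point of
  the field lies on an axis only if it is critical.

  The constant \<open>kap\<close> is approached, for \<open>c \<ge> 25\<close>, by points of the field whose orbit follows the heteroclinic orbit and its
  negative for a long time (\<open>F_critical_lower\<close>). One integer is too close to these points in norm; a suitable choice of the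
  period, found by lifting modulo powers of 23, makes the difference divisible by a high power of the prime above 23, and
  its weight becomes large. For \<open>c < 23\<close>, points near a homoclinic orbit whose denominators contain high powers of that
  prime have unbounded minima (\<open>F_unbounded\<close>).

  So the Euclidean minimum is \<open>max (25 / c) kap\<close> for \<open>c \<ge> 23\<close>. It is isolated if it is attained at the critical points
  with \<open>25 / c > kap\<close>, and not isolated if it is the limit \<open>kap\<close>; the equality \<open>25 / c = kap\<close> is the upper end of the
  interval in the theorem.

  The bound \<open>norm_covering\<close> also makes the ring Euclidean, hence principal. Then fractional ideals have generators, the
  absolute norm of an ideal is the norm of a generator (\<open>abs_norm_prin\<close>), and unique factorization identifies the weighted norm
  with \<open>F c\<close> (\<open>weighted_norm_eq_F\<close>).
\<close>

section \<open>Points that are far from the ring of integers\<close>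

abbreviation rt :: real where "rt \<equiv> sqrt 69"

lemma rt_bounds: "(8306623862918 / 1000000000000) < rt" "rt < (8306623862919 / 1000000000000)"
  by (rule real_less_rsqrt, simp add: power2_eq_square)
     (rule real_less_lsqrt, simp_all add: power2_eq_square)

definition kap :: real where "kap = (75 * rt - 600) / 23"

lemma kap_bounds: "(99985 / 100000) < kap" "kap < (99987 / 100000)"
  using rt_bounds by (simp_all add: kap_def)

text \<open>
  The plane contains the field through \<open>z \<mapsto> (z, z')\<close>, with \<open>z'\<close> the conjugate. The integer \<open>(a + b * rt) / 2\<close> is
  congruent to \<open>a / 2\<close> modulo the prime above 23, so that \<open>a mod 23\<close> encodes its residue class. A bad point admits no
  integer at norm distance less than \<open>kap\<close> outside the class \<open>f\<close>. One class has to be excepted, because in one class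
  the weight may be larger than the norm, by an uncontrolled power of \<open>c / 23\<close>.
\<close>

definition bad :: "int \<Rightarrow> real \<Rightarrow> real \<Rightarrow> bool" where
  "bad f x y \<longleftrightarrow> (\<forall>a b::int. even (a + b) \<longrightarrow> \<not> 23 dvd (a - f) \<longrightarrow>
     kap \<le> \<bar>(x - (a + b * rt) / 2) * (y - (a - b * rt) / 2)\<bar>)"

lemma badD:
  assumes "bad f x y" "even (a + b)" "\<not> 23 dvd (a - f)"
  shows "kap \<le> \<bar>(x - (of_int a + of_int b * rt) / 2) * (y - (of_int a - of_int b * rt) / 2)\<bar>"
  using assms unfolding bad_def by blast

lemma bad_cong_class: "23 dvd (f - g) \<Longrightarrow> bad f x y \<Longrightarrow> bad g x y"
  unfolding bad_def
  by (metis (no_types, lifting) diff_add_cancel dvd_diff_commute dvd_add_right_iff add_diff_eq)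

lemma bad_shift:
  assumes "bad f x y" "even (a0 + b0)"
  shows "bad (f - a0) (x - (of_int a0 + of_int b0 * rt) / 2) (y - (of_int a0 - of_int b0 * rt) / 2)"
  unfolding bad_def
proof (intro allI impI)
  fix a b :: int
  assume ab: "even (a + b)" "\<not> 23 dvd (a - (f - a0))"
  have "kap \<le> \<bar>(x - (of_int (a + a0) + of_int (b + b0) * rt) / 2)
               * (y - (of_int (a + a0) - of_int (b + b0) * rt) / 2)\<bar>"
    using ab assms(2) by (intro badD[OF assms(1)]) (auto simp: algebra_simps)
  also have "(x - (of_int (a + a0) + of_int (b + b0) * rt) / 2)
      = x - (of_int a0 + of_int b0 * rt) / 2 - (of_int a + of_int b * rt) / 2"
    by (simp add: field_simps)
  also have "(y - (of_int (a + a0) - of_int (b + b0) * rt) / 2)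
      = y - (of_int a0 - of_int b0 * rt) / 2 - (of_int a - of_int b * rt) / 2"
    by (simp add: field_simps)
  finally show "kap \<le> \<bar>(x - (of_int a0 + of_int b0 * rt) / 2 - (of_int a + of_int b * rt) / 2) *
       (y - (of_int a0 - of_int b0 * rt) / 2 - (of_int a - of_int b * rt) / 2)\<bar>" .
qed

lemma bad_minus:
  assumes "bad f x y"
  shows "bad (- f) (- x) (- y)"
  unfolding bad_def
proof (intro allI impI)
  fix a b :: int
  assume ab: "even (a + b)" "\<not> 23 dvd (a - (- f))"
  have "\<not> 23 dvd (- a - f)" using ab(2) dvd_minus_iff[of 23 "a + f"] by simp
  then have "kap \<le> \<bar>(x - (of_int (- a) + of_int (- b) * rt) / 2)
               * (y - (of_int (- a) - of_int (- b) * rt) / 2)\<bar>"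
    using ab by (intro badD[OF assms]) auto
  also have "\<dots> = \<bar>(- x - (of_int a + of_int b * rt) / 2) * (- y - (of_int a - of_int b * rt) / 2)\<bar>"
    by (rule arg_cong[where f = abs]) (simp add: field_simps)
  finally show "kap \<le> \<bar>(- x - (of_int a + of_int b * rt) / 2) * (- y - (of_int a - of_int b * rt) / 2)\<bar>" .
qed

lemma bad_conj:
  assumes "bad f x y"
  shows "bad f y x"
  unfolding bad_def
proof (intro allI impI)
  fix a b :: int
  assume ab: "even (a + b)" "\<not> 23 dvd (a - f)"
  have "kap \<le> \<bar>(x - (of_int a + of_int (- b) * rt) / 2) * (y - (of_int a - of_int (- b) * rt) / 2)\<bar>"
    using ab by (intro badD[OF assms]) auto
  then show "kap \<le> \<bar>(y - (of_int a + of_int b * rt) / 2) * (x - (of_int a - of_int b * rt) / 2)\<bar>"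
    by (simp add: mult.commute)
qed

definition eps :: real where "eps = (25 + 3 * rt) / 2"
definition eps' :: real where "eps' = (25 - 3 * rt) / 2"

lemma eps_eps' [simp]: "eps * eps' = 1" "eps' * eps = 1"
  by (simp_all add: eps_def eps'_def field_simps)

lemma eps_bounds: "(24959935 / 1000000) < eps" "eps < (24959936 / 1000000)"
  using rt_bounds by (simp_all add: eps_def)

lemma eps'_bounds: "(400642 / 10000000) < eps'" "eps' < (400643 / 10000000)"
  using rt_bounds by (simp_all add: eps'_def)

text \<open>
  The fundamental unit has norm 1 and is congruent to 1 modulo the prime above 23; multiplication by it therefore
  preserves norms and residue classes.
\<close>

lemma bad_eps:
  assumes "bad f x y"
  shows "bad f (eps * x) (eps' * y)"
  unfolding bad_def
proof (intro allI impI)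
  fix a b :: int
  assume ab: "even (a + b)" "\<not> 23 dvd (a - f)"
  obtain k where k: "b = 2 * k - a" using ab(1) by (metis add_diff_cancel_left' evenE)
  \<comment> \<open>the coordinates of the product of \<open>(a + b * rt) / 2\<close> with \<open>eps'\<close>\<close>
  define a1 where "a1 = 116 * a - 207 * k"
  define b1 where "b1 = 25 * k - 14 * a"
  have "a1 + b1 = 2 * (51 * a - 91 * k)" by (simp add: a1_def b1_def)
  then have ev: "even (a1 + b1)" by simp
  have "a1 - f = (a - f) + 23 * (5 * a - 9 * k)" by (simp add: a1_def)
  then have cl: "\<not> 23 dvd (a1 - f)" using ab(2) by (metis dvd_add_times_triv_right_iff mult.commute)
  have 1: "eps * (x - (of_int a1 + of_int b1 * rt) / 2) = eps * x - (of_int a + of_int b * rt) / 2"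
    by (simp add: eps_def a1_def b1_def k field_simps)
  have 2: "eps' * (y - (of_int a1 - of_int b1 * rt) / 2) = eps' * y - (of_int a - of_int b * rt) / 2"
    by (simp add: eps'_def a1_def b1_def k field_simps)
  have "kap \<le> \<bar>(x - (of_int a1 + of_int b1 * rt) / 2) * (y - (of_int a1 - of_int b1 * rt) / 2)\<bar>"
    by (rule badD[OF assms ev cl])
  also have "\<dots> = \<bar>(eps * eps') * ((x - (of_int a1 + of_int b1 * rt) / 2) * (y - (of_int a1 - of_int b1 * rt) / 2))\<bar>"
    by simp
  also have "\<dots> = \<bar>(eps * (x - (of_int a1 + of_int b1 * rt) / 2)) * (eps' * (y - (of_int a1 - of_int b1 * rt) / 2))\<bar>"
    by (simp only: mult_ac)
  finally show "kap \<le> \<bar>(eps * x - (of_int a + of_int b * rt) / 2) * (eps' * y - (of_int a - of_int b * rt) / 2)\<bar>"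
    unfolding 1 2 .
qed

section \<open>A subdivision certificate\<close>

text \<open>
  A bisection tree for the rectangle \<open>0 \<le> A \<le> 1/2\<close>, \<open>0 \<le> B \<le> 1/4\<close> of points \<open>A + B * rt\<close>. On a leaf \<open>Two\<close>, two
  integers from different classes are close to every point, and no point is bad. On a leaf \<open>One\<close>, one integer is
  close to every point and determines the excepted class; such leaves, and the leaves \<open>Centre\<close>, fill small
  regions that need the finer analysis of the following sections.
\<close>

datatype cert = Two "int \<times> int" "int \<times> int" | Centre | One nat "int \<times> int"
  | HalfA cert cert | HalfB cert cert

definition max_sq :: "int \<Rightarrow> int \<Rightarrow> int" where
  "max_sq l h = max (l * l) (h * h)"

definition min_sq :: "int \<Rightarrow> int \<Rightarrow> int" where
  "min_sq l h = (if l \<le> 0 \<and> 0 \<le> h then 0 else min (l * l) (h * h))"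

text \<open>
  Boxes are given in units of \<open>1/1024\<close> for \<open>A\<close> and \<open>1/2048\<close> for \<open>B\<close>. In these units the norm is
  \<open>(4 x\<^sup>2 - 69 y\<^sup>2) / 4194304\<close>, and \<open>4193632 / 4194304\<close> is slightly smaller than \<open>kap\<close>.
\<close>

definition small_on :: "int \<times> int \<Rightarrow> int \<Rightarrow> int \<Rightarrow> int \<Rightarrow> int \<Rightarrow> bool" where
  "small_on q i0 i1 j0 j1 =
     (let x0 = i0 - 512 * fst q; x1 = i1 - 512 * fst q;
          y0 = j0 - 1024 * snd q; y1 = j1 - 1024 * snd q
      in even (fst q + snd q) \<and>
         4 * max_sq x0 x1 - 69 * min_sq y0 y1 < 4193632 \<and>
         69 * max_sq y0 y1 - 4 * min_sq x0 x1 < 4193632)"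

text \<open>
  The regions left to the leaves \<open>One\<close>, each with its excepted class: a neighbourhood of 0, the part of the unstable
  line of the critical point next to it, and a neighbourhood of the point at which a bad point may leave this line.
\<close>

definition arms :: "(int \<times> int \<times> int \<times> int \<times> int) list" where
  "arms = [(0, 0, 4, 0, 4), (18, 0, 112, 348, 384), (4, 194, 252, 398, 416)]"

definition in_box :: "int \<times> int \<times> int \<times> int \<Rightarrow> int \<Rightarrow> int \<Rightarrow> int \<Rightarrow> int \<Rightarrow> bool" where
  "in_box r i0 i1 j0 j1 = (case r of (r0, r1, s0, s1) \<Rightarrow> r0 \<le> i0 \<and> i1 \<le> r1 \<and> s0 \<le> j0 \<and> j1 \<le> s1)"

fun verify :: "cert \<Rightarrow> int \<Rightarrow> int \<Rightarrow> int \<Rightarrow> int \<Rightarrow> bool" where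
  "verify (Two p q) i0 i1 j0 j1 =
     ((fst p - fst q) mod 23 \<noteq> 0 \<and> small_on p i0 i1 j0 j1 \<and> small_on q i0 i1 j0 j1)"
| "verify Centre i0 i1 j0 j1 = in_box (0, 32, 350, 362) i0 i1 j0 j1"
| "verify (One n q) i0 i1 j0 j1 =
     (n < 3 \<and> (fst q - fst (arms ! n)) mod 23 = 0 \<and> in_box (snd (arms ! n)) i0 i1 j0 j1
      \<and> small_on q i0 i1 j0 j1)"
| "verify (HalfA l r) i0 i1 j0 j1 =
     (let m = (i0 + i1) div 2 in verify l i0 m j0 j1 \<and> verify r m i1 j0 j1)"
| "verify (HalfB l r) i0 i1 j0 j1 =
     (let m = (j0 + j1) div 2 in verify l i0 i1 j0 m \<and> verify r i0 i1 m j1)"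

lemma sq_between:
  fixes x :: real
  assumes "of_int l \<le> x" "x \<le> of_int h"
  shows "x * x \<le> of_int (max_sq l h)" "of_int (min_sq l h) \<le> x * x"
proof -
  have "x * x \<le> max (of_int l * of_int l) (of_int h * of_int h)"
  proof (cases "x \<ge> 0")
    case True
    then have "x * x \<le> of_int h * of_int h" using assms by (intro mult_mono) auto
    then show ?thesis by simp
  next
    case False
    then have "(- x) * (- x) \<le> (- of_int l) * (- of_int l)" using assms by (intro mult_mono) auto
    then show ?thesis by simp
  qed
  then show "x * x \<le> of_int (max_sq l h)"
    by (simp add: max_sq_def of_int_max)
  show "of_int (min_sq l h) \<le> x * x"
  proof (cases "l \<le> 0 \<and> 0 \<le> h")
    case True
    then show ?thesis by (simp add: min_sq_def)
  next
    case False
    then consider "l > 0" | "h < 0" by linarith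
    then have "min (of_int l * of_int l) (of_int h * of_int h) \<le> x * x"
    proof cases
      case 1
      then have "of_int l * of_int l \<le> x * x" using assms by (intro mult_mono) auto
      then show ?thesis by simp
    next
      case 2
      then have "(- of_int h) * (- of_int h) \<le> (- x) * (- x)" using assms by (intro mult_mono) auto
      then show ?thesis by simp
    qed
    then show ?thesis using False by (auto simp: min_sq_def of_int_min)
  qed
qed

lemma small_on_imp:
  fixes A B :: real
  assumes q: "small_on q i0 i1 j0 j1"
    and A: "of_int i0 \<le> 1024 * A" "1024 * A \<le> of_int i1"
    and B: "of_int j0 \<le> 2048 * B" "2048 * B \<le> of_int j1"
  shows "\<bar>(A + B * rt - (of_int (fst q) + of_int (snd q) * rt) / 2)
        * (A - B * rt - (of_int (fst q) - of_int (snd q) * rt) / 2)\<bar> < kap"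
proof -
  define a b where "a = fst q" and "b = snd q"
  define Z where "Z = 1024 * A - 512 * of_int a"
  define Y where "Y = 2048 * B - 1024 * of_int b"
  have Z: "of_int (i0 - 512 * a) \<le> Z" "Z \<le> of_int (i1 - 512 * a)"
    using A by (auto simp: Z_def)
  have Y: "of_int (j0 - 1024 * b) \<le> Y" "Y \<le> of_int (j1 - 1024 * b)"
    using B by (auto simp: Y_def)
  note Z' = sq_between[OF Z] and Y' = sq_between[OF Y]
  have I: "4 * max_sq (i0 - 512 * a) (i1 - 512 * a) - 69 * min_sq (j0 - 1024 * b) (j1 - 1024 * b) < 4193632"
    "69 * max_sq (j0 - 1024 * b) (j1 - 1024 * b) - 4 * min_sq (i0 - 512 * a) (i1 - 512 * a) < 4193632"
    using q by (auto simp: small_on_def Let_def a_def b_def)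
  have "4 * (Z * Z) - 69 * (Y * Y) < 4193632" "69 * (Y * Y) - 4 * (Z * Z) < 4193632"
    using Z' Y' I[THEN of_int_less_iff[where 'a = real, THEN iffD2]]
    unfolding of_int_diff of_int_mult of_int_numeral by linarith+
  then have "\<bar>4 * (Z * Z) - 69 * (Y * Y)\<bar> < 4193632" by linarith
  moreover have "(A + B * rt - (of_int a + of_int b * rt) / 2) * (A - B * rt - (of_int a - of_int b * rt) / 2)
      = (4 * (Z * Z) - 69 * (Y * Y)) / 4194304"
  proof -
    have "(A + B * rt - (of_int a + of_int b * rt) / 2) * (A - B * rt - (of_int a - of_int b * rt) / 2)
      = (A - of_int a / 2) * (A - of_int a / 2) - (rt * rt) * ((B - of_int b / 2) * (B - of_int b / 2))"
      by (simp add: algebra_simps add_divide_distrib diff_divide_distrib)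
    also have "\<dots> = (4 * (Z * Z) - 69 * (Y * Y)) / 4194304"
      by (simp add: Z_def Y_def field_simps)
    finally show ?thesis .
  qed
  ultimately show ?thesis
    using kap_bounds unfolding a_def b_def by (simp only: abs_divide) simp
qed

lemma small_on_class:
  assumes "bad f (A + B * rt) (A - B * rt)" "small_on q i0 i1 j0 j1"
    "of_int i0 \<le> 1024 * A" "1024 * A \<le> of_int i1" "of_int j0 \<le> 2048 * B" "2048 * B \<le> of_int j1"
  shows "23 dvd (fst q - f)"
proof (rule ccontr)
  assume "\<not> 23 dvd (fst q - f)"
  moreover have "even (fst q + snd q)" using assms(2) by (simp add: small_on_def Let_def)
  ultimately have "kap \<le> \<bar>(A + B * rt - (of_int (fst q) + of_int (snd q) * rt) / 2)
        * (A - B * rt - (of_int (fst q) - of_int (snd q) * rt) / 2)\<bar>"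
    by (intro badD[OF assms(1)])
  then show False using small_on_imp[OF assms(2-6)] by linarith
qed

text \<open>
  The union of the undecided regions; the first one surrounds the critical point \<open>(0, 4/23)\<close>.
\<close>

definition suspicious :: "int \<Rightarrow> real \<Rightarrow> real \<Rightarrow> bool" where
  "suspicious f A B \<longleftrightarrow>
     (0 \<le> 1024 * A \<and> 1024 * A \<le> 32 \<and> 350 \<le> 2048 * B \<and> 2048 * B \<le> 362) \<or>
     (23 dvd f \<and> 0 \<le> 1024 * A \<and> 1024 * A \<le> 4 \<and> 0 \<le> 2048 * B \<and> 2048 * B \<le> 4) \<or>
     (23 dvd (f - 18) \<and> 0 \<le> 1024 * A \<and> 1024 * A \<le> 112 \<and> 348 \<le> 2048 * B \<and> 2048 * B \<le> 384) \<or>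
     (23 dvd (f - 4) \<and> 194 \<le> 1024 * A \<and> 1024 * A \<le> 252 \<and> 398 \<le> 2048 * B \<and> 2048 * B \<le> 416)"

lemma verify_sound:
  assumes "verify t i0 i1 j0 j1" "bad f (A + B * rt) (A - B * rt)"
    "of_int i0 \<le> 1024 * A" "1024 * A \<le> of_int i1" "of_int j0 \<le> 2048 * B" "2048 * B \<le> of_int j1"
  shows "suspicious f A B"
  using assms
proof (induction t arbitrary: i0 i1 j0 j1)
  case (Two p q)
  have "23 dvd (fst p - f)" "23 dvd (fst q - f)"
    using Two by (auto intro: small_on_class)
  then have "23 dvd (fst p - fst q)"
    using dvd_diff[of 23 "fst p - f" "fst q - f"] by simp
  then show ?case using Two by (simp add: dvd_eq_mod_eq_0)
next
  case Centre
  then have "0 \<le> i0" "i1 \<le> 32" "350 \<le> j0" "j1 \<le> 362" by (auto simp: in_box_def)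
  then have "0 \<le> real_of_int i0" "real_of_int i1 \<le> 32" "350 \<le> real_of_int j0" "real_of_int j1 \<le> 362"
    by linarith+
  then show ?case using Centre by (auto simp: suspicious_def)
next
  case (One n q)
  have q: "23 dvd (fst q - f)" using One by (auto intro: small_on_class)
  have m: "23 dvd (fst q - fst (arms ! n))" "n < 3" "in_box (snd (arms ! n)) i0 i1 j0 j1"
    using One by (auto simp: mod_eq_0_iff_dvd)
  have d: "23 dvd (f - fst (arms ! n))" using dvd_diff[OF m(1) q] by simp
  consider "n = 0" | "n = 1" | "n = 2" using m(2) by linarith
  then show ?case
  proof cases
    case 1
    then have "0 \<le> i0" "i1 \<le> 4" "0 \<le> j0" "j1 \<le> 4" using m(3) by (auto simp: in_box_def arms_def)
    then have "0 \<le> real_of_int i0" "real_of_int i1 \<le> 4" "0 \<le> real_of_int j0" "real_of_int j1 \<le> 4"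
      by linarith+
    then show ?thesis using One 1 d by (auto simp: suspicious_def arms_def)
  next
    case 2
    then have "0 \<le> i0" "i1 \<le> 112" "348 \<le> j0" "j1 \<le> 384" using m(3) by (auto simp: in_box_def arms_def)
    then have "0 \<le> real_of_int i0" "real_of_int i1 \<le> 112" "348 \<le> real_of_int j0" "real_of_int j1 \<le> 384"
      by linarith+
    then show ?thesis using One 2 d by (auto simp: suspicious_def arms_def)
  next
    case 3
    then have "194 \<le> i0" "i1 \<le> 252" "398 \<le> j0" "j1 \<le> 416" using m(3) by (auto simp: in_box_def arms_def)
    then have "194 \<le> real_of_int i0" "real_of_int i1 \<le> 252" "398 \<le> real_of_int j0" "real_of_int j1 \<le> 416"
      by linarith+
    then show ?thesis using One 3 d by (auto simp: suspicious_def arms_def)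
  qed
next
  case (HalfA l r)
  then show ?case by (cases "1024 * A \<le> of_int ((i0 + i1) div 2)") (auto simp: Let_def)
next
  case (HalfB l r)
  then show ?case by (cases "2048 * B \<le> of_int ((j0 + j1) div 2)") (auto simp: Let_def)
qed

definition covering :: cert where
  "covering = HalfB (HalfB (HalfA (HalfA (HalfA (HalfA (HalfA (HalfA (HalfA (HalfB (HalfB (HalfB (HalfB (HalfB
(One 0 (0,0)) (Two (0,0) (2,0))) (Two (0,0) (2,0))) (Two (0,0) (2,0))) (Two (-2,0) (0,0))) (Two
(-2,0) (0,0))) (Two (0,0) (2,0))) (Two (0,0) (2,0))) (Two (0,0) (2,0))) (Two (0,0) (2,0))) (Two
(0,0) (2,0))) (Two (0,0) (2,0))) (Two (0,0) (2,0))) (HalfB (Two (0,0) (2,0)) (HalfA (Two (-2,0)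
(2,0)) (HalfA (HalfB (Two (0,0) (2,0)) (Two (2,0) (7,1))) (Two (0,0) (2,0)))))) (HalfA (HalfB
(HalfA (HalfB (Two (-2,0) (2,0)) (HalfA (HalfB (HalfB (Two (11,-1) (-2,0)) (HalfA (HalfB (Two
(-11,-1) (11,-1)) (HalfA (HalfB (Two (-11,-1) (11,-1)) (HalfB (Two (-11,-1) (11,-1)) Centre))
(Two (-11,-1) (-36,-4)))) (Two (-11,-1) (-2,0)))) (HalfB (HalfA (HalfB Centre (HalfB (HalfB
Centre (One 1 (-5,1))) (One 1 (-5,1)))) (HalfB (HalfB (Two (-11,-1) (-36,-4)) (Two (-11,-1)
(-5,1))) (One 1 (-5,1)))) (One 1 (-5,1)))) (HalfB (HalfB (HalfA (HalfB (Two (11,-1) (-2,0)) (Two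
(-2,0) (14,2))) (HalfA (HalfB (Two (-2,0) (2,0)) (HalfB (HalfB (Two (-2,0) (2,0)) (HalfA (Two
(-2,0) (14,2)) (HalfA (HalfB (Two (-2,0) (64,8)) (Two (-2,0) (14,2))) (Two (-2,0) (64,8)))))
(Two (-2,0) (14,2)))) (HalfA (HalfB (Two (-2,0) (2,0)) (HalfB (Two (-2,0) (64,8)) (HalfB (Two
(-2,0) (86,-10)) (Two (-2,0) (14,2))))) (HalfB (HalfA (Two (-2,0) (2,0)) (HalfB (Two (-2,0)
(2,0)) (HalfB (Two (-2,0) (2,0)) (HalfB (Two (-2,0) (2,0)) (Two (-2,0) (-130,16)))))) (HalfB
(HalfB (HalfA (Two (-2,0) (-130,16)) (HalfB (Two (-2,0) (-130,16)) (Two (-2,0) (86,-10)))) (Two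
(-2,0) (86,-10))) (HalfB (Two (-2,0) (64,8)) (Two (-2,0) (-5,1)))))))) (Two (-2,0) (14,2)))
(HalfA (One 1 (-5,1)) (HalfA (One 1 (-5,1)) (HalfB (Two (-11,-1) (-2,0)) (HalfB (Two (-11,-1)
(-5,1)) (HalfB (Two (-11,-1) (-5,1)) (Two (20,-2) (-5,1)))))))))) (HalfB (HalfB (Two (-2,0)
(2,0)) (HalfB (Two (-2,0) (2,0)) (HalfA (HalfA (Two (-2,0) (2,0)) (HalfA (Two (-2,0) (2,0))
(HalfB (Two (-2,0) (2,0)) (HalfB (Two (-2,0) (2,0)) (HalfA (HalfB (Two (-2,0) (2,0)) (Two (-2,0)
(86,-10))) (HalfB (Two (-2,0) (86,-10)) (HalfA (HalfB (Two (-2,0) (86,-10)) (Two (-2,0) (-5,1)))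
(Two (-2,0) (-5,1))))))))) (HalfA (HalfB (Two (-2,0) (2,0)) (HalfA (HalfB (Two (-2,0) (-52,-6))
(HalfA (HalfB (HalfA (HalfB (Two (-2,0) (2,0)) (HalfA (HalfA (Two (-2,0) (86,-10)) (Two (-2,0)
(-5,1))) (Two (-2,0) (-5,1)))) (Two (-2,0) (-52,-6))) (Two (-2,0) (-5,1))) (Two (-2,0) (-5,1))))
(HalfB (HalfB (Two (-2,0) (-27,-3)) (Two (-2,0) (-5,1))) (Two (-2,0) (-5,1))))) (HalfB (HalfB
(Two (-2,0) (2,0)) (HalfA (Two (-2,0) (-27,-3)) (Two (-2,0) (-5,1)))) (Two (-2,0) (-5,1)))))))
(HalfB (HalfA (HalfB (HalfA (HalfA (HalfB (HalfB (Two (-2,0) (2,0)) (HalfB (HalfB (Two (-2,0)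
(2,0)) (Two (-2,0) (89,11))) (HalfA (HalfB (Two (-2,0) (-130,16)) (Two (-2,0) (-127,-15))) (Two
(-2,0) (89,11))))) (HalfB (HalfA (HalfA (Two (-2,0) (86,-10)) (HalfB (Two (-2,0) (86,-10))
(HalfB (Two (-2,0) (86,-10)) (Two (-2,0) (-5,1))))) (HalfB (HalfB (Two (-2,0) (86,-10)) (Two
(-2,0) (-127,-15))) (Two (-2,0) (-5,1)))) (Two (-2,0) (-5,1)))) (HalfB (HalfB (HalfB (Two (-2,0)
(2,0)) (HalfA (HalfA (Two (-2,0) (2,0)) (Two (-2,0) (-102,-12))) (HalfA (Two (-2,0) (-102,-12))
(Two (-2,0) (86,-10))))) (HalfA (HalfB (HalfA (HalfA (HalfA (HalfB (Two (-2,0) (-130,16)) (Two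
(-2,0) (86,-10))) (Two (-2,0) (86,-10))) (Two (-2,0) (86,-10))) (Two (-2,0) (86,-10))) (HalfB
(Two (-2,0) (86,-10)) (Two (-2,0) (89,11)))) (HalfB (Two (-2,0) (86,-10)) (HalfA (HalfA (HalfB
(Two (-2,0) (86,-10)) (Two (-2,0) (-5,1))) (Two (-2,0) (-5,1))) (Two (-2,0) (-5,1)))))) (Two
(-2,0) (-5,1)))) (HalfB (HalfA (HalfA (HalfA (HalfB (HalfB (Two (-2,0) (114,14)) (Two (-2,0)
(86,-10))) (HalfB (Two (-2,0) (-102,-12)) (Two (-2,0) (-5,1)))) (HalfB (Two (-2,0) (86,-10))
(Two (-2,0) (-5,1)))) (HalfB (HalfB (Two (-2,0) (86,-10)) (HalfA (Two (-2,0) (114,14)) (Two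
(-2,0) (-5,1)))) (Two (-2,0) (-5,1)))) (HalfB (HalfB (HalfB (Two (-2,0) (-77,-9)) (Two (-2,0)
(-5,1))) (Two (-2,0) (-5,1))) (Two (-2,0) (-5,1)))) (Two (-2,0) (-5,1)))) (Two (-2,0) (-5,1)))
(Two (-2,0) (-5,1))) (HalfB (Two (-2,0) (-5,1)) (HalfA (Two (-11,-1) (-5,1)) (Two (-5,1)
(14,2))))))) (HalfB (HalfB (HalfA (HalfA (Two (-5,1) (5,1)) (HalfA (Two (-5,1) (5,1)) (HalfB
(HalfB (Two (20,-2) (-5,1)) (Two (-5,1) (5,1))) (Two (-5,1) (5,1))))) (HalfA (HalfB (HalfA
(HalfB (HalfA (Two (20,-2) (-5,1)) (HalfB (Two (20,-2) (-11,-1)) (Two (4,0) (-5,1)))) (Two (4,0)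
(-5,1))) (Two (4,0) (-5,1))) (HalfB (Two (4,0) (-5,1)) (Two (4,0) (5,1)))) (HalfA (HalfB (Two
(4,0) (-5,1)) (HalfA (HalfA (HalfA (HalfA (HalfB (Two (4,0) (-5,1)) (Two (4,0) (5,1))) (One 2
(4,0))) (One 2 (4,0))) (One 2 (4,0))) (One 2 (4,0)))) (HalfB (Two (-11,-1) (4,0)) (HalfA (One 2
(4,0)) (HalfA (One 2 (4,0)) (HalfA (One 2 (4,0)) (HalfB (Two (-11,-1) (4,0)) (Two (4,0)
(-46,6)))))))))) (HalfB (HalfA (HalfA (Two (-5,1) (5,1)) (Two (4,0) (5,1))) (HalfA (Two (4,0)
(5,1)) (HalfA (Two (4,0) (5,1)) (HalfA (Two (4,0) (5,1)) (Two (4,0) (-21,3)))))) (Two (4,0)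
(5,1)))) (HalfA (HalfA (Two (-4,0) (4,0)) (HalfB (HalfB (Two (4,0) (5,1)) (Two (-4,0) (4,0)))
(Two (-4,0) (4,0)))) (HalfB (Two (4,0) (5,1)) (HalfA (HalfA (Two (-4,0) (4,0)) (HalfA (Two
(-4,0) (4,0)) (HalfB (Two (-4,0) (4,0)) (HalfB (Two (-4,0) (4,0)) (HalfB (Two (-4,0) (4,0)) (Two
(-4,0) (-12,2))))))) (HalfB (Two (4,0) (5,1)) (HalfA (HalfB (Two (-4,0) (5,1)) (Two (-4,0)
(-12,2))) (Two (5,1) (-12,2))))))))) (HalfA (HalfB (HalfB (HalfB (Two (-2,0) (2,0)) (HalfB
(HalfA (HalfB (Two (-2,0) (2,0)) (HalfA (Two (-2,0) (23,3)) (Two (-2,0) (-5,1)))) (HalfA (HalfA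
(HalfB (Two (-2,0) (2,0)) (Two (-2,0) (-5,1))) (Two (-2,0) (-5,1))) (Two (-2,0) (-5,1)))) (Two
(-2,0) (-5,1)))) (HalfB (Two (-2,0) (-5,1)) (HalfA (HalfA (Two (-2,0) (-5,1)) (Two (-2,0)
(4,0))) (Two (-2,0) (4,0))))) (HalfA (HalfB (HalfB (HalfB (Two (4,0) (14,2)) (HalfB (Two
(-11,-1) (4,0)) (HalfB (Two (-11,-1) (4,0)) (Two (4,0) (-21,3))))) (HalfB (HalfA (HalfB (Two
(4,0) (-21,3)) (Two (4,0) (5,1))) (HalfA (HalfB (HalfA (HalfB (Two (-11,-1) (4,0)) (Two (4,0)
(-61,-7))) (Two (-11,-1) (4,0))) (HalfB (HalfB (HalfB (Two (4,0) (-61,-7)) (Two (4,0) (29,-3)))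
(Two (4,0) (29,-3))) (Two (4,0) (5,1)))) (HalfB (Two (-11,-1) (4,0)) (Two (4,0) (29,-3))))) (Two
(4,0) (5,1)))) (HalfB (Two (4,0) (5,1)) (HalfA (HalfB (HalfB (Two (-20,-2) (4,0)) (Two (5,1)
(-12,2))) (Two (5,1) (-12,2))) (HalfB (Two (5,1) (-12,2)) (Two (13,-1) (5,1)))))) (HalfB (HalfB
(HalfB (Two (-2,0) (4,0)) (Two (4,0) (14,2))) (HalfA (HalfB (HalfA (HalfA (HalfB (Two (-11,-1)
(4,0)) (Two (4,0) (29,-3))) (Two (-11,-1) (4,0))) (Two (-11,-1) (4,0))) (HalfB (HalfA (HalfB
(Two (4,0) (54,-6)) (Two (4,0) (5,1))) (HalfB (HalfA (Two (4,0) (-61,-7)) (HalfA (Two (4,0)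
(-61,-7)) (Two (-11,-1) (4,0)))) (HalfB (HalfA (HalfA (Two (4,0) (5,1)) (Two (4,0) (-137,17)))
(Two (4,0) (-61,-7))) (Two (4,0) (5,1))))) (Two (4,0) (5,1)))) (HalfB (Two (-11,-1) (4,0))
(HalfA (HalfB (HalfB (Two (-11,-1) (4,0)) (HalfA (Two (4,0) (-61,-7)) (HalfA (Two (4,0)
(-61,-7)) (Two (-11,-1) (4,0))))) (HalfA (Two (4,0) (5,1)) (HalfB (HalfB (Two (4,0) (-61,-7))
(Two (4,0) (5,1))) (Two (4,0) (5,1))))) (HalfB (Two (-11,-1) (4,0)) (HalfA (HalfB (Two (4,0)
(-61,-7)) (Two (4,0) (5,1))) (HalfB (HalfA (Two (4,0) (-61,-7)) (Two (-11,-1) (4,0))) (HalfB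
(Two (4,0) (-61,-7)) (Two (4,0) (5,1)))))))))) (HalfB (HalfB (Two (4,0) (5,1)) (HalfA (HalfA
(Two (4,0) (5,1)) (HalfB (Two (4,0) (5,1)) (Two (5,1) (-12,2)))) (HalfA (HalfB (Two (4,0) (5,1))
(Two (5,1) (-12,2))) (Two (5,1) (-12,2))))) (HalfA (HalfB (Two (5,1) (-12,2)) (Two (13,-1)
(5,1))) (HalfB (Two (13,-1) (5,1)) (HalfB (Two (13,-1) (5,1)) (Two (-20,-2) (5,1))))))))) (HalfB
(HalfB (HalfB (HalfA (Two (-2,0) (7,1)) (HalfB (Two (2,0) (7,1)) (Two (-5,1) (7,1)))) (Two
(-2,0) (-5,1))) (Two (-2,0) (4,0))) (HalfB (HalfB (Two (-2,0) (4,0)) (HalfA (HalfB (Two (4,0)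
(14,2)) (HalfA (HalfA (HalfB (Two (-11,-1) (4,0)) (HalfB (Two (-11,-1) (4,0)) (HalfA (Two (4,0)
(-61,-7)) (HalfA (Two (4,0) (-61,-7)) (Two (-11,-1) (4,0)))))) (Two (-11,-1) (4,0))) (Two
(-11,-1) (4,0)))) (HalfB (HalfA (HalfA (Two (4,0) (14,2)) (Two (-2,0) (4,0))) (Two (-2,0)
(4,0))) (HalfB (Two (4,0) (14,2)) (Two (-11,-1) (14,2)))))) (HalfA (HalfB (HalfB (HalfA (HalfB
(HalfB (HalfA (HalfA (Two (4,0) (5,1)) (HalfB (Two (4,0) (-61,-7)) (Two (4,0) (5,1)))) (Two
(4,0) (-61,-7))) (Two (4,0) (5,1))) (HalfA (Two (4,0) (5,1)) (Two (5,1) (-12,2)))) (HalfB (HalfB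
(Two (-11,-1) (4,0)) (Two (4,0) (-12,2))) (HalfA (Two (5,1) (-12,2)) (Two (13,-1) (-12,2)))))
(Two (5,1) (-12,2))) (HalfA (HalfB (Two (13,-1) (5,1)) (HalfB (HalfA (HalfA (Two (13,-1) (5,1))
(HalfB (Two (13,-1) (5,1)) (Two (-3,1) (5,1)))) (HalfB (Two (5,1) (30,4)) (Two (-3,1) (5,1))))
(Two (-3,1) (5,1)))) (HalfB (HalfB (Two (13,-1) (5,1)) (HalfA (HalfA (Two (13,-1) (5,1)) (HalfB
(Two (13,-1) (5,1)) (Two (-3,1) (5,1)))) (HalfB (HalfB (Two (13,-1) (5,1)) (Two (-3,1) (5,1)))
(Two (-3,1) (5,1))))) (Two (-3,1) (5,1))))) (HalfB (HalfB (HalfB (Two (-11,-1) (-12,2)) (Two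
(13,-1) (-12,2))) (HalfA (HalfB (Two (13,-1) (-12,2)) (Two (13,-1) (5,1))) (HalfA (HalfB (HalfB
(Two (-11,-1) (13,-1)) (Two (13,-1) (38,-4))) (HalfA (Two (13,-1) (5,1)) (HalfA (Two (13,-1)
(5,1)) (HalfB (Two (13,-1) (5,1)) (Two (5,1) (63,-7)))))) (HalfA (HalfB (Two (13,-1) (38,-4))
(HalfB (Two (13,-1) (5,1)) (Two (5,1) (63,-7)))) (HalfB (Two (-11,-1) (13,-1)) (HalfB (HalfB
(Two (13,-1) (-61,-7)) (Two (5,1) (63,-7))) (Two (-3,1) (5,1)))))))) (HalfA (HalfB (HalfB (HalfA
(HalfA (Two (13,-1) (5,1)) (HalfA (Two (13,-1) (5,1)) (HalfB (Two (13,-1) (5,1)) (Two (-3,1)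
(5,1))))) (HalfB (HalfA (Two (13,-1) (5,1)) (HalfA (Two (13,-1) (5,1)) (Two (5,1) (63,-7))))
(Two (-3,1) (5,1)))) (Two (-3,1) (5,1))) (Two (-3,1) (5,1))) (Two (-3,1) (5,1)))))))))"

lemma verify_covering: "verify covering 0 512 0 512"
  by code_simp

lemma bad_suspicious:
  assumes "bad f (A + B * rt) (A - B * rt)" "0 \<le> A" "A \<le> 1 / 2" "0 \<le> B" "B \<le> 1 / 4"
  shows "suspicious f A B"
  by (rule verify_sound[OF verify_covering assms(1)]) (use assms in auto)


section \<open>Motion near the critical point\<close>

text \<open>
  The critical point \<open>4 sqrt 69 / 23\<close>. Its class modulo the ring of integers is fixed by the fundamental unit.
\<close>

definition s :: real where "s = 4 * rt / 23"

text \<open>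
  Coordinates centred at the critical point. Multiplication by \<open>eps\<close> acts on them as the hyperbolic map
  \<open>(u, v) \<mapsto> (eps u, v / eps)\<close>; translating the point back to the critical one moves the class by 10.
\<close>

definition st :: "int \<Rightarrow> real \<Rightarrow> real \<Rightarrow> bool" where
  "st f u v \<longleftrightarrow> bad f (s + u) (- s + v)"

lemma st_cong: "23 dvd (f - g) \<Longrightarrow> st f u v \<Longrightarrow> st g u v"
  unfolding st_def by (rule bad_cong_class)

lemma st_mirror: "st f u v \<Longrightarrow> st (- f) (- v) (- u)"
  unfolding st_def using bad_conj[OF bad_minus, of f "s + u" "- s + v"] by (simp add: algebra_simps)

lemma eps_s: "eps * s = s + (of_int 36 + of_int 4 * rt) / 2" "eps' * s = s + (- of_int 36 + of_int 4 * rt) / 2"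
  by (simp_all add: eps_def eps'_def s_def field_simps)

lemma st_fwd:
  assumes "st f u v"
  shows "st (f + 10) (eps * u) (eps' * v)"
proof -
  have "bad f (eps * (s + u)) (eps' * (- s + v))"
    using bad_eps[OF assms[unfolded st_def]] .
  from bad_shift[OF this, of 36 4] have "bad (f - 36) (eps * (s + u) - (36 + 4 * rt) / 2) (eps' * (- s + v) - (36 - 4 * rt) / 2)"
    by simp
  moreover have "eps * (s + u) - (36 + 4 * rt) / 2 = s + eps * u" "eps' * (- s + v) - (36 - 4 * rt) / 2 = - s + eps' * v"
    by (simp_all only: distrib_left mult_minus_right eps_s)
       (simp_all add: add_divide_distrib diff_divide_distrib)
  ultimately have "bad (f - 36) (s + eps * u) (- s + eps' * v)" by simp
  then show ?thesis unfolding st_def by (rule bad_cong_class[rotated]) simp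
qed

lemma st_bwd: "st f u v \<Longrightarrow> st (f - 10) (eps' * u) (eps * v)"
  using st_mirror[OF st_fwd[OF st_mirror[of f u v]]] by simp

lemmas num = s_def of_int_numeral of_int_minus of_int_0 of_int_1

text \<open>
  An integer whose norm distance is visibly less than \<open>kap\<close> must lie in the excepted class.
\<close>

lemma st_class:
  assumes "st f u v" "even (a + b)"
    "s + u - of_int a / 2 - of_int b * rt / 2 \<le> M" "- M \<le> s + u - of_int a / 2 - of_int b * rt / 2"
    "- s + v - of_int a / 2 + of_int b * rt / 2 \<le> M'" "- M' \<le> - s + v - of_int a / 2 + of_int b * rt / 2"
    "M * M' < 99985 / 100000"
  shows "23 dvd (a - f)"
proof (rule ccontr)
  assume "\<not> 23 dvd (a - f)"
  note k = badD[OF assms(1)[unfolded st_def] assms(2) this]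
  have "kap \<le> \<bar>s + u - of_int a / 2 - of_int b * rt / 2\<bar> * \<bar>- s + v - of_int a / 2 + of_int b * rt / 2\<bar>"
  proof -
    have "s + u - (of_int a + of_int b * rt) / 2 = s + u - of_int a / 2 - of_int b * rt / 2"
      "- s + v - (of_int a - of_int b * rt) / 2 = - s + v - of_int a / 2 + of_int b * rt / 2"
      by (simp_all add: add_divide_distrib diff_divide_distrib)
    then show ?thesis using k by (simp only: abs_mult)
  qed
  also have "\<dots> \<le> M * M'"
    by (rule mult_mono) (use assms(3-6) in linarith)+
  finally show False using kap_bounds assms(7) by linarith
qed

text \<open>
  The step of a march along the unstable line: an integer of a wrong class that is close to the whole segment from
  \<open>l\<close> to \<open>h\<close> pushes \<open>u\<close> beyond \<open>h\<close>.
\<close>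

lemma st_skip:
  assumes "st f u v" "\<bar>v\<bar> \<le> 24 / 10000" "23 dvd (f - g)" "l \<le> u" "even (a + b)" "(a - g) mod 23 \<noteq> 0"
    "s + h - of_int a / 2 - of_int b * rt / 2 \<le> M" "- M \<le> s + l - of_int a / 2 - of_int b * rt / 2"
    "- s + 24 / 10000 - of_int a / 2 + of_int b * rt / 2 \<le> M'"
    "- M' \<le> - s - 24 / 10000 - of_int a / 2 + of_int b * rt / 2"
    "M * M' < 99985 / 100000"
  shows "h < u"
proof (rule ccontr)
  assume "\<not> h < u"
  then have "23 dvd (a - f)"
    by (intro st_class[OF assms(1,5) _ _ _ _ assms(11)]) (use assms in linarith)+
  from dvd_add[OF this assms(3)] show False using assms(6) by (simp add: mod_eq_0_iff_dvd)
qed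

text \<open>
  Each step of the march names an integer, the end of its segment and bounds for the two coordinates of the distance.
  Integers with large coordinates serve short segments only, since one coordinate of their distance is large.
\<close>

lemma exit_right_18:
  assumes st: "st f u v" and v: "\<bar>v\<bar> \<le> 24 / 10000" and f: "23 dvd (f - 18)" and u: "2 / 100 \<le> u"
  shows "27 / 100 < u"
proof -
  have h0: "3335 / 100000 < u"
    by (rule st_skip[OF st v f u(1), of "86" "-10" "3335 / 100000" "11101 / 1000000" "859802 / 10000"], simp, simp)
       (use rt_bounds in \<open>unfold num, linarith+\<close>)
  have h1: "3918 / 100000 < u"
    by (rule st_skip[OF st v f less_imp_le[OF h0], of "302" "-36" "3918 / 100000" "30399 / 10000000" "3019664 / 10000"], simp, simp)
       (use rt_bounds in \<open>unfold num, linarith+\<close>)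
  have h2: "5562 / 100000 < u"
    by (rule st_skip[OF st v f less_imp_le[OF h1], of "-105" "13" "5562 / 100000" "9246 / 1000000" "1050509 / 10000"], simp, simp)
       (use rt_bounds in \<open>unfold num, linarith+\<close>)
  have h3: "7128 / 100000 < u"
    by (rule st_skip[OF st v f less_imp_le[OF h2], of "111" "-13" "7128 / 100000" "8966 / 1000000" "1109402 / 10000"], simp, simp)
       (use rt_bounds in \<open>unfold num, linarith+\<close>)
  have h4: "7699 / 100000 < u"
    by (rule st_skip[OF st v f less_imp_le[OF h3], of "-296" "36" "7699 / 100000" "332 / 100000" "2960771 / 10000"], simp, simp)
       (use rt_bounds in \<open>unfold num, linarith+\<close>)
  have h5: "9799 / 100000 < u"
    by (rule st_skip[OF st v f less_imp_le[OF h4], of "-80" "10" "9799 / 100000" "115 / 10000" "80091 / 1000"], simp, simp)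
       (use rt_bounds in \<open>unfold num, linarith+\<close>)
  have h6: "10956 / 100000 < u"
    by (rule st_skip[OF st v f less_imp_le[OF h5], of "136" "-16" "10956 / 100000" "7182 / 1000000" "1359001 / 10000"], simp, simp)
       (use rt_bounds in \<open>unfold num, linarith+\<close>)
  have h7: "11021 / 100000 < u"
    by (rule st_skip[OF st v f less_imp_le[OF h6], of "-2140" "258" "11021 / 100000" "362 / 1000000" "21401123 / 10000"], simp, simp)
       (use rt_bounds in \<open>unfold num, linarith+\<close>)
  have h8: "110565 / 1000000 < u"
    by (rule st_skip[OF st v f less_imp_le[OF h7], of "3251" "-391" "110565 / 1000000" "1947 / 10000000" "32508921 / 10000"], simp, simp)
       (use rt_bounds in \<open>unfold num, linarith+\<close>)
  have h9: "14108 / 100000 < u"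
    by (rule st_skip[OF st v f less_imp_le[OF h8], of "-55" "7" "14108 / 100000" "17989 / 1000000" "551311 / 10000"], simp, simp)
       (use rt_bounds in \<open>unfold num, linarith+\<close>)
  have h10: "19994 / 100000 < u"
    by (rule st_skip[OF st v f less_imp_le[OF h9], of "-30" "4" "19994 / 100000" "31324 / 1000000" "301711 / 10000"], simp, simp)
       (use rt_bounds in \<open>unfold num, linarith+\<close>)
  have h11: "27 / 100 < u"
    by (rule st_skip[OF st v f less_imp_le[OF h10], of "20" "-2" "27 / 100" "48807 / 1000000" "197538 / 10000"], simp, simp)
       (use rt_bounds in \<open>unfold num, linarith+\<close>)
  show ?thesis by (rule h11)
qed

lemma exit_right_4:
  assumes st: "st f u v" and v: "\<bar>v\<bar> \<le> 24 / 10000" and f: "23 dvd (f - 4)" and u: "4 / 10 \<le> u" "u \<le> 1 / 2"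
  shows "4173 / 10000 < u \<and> u < 4213 / 10000"
proof (intro conjI)
  have h0: "40307 / 100000 < u"
    by (rule st_skip[OF st v f u(1), of "-96" "12" "40307 / 100000" "7958 / 1000000" "963976 / 10000"], simp, simp)
       (use rt_bounds in \<open>unfold num, linarith+\<close>)
  have h1: "41735 / 100000 < u"
    by (rule st_skip[OF st v f less_imp_le[OF h0], of "120" "-14" "41735 / 100000" "8348 / 1000000" "1195935 / 10000"], simp, simp)
       (use rt_bounds in \<open>unfold num, linarith+\<close>)
  show "4173 / 10000 < u" using h1 by linarith
  show "u < 4213 / 10000"
  proof (rule ccontr)
    assume "\<not> ?thesis"
    then have g: "42119 / 100000 \<le> u" by linarith
    have k0: "44566 / 100000 < u"
      by (rule st_skip[OF st v f g, of "-71" "9" "44566 / 100000" "13988 / 1000000" "714377 / 10000"], simp, simp)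
         (use rt_bounds in \<open>unfold num, linarith+\<close>)
    have k1: "45486 / 100000 < u"
      by (rule st_skip[OF st v f less_imp_le[OF k0], of "145" "-17" "45486 / 100000" "5794 / 1000000" "1445534 / 10000"], simp, simp)
         (use rt_bounds in \<open>unfold num, linarith+\<close>)
    have k2: "4843 / 10000 < u"
      by (rule st_skip[OF st v f less_imp_le[OF k1], of "-46" "6" "4843 / 10000" "20382 / 1000000" "464777 / 10000"], simp, simp)
         (use rt_bounds in \<open>unfold num, linarith+\<close>)
    have k3: "5 / 10 < u"
      by (rule st_skip[OF st v f less_imp_le[OF k2], of "5" "1" "5 / 10" "4724383 / 1000000" "2112 / 10000"], simp, simp)
         (use rt_bounds in \<open>unfold num, linarith+\<close>)
    show False using k3 u(2) by linarith
  qed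
qed

text \<open>
  A bad point that leaves the neighbourhood of the critical point to the right along the unstable line can only do so
  close to \<open>tt\<close>, the point at which the heteroclinic orbit leaves.
\<close>

lemma exit_right:
  assumes st: "st f u v" and v: "\<bar>v\<bar> \<le> (24 / 10000)" and u: "(2 / 100) \<le> u" "u \<le> (5 / 10)"
  shows "23 dvd (f - 4) \<and> (4173 / 10000) < u \<and> u < (4213 / 10000)"
proof -
  have c0: "23 dvd (-5 - f)" if "(2 / 100) \<le> u" "u \<le> (4 / 10)"
    by (rule st_class[OF st, of "-5" "1" "(1915 / 10000)" "(52113 / 10000)"], simp) (use that v rt_bounds in \<open>unfold num, linarith+\<close>)
  have c1: "23 dvd (4 - f)" if "(266 / 1000) \<le> u" "u \<le> (5 / 10)"
    by (rule st_class[OF st, of 4 0 "(29 / 100)" "(34475 / 10000)"], simp) (use that v rt_bounds in \<open>unfold num, linarith+\<close>)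
  show ?thesis
  proof (cases "u \<le> (4 / 10)")
    case True
    then have f: "23 dvd (f - 18)" using c0[OF u(1)] by presburger
    show ?thesis
    proof (cases "u \<le> (27 / 100)")
      case True
      then show ?thesis using exit_right_18[OF st v f u(1)] by linarith
    next
      case False
      then have "23 dvd (4 - f)" using c1 u(2) by linarith
      with f show ?thesis by presburger
    qed
  next
    case False
    then have "23 dvd (4 - f)" using c1 u(2) by linarith
    then have "23 dvd (f - 4)" by presburger
    then show ?thesis using exit_right_4[OF st v] False u(2) by simp
  qed
qed

lemma exit_left:
  assumes st: "st f u v" and v: "\<bar>v\<bar> \<le> (24 / 10000)" and u: "- (115 / 100) \<le> u" "u \<le> - (362 / 10000)"
  shows False
proof -
  have c0: "23 dvd (2 - f)" if "- (85 / 100) \<le> u" "u \<le> - (362 / 10000)"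
    by (rule st_class[OF st, of "2" "0" "(4085 / 10000)" "(24471 / 10000)"], simp) (use that v rt_bounds in \<open>unfold num, linarith+\<close>)
  have c1: "23 dvd (-2 - f)" if "- (115 / 100) \<le> u" "u \<le> - (21 / 100)"
    by (rule st_class[OF st, of "-2" "0" "(2235 / 1000)" "(4471 / 10000)"], simp) (use that v rt_bounds in \<open>unfold num, linarith+\<close>)
  have c2: "23 dvd (-14 - f)" if "-(21 / 100) \<le> u" "u \<le> -(12695 / 100000)"
    by (rule st_class[OF st, of "-14" "2" "(71995 / 1000000)" "(138645 / 10000)"], simp) (use that v rt_bounds in \<open>unfold num, linarith+\<close>)
  have c3: "23 dvd (11 - f)" if "-(12695 / 100000) \<le> u" "u \<le> -(36 / 1000)"
    by (rule st_class[OF st, of "11" "-1" "(61943 / 1000000)" "(111004 / 10000)"], simp) (use that v rt_bounds in \<open>unfold num, linarith+\<close>)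
  have c4: "23 dvd (0 - f)" if "-(115 / 100) \<le> u" "u \<le> -(85 / 100)"
    by (rule st_class[OF st, of "0" "0" "(594631 / 1000000)" "(14471 / 10000)"], simp) (use that v rt_bounds in \<open>unfold num, linarith+\<close>)
  consider "u \<le> - (85 / 100)" | "- (85 / 100) \<le> u" "u \<le> - (21 / 100)" | "- (21 / 100) \<le> u" "u \<le> -(12695 / 100000)" | "-(12695 / 100000) \<le> u"
    by linarith
  then show False
  proof cases
    case 1
    have "23 dvd (- 2 - f)" using 1 u c1 by linarith
    moreover have "23 dvd (0 - f)" using 1 u c4 by linarith
    ultimately show False by presburger
  next
    case 2
    have "23 dvd (- 2 - f)" using 2 u c1 by linarith
    moreover have "23 dvd (2 - f)" using 2 u c0 by linarith
    ultimately show False by presburger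
  next
    case 3
    have "23 dvd (- 14 - f)" using 3 u c2 by linarith
    moreover have "23 dvd (2 - f)" using 3 u c0 by linarith
    ultimately show False by presburger
  next
    case 4
    have "23 dvd (11 - f)" using 4 u c3 by linarith
    moreover have "23 dvd (2 - f)" using 4 u c0 by linarith
    ultimately show False by presburger
  qed
qed


text \<open>
  Multiplication by \<open>eps\<close> enlarges \<open>u\<close> about 25 times, so that \<open>u\<close> leaves every neighbourhood of 0; the starting
  range for \<open>u\<close> contains every value after a first exit from the interval between \<open>- 362 / 10000\<close> and \<open>2 / 100\<close>.
\<close>

lemma run_right:
  assumes "st f u v" "u \<noteq> 0" "- 115 / 100 \<le> u" "u \<le> 1 / 2" "\<bar>v\<bar> \<le> 24 / 10000"
  obtains j where "4173 / 10000 < eps ^ j * u" "eps ^ j * u < 4213 / 10000"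
    "st 4 (eps ^ j * u) (eps' ^ j * v)" "\<bar>eps' ^ j * v\<bar> \<le> 24 / 10000"
proof -
  have e1: "eps > 1" "eps > 0" and e2: "0 < eps'" "eps' < 1" using eps_bounds eps'_bounds by linarith+
  define calm where "calm = (\<lambda>x::real. - 362 / 10000 < x \<and> x < 2 / 100)"
  have "\<exists>j. \<not> calm (eps ^ j * u)"
  proof -
    obtain j where "1 / \<bar>u\<bar> < eps ^ j" using real_arch_pow[OF e1(1)] by blast
    then have "1 < \<bar>eps ^ j * u\<bar>" using assms(2) e1 by (simp add: abs_mult field_simps)
    then show ?thesis by (intro exI[of _ j]) (auto simp: calm_def)
  qed
  define j where "j = (LEAST j. \<not> calm (eps ^ j * u))"
  have j: "\<not> calm (eps ^ j * u)" unfolding j_def by (rule LeastI_ex) fact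
  have st: "st (f + 10 * int i) (eps ^ i * u) (eps' ^ i * v)" for i
  proof (induction i)
    case (Suc i)
    from st_fwd[OF Suc] show ?case by (simp add: algebra_simps)
  qed (use assms in simp)
  have v: "\<bar>eps' ^ j * v\<bar> \<le> 24 / 10000"
  proof -
    have "eps' ^ j \<le> 1" using e2 by (simp add: power_le_one)
    then have "eps' ^ j * \<bar>v\<bar> \<le> 1 * \<bar>v\<bar>" by (rule mult_right_mono) simp
    then show ?thesis using assms(5) e2 by (simp add: abs_mult)
  qed
  have rng: "- 115 / 100 \<le> eps ^ j * u \<and> eps ^ j * u \<le> 1 / 2"
  proof (cases j)
    case 0
    then show ?thesis using assms by simp
  next
    case (Suc i)
    have "calm (eps ^ i * u)" using not_less_Least[of i "\<lambda>j. \<not> calm (eps ^ j * u)"] Suc by (simp add: j_def)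
    then have c: "- 362 / 10000 < eps ^ i * u" "eps ^ i * u < 2 / 100" by (auto simp: calm_def)
    have "eps * (- 362 / 10000) \<le> eps * (eps ^ i * u)" "eps * (eps ^ i * u) \<le> eps * (2 / 100)"
      using c e1 by (intro mult_left_mono; simp)+
    then have "- 115 / 100 \<le> eps * (eps ^ i * u)" "eps * (eps ^ i * u) \<le> 1 / 2"
      using eps_bounds by linarith+
    then show ?thesis using Suc by (simp add: mult.assoc)
  qed
  have "\<not> eps ^ j * u \<le> - 362 / 10000"
    using exit_left[OF st v] rng by auto
  then have "2 / 100 \<le> eps ^ j * u" using j by (auto simp: calm_def)
  from exit_right[OF st v this] rng have ex: "23 dvd (f + 10 * int j - 4)" "4173 / 10000 < eps ^ j * u" "eps ^ j * u < 4213 / 10000"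
    by auto
  show ?thesis by (rule that[OF ex(2,3) st_cong[OF ex(1) st] v])
qed

text \<open>
  Since \<open>s + tt = (rt - 5) - s\<close>, the point with coordinates \<open>u = tt\<close>, \<open>v = 0\<close> has first coordinate congruent to \<open>- s\<close>
  and second coordinate equal to that of \<open>s\<close>. Its orbit is heteroclinic: backwards it tends to \<open>s\<close>, forwards to \<open>- s\<close>.
\<close>

definition tt :: real where "tt = 15 * rt / 23 - 5"

lemma eps_tt: "eps * tt = 5 + rt - 2 * s"
  by (simp add: eps_def s_def tt_def field_simps)

text \<open>
  The heteroclinic orbit is symmetric: the unit, a translation and conjugation combine to a map that fixes its exit point
  and reverses it.
\<close>

lemma st_reflect:
  assumes "st 4 a b"
  shows "st 4 (tt + eps' * b) (eps * (a - tt))"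
proof -
  have "bad 4 (eps * (s + a)) (eps' * (- s + b))"
    using bad_eps[OF assms[unfolded st_def]] .
  from bad_conj[OF bad_shift[OF this, of 46 6]]
  have "bad (4 - 46) (eps' * (- s + b) - (46 - 6 * rt) / 2) (eps * (s + a) - (46 + 6 * rt) / 2)"
    by simp
  moreover have "eps' * (- s + b) - (46 - 6 * rt) / 2 = s + (tt + eps' * b)"
    "eps * (s + a) - (46 + 6 * rt) / 2 = - s + eps * (a - tt)"
    by (simp_all only: distrib_left right_diff_distrib mult_minus_right eps_s eps_tt)
       (simp_all add: tt_def s_def add_divide_distrib diff_divide_distrib)
  ultimately have "bad (4 - 46) (s + (tt + eps' * b)) (- s + eps * (a - tt))" by simp
  then show ?thesis unfolding st_def by (rule bad_cong_class[rotated]) simp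
qed

section \<open>The heteroclinic point\<close>

text \<open>
  The absolute values of the two coordinates of the point with \<open>u = eps' * tt\<close>, \<open>v = 0\<close> (one step before the exit)
  relative to the integer \<open>(rt - 5) / 2\<close>. Their product is the constant \<open>kap\<close>, which originates here.
\<close>

definition PP :: real where "PP = rt / 2 - 5 / 2 - s - eps' * tt"
definition QQ :: real where "QQ = rt / 2 + 5 / 2 - s"

lemma PQ: "PP * QQ = kap"
  by (simp add: PP_def QQ_def eps'_def s_def tt_def kap_def field_simps)

lemma PQ_bounds: "19 / 100 < PP" "PP < 2 / 10" "52 / 10 < QQ" "QQ < 53 / 10"
proof -
  show "52 / 10 < QQ" "QQ < 53 / 10"
    using rt_bounds unfolding QQ_def s_def by linarith+
  have "eps' * tt = (25 - 3 * rt) / 2 * (15 * rt / 23 - 5)" by (simp add: eps'_def tt_def)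
  also have "\<dots> = (720 * rt - 5980) / 46 * 1" by (simp add: field_simps)
  finally have "eps' * tt = 720 * rt / 46 - 130" by (simp add: field_simps)
  then show "19 / 100 < PP" "PP < 2 / 10"
    using rt_bounds unfolding PP_def s_def by linarith+
qed

text \<open>
  The inequality that the integer \<open>(rt - 5) / 2\<close> imposes on a bad point near the heteroclinic point, where it is an
  equality.
\<close>

lemma sharp:
  assumes "st 4 a b" "eps * b < 0" "- 5 < eps * b" "\<bar>a - tt\<bar> < 1 / 100"
  shows "PP * QQ \<le> (PP + eps' * (tt - a)) * (QQ + eps * b)"
proof -
  \<comment> \<open>after one step backwards, \<open>(rt - 5) / 2\<close> has class \<open>- 5\<close>, different from the excepted class \<open>- 6\<close>\<close>
  have st: "st (4 - 10) (eps' * a) (eps * b)" by (rule st_bwd) fact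
  have "kap \<le> \<bar>(s + eps' * a - (of_int (- 5) + of_int 1 * rt) / 2) * (- s + eps * b - (of_int (- 5) - of_int 1 * rt) / 2)\<bar>"
    by (rule badD[OF st[unfolded st_def]]) simp_all
  also have "s + eps' * a - (of_int (- 5) + of_int 1 * rt) / 2 = - (PP + eps' * (tt - a))"
    by (simp add: PP_def right_diff_distrib add_divide_distrib diff_divide_distrib)
  also have "- s + eps * b - (of_int (- 5) - of_int 1 * rt) / 2 = QQ + eps * b"
    by (simp add: QQ_def add_divide_distrib diff_divide_distrib)
  also have "- (PP + eps' * (tt - a)) * (QQ + eps * b) = - ((PP + eps' * (tt - a)) * (QQ + eps * b))"
    by (rule mult_minus_left)
  also have "\<bar>- ((PP + eps' * (tt - a)) * (QQ + eps * b))\<bar> = (PP + eps' * (tt - a)) * (QQ + eps * b)"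
  proof -
    have "\<bar>eps' * (tt - a)\<bar> \<le> 1 * (1 / 100)" unfolding abs_mult
      using assms(4) eps'_bounds by (intro mult_mono) (auto simp: abs_minus_commute)
    then have "0 \<le> PP + eps' * (tt - a)" using PQ_bounds by linarith
    moreover have "0 \<le> QQ + eps * b" using PQ_bounds assms(3) by linarith
    ultimately show ?thesis by simp
  qed
  finally show ?thesis by (simp add: PQ)
qed

text \<open>
  Deviations \<open>\<delta> = tt - a\<close> and \<open>\<beta> = - b\<close> from the heteroclinic point satisfy the sharp inequality and its reflection.
  Running backwards shows \<open>\<beta> > 0\<close>, the first inequality then gives \<open>\<delta> > 0\<close>, and the product of the two inequalities
  bounds \<open>eps ^ 6\<close> by \<open>(QQ / PP)\<^sup>2\<close>, which is too small.
\<close>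

lemma no_exit:
  assumes st: "st 4 a b" and a: "4173 / 10000 < a" "a < 4213 / 10000" and b: "\<bar>b\<bar> \<le> 24 / 10000" "b \<noteq> 0"
  shows False
proof -
  have e: "0 < eps" "0 < eps'" using eps_bounds eps'_bounds by linarith+
  define b1 where "b1 = eps * b"
  have st1: "st (- 6) (eps' * a) b1" using st_bwd[OF st] by (simp add: b1_def)
  have u1: "167 / 10000 < eps' * a" "eps' * a < 169 / 10000"
  proof -
    have "400642 / 10000000 * (4173 / 10000) \<le> eps' * a" using eps'_bounds a by (intro mult_mono) auto
    then show "167 / 10000 < eps' * a" by simp
    have "eps' * a \<le> 400643 / 10000000 * (4213 / 10000)" using eps'_bounds a by (intro mult_mono) auto
    then show "eps' * a < 169 / 10000" by simp
  qed
  have b1: "\<bar>b1\<bar> \<le> 6 / 100"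
  proof -
    have "eps * \<bar>b\<bar> \<le> 25 * (24 / 10000)" using eps_bounds b by (intro mult_mono) auto
    then show ?thesis using e by (simp add: b1_def abs_mult)
  qed
  have lo: "- 18 / 1000 \<le> b1"
  proof (rule ccontr)
    assume n: "\<not> ?thesis"
    have "23 dvd (5 - (- 6 :: int))"
      by (rule st_class[OF st1, of 5 1 "52087 / 10000" "1907 / 10000"], simp)
         (use n b1 u1 rt_bounds in \<open>unfold num, linarith+\<close>)
    then show False by simp
  qed
  have hi: "b1 \<le> 107 / 10000"
  proof (rule ccontr)
    assume n: "\<not> ?thesis"
    have "23 dvd (- 11 - (- 6 :: int))"
      by (rule st_class[OF st1, of "- 11" "- 1" "11115 / 1000" "873 / 10000"], simp)
         (use n b1 u1 rt_bounds in \<open>unfold num, linarith+\<close>)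
    then show False by simp
  qed
  have "b < 0"
  proof -
    have st2: "st (- (- 6 - 10)) (- (eps * b1)) (- (eps' * (eps' * a)))"
      by (rule st_mirror[OF st_bwd[OF st1]])
    have "eps * (- 18 / 1000) \<le> eps * b1" "eps * b1 \<le> eps * (107 / 10000)"
      using lo hi e by (intro mult_left_mono; simp)+
    then have r: "- 115 / 100 \<le> - (eps * b1)" "- (eps * b1) \<le> 1 / 2"
      using eps_bounds by linarith+
    have "eps' * (eps' * a) \<le> 401 / 10000 * (169 / 10000)"
      using u1 eps'_bounds by (intro mult_mono) auto
    moreover have "0 \<le> eps' * (eps' * a)" using u1 eps'_bounds by simp
    ultimately have w: "\<bar>- (eps' * (eps' * a))\<bar> \<le> 24 / 10000" by simp
    have nz: "- (eps * b1) \<noteq> 0" using b(2) e by (simp add: b1_def)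
    obtain j where "4173 / 10000 < eps ^ j * - (eps * b1)"
      using run_right[OF st2 nz r w] by metis
    then have "0 < eps ^ j * - (eps * b1)" by linarith
    then have "0 < - (eps * b1)" by (rule zero_less_mult_pos) (use e in simp)
    then show "b < 0" using e unfolding b1_def by (simp add: zero_less_mult_iff mult_less_0_iff)
  qed
  define \<delta> where "\<delta> = tt - a"
  define \<beta> where "\<beta> = - b"
  have tt: "4173 / 10000 < tt" "tt < 4174 / 10000" using rt_bounds unfolding tt_def by linarith+
  have d: "\<bar>\<delta>\<bar> < 4 / 1000" using a tt unfolding \<delta>_def by linarith
  have \<beta>: "0 < \<beta>" using \<open>b < 0\<close> by (simp add: \<beta>_def)
  have i1: "PP * QQ \<le> (PP + eps' * \<delta>) * (QQ - eps * \<beta>)"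
    using sharp[OF st] \<open>b < 0\<close> e b1 d unfolding \<delta>_def \<beta>_def b1_def by (simp add: mult_pos_neg abs_minus_commute)
  have pos: "0 < QQ - eps * \<beta>" using PQ_bounds b1 unfolding b1_def \<beta>_def by (simp; linarith)
  have \<delta>: "0 < \<delta>"
  proof (rule ccontr)
    assume "\<not> 0 < \<delta>"
    then have "(PP + eps' * \<delta>) * (QQ - eps * \<beta>) \<le> PP * (QQ - eps * \<beta>)"
      using pos e by (intro mult_right_mono) (auto simp: mult_le_0_iff)
    also have "\<dots> < PP * QQ" using PQ_bounds e \<beta> by (intro mult_strict_left_mono) auto
    finally show False using i1 by linarith
  qed
  have i2: "PP * QQ \<le> (PP + eps' * (eps' * \<beta>)) * (QQ - eps * (eps * \<delta>))"
  proof -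
    have "st 4 (tt + eps' * b) (eps * (a - tt))" by (rule st_reflect) fact
    moreover have "eps * (eps * (a - tt)) < 0" using \<delta> e unfolding \<delta>_def by (simp add: mult_pos_neg)
    moreover have "- 5 < eps * (eps * (a - tt))"
    proof -
      have "eps * (eps * \<delta>) \<le> 25 * (25 * (4 / 1000))"
        using d eps_bounds \<delta> by (intro mult_mono) auto
      then show ?thesis unfolding \<delta>_def by (simp add: algebra_simps)
    qed
    moreover have "\<bar>(tt + eps' * b) - tt\<bar> < 1 / 100"
    proof -
      have "eps' * \<bar>b\<bar> \<le> 1 * (24 / 10000)" using eps'_bounds b by (intro mult_mono) auto
      then show ?thesis using e by (simp add: abs_mult)
    qed
    ultimately have "PP * QQ \<le> (PP + eps' * (tt - (tt + eps' * b))) * (QQ + eps * (eps * (a - tt)))"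
      by (rule sharp)
    then show ?thesis unfolding \<delta>_def \<beta>_def by (simp add: algebra_simps)
  qed
  \<comment> \<open>in both inequalities the quadratic term has the favourable sign and is dropped\<close>
  have j1: "PP * (eps * \<beta>) \<le> eps' * \<delta> * QQ"
  proof -
    have "0 \<le> eps' * \<delta> * (eps * \<beta>)" using e \<delta> \<beta> by simp
    then show ?thesis using i1 by (simp add: algebra_simps)
  qed
  have j2: "PP * (eps * (eps * \<delta>)) \<le> eps' * (eps' * \<beta>) * QQ"
  proof -
    have "0 \<le> eps' * (eps' * \<beta>) * (eps * (eps * \<delta>))" using e \<delta> \<beta> by simp
    then show ?thesis using i2 by (simp add: algebra_simps)
  qed
  have "PP * (eps * \<beta>) * (PP * (eps * (eps * \<delta>))) \<le> eps' * \<delta> * QQ * (eps' * (eps' * \<beta>) * QQ)"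
    by (rule mult_mono[OF j1 j2]) (use PQ_bounds e \<beta> \<delta> in auto)
  then have "(PP * PP * eps ^ 3) * (\<beta> * \<delta>) \<le> (QQ * QQ * eps' ^ 3) * (\<beta> * \<delta>)"
    by (simp add: algebra_simps power3_eq_cube)
  then have "PP * PP * eps ^ 3 \<le> QQ * QQ * eps' ^ 3" using \<beta> \<delta> by simp
  moreover have "QQ * QQ * eps' ^ 3 \<le> (53/10 * (53/10)) * 1 ^ 3"
    using PQ_bounds eps'_bounds by (intro mult_mono power_mono) auto
  moreover have "19/100 * (19/100) * 24 ^ 3 \<le> PP * PP * eps ^ 3"
    using PQ_bounds eps_bounds by (intro mult_mono power_mono) auto
  ultimately show False by simp
qed

lemma no_state:
  assumes "st f u v" "u \<noteq> 0" "v \<noteq> 0" "- 115 / 100 \<le> u" "u \<le> 1 / 2" "\<bar>v\<bar> \<le> 24 / 10000"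
  shows False
proof -
  obtain j where j: "4173 / 10000 < eps ^ j * u" "eps ^ j * u < 4213 / 10000"
    "st 4 (eps ^ j * u) (eps' ^ j * v)" "\<bar>eps' ^ j * v\<bar> \<le> 24 / 10000"
    using run_right[OF assms(1,2,4,5,6)] by metis
  have "eps' ^ j * v \<noteq> 0" using assms(3) eps'_bounds by simp
  from no_exit[OF j(3,1,2,4) this] show False .
qed

section \<open>The bad points of the field\<close>

lemma near_abs_le: "eps' * \<bar>w\<bar> \<le> 24 / 10000 \<Longrightarrow> \<bar>eps' * w\<bar> \<le> 24 / 10000"
  using eps'_bounds by (simp add: abs_mult)

lemma suspicious_uv:
  assumes "st f u v" "0 \<le> u + v" "u + v \<le> 1" "- 288 / 100 \<le> u - v" "u - v \<le> 7 / 46 * rt"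
  shows "(u + v \<le> 625 / 10000 \<and> - 501 / 10000 \<le> u - v \<and> u - v \<le> 473 / 10000) \<or>
    u - v \<le> - 28 / 10 \<or>
    (23 dvd (f - 18) \<and> u + v \<le> 21875 / 100000 \<and> - 664 / 10000 \<le> u - v \<and> u - v \<le> 2258 / 10000) \<or>
    (23 dvd (f - 4) \<and> 3788 / 10000 \<le> u + v \<and> u + v \<le> 4922 / 10000 \<and> 339 / 1000 \<le> u - v \<and> u - v \<le> 4854 / 10000)"
proof -
  define A where "A = u / 2 + v / 2"
  define B where "B = 4 / 23 + (u - v) / (2 * rt)"
  have rt0: "0 < rt" by simp
  have sumA: "u + v = 2 * A" by (simp add: A_def)
  have Brt: "B * rt = s + (u - v) / 2" using rt0 by (simp add: B_def s_def distrib_right)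
  have AB: "A + B * rt = s + u" "A - B * rt = - s + v"
    unfolding Brt by (simp_all add: A_def add_divide_distrib diff_divide_distrib)
  have uv: "u - v = 2 * rt * (B - 4 / 23)" using rt0 by (simp add: B_def)
  have le: "c \<le> 2048 * B \<longleftrightarrow> c / 1024 * rt - 8 / 23 * rt \<le> u - v"
    and ge: "2048 * B \<le> c \<longleftrightarrow> u - v \<le> c / 1024 * rt - 8 / 23 * rt" for c
  proof -
    have "c / 1024 * rt - 8 / 23 * rt = 2 * rt * (c / 2048 - 4 / 23)" by (simp add: right_diff_distrib)
    then show "c \<le> 2048 * B \<longleftrightarrow> c / 1024 * rt - 8 / 23 * rt \<le> u - v"
      "2048 * B \<le> c \<longleftrightarrow> u - v \<le> c / 1024 * rt - 8 / 23 * rt"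
      unfolding uv using rt0 by (simp_all add: mult.commute)
  qed
  have "0 \<le> 2048 * B" unfolding le using assms(4) rt_bounds by linarith
  moreover have "2048 * B \<le> 512" unfolding ge using assms(5) rt_bounds by linarith
  moreover have "bad f (A + B * rt) (A - B * rt)" using assms(1) unfolding AB st_def .
  ultimately have "suspicious f A B"
    using assms(2,3) by (intro bad_suspicious) (auto simp: A_def)
  then show ?thesis
    unfolding suspicious_def
  proof (elim disjE conjE)
    assume "1024 * A \<le> 32" "350 \<le> 2048 * B" "2048 * B \<le> 362"
    then have "- 501 / 10000 \<le> u - v \<and> u - v \<le> 473 / 10000" "u + v \<le> 625 / 10000"
      unfolding le ge using rt_bounds sumA by linarith+
    then show ?thesis by blast
  next
    assume "2048 * B \<le> 4"
    then have "u - v \<le> - 28 / 10" unfolding le ge using rt_bounds by linarith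
    then show ?thesis by blast
  next
    assume "23 dvd (f - 18)" "1024 * A \<le> 112" "348 \<le> 2048 * B" "2048 * B \<le> 384"
    moreover from this have "- 664 / 10000 \<le> u - v \<and> u - v \<le> 2258 / 10000" "u + v \<le> 21875 / 100000"
      unfolding le ge using rt_bounds sumA by linarith+
    ultimately show ?thesis by blast
  next
    assume "23 dvd (f - 4)" "194 \<le> 1024 * A" "1024 * A \<le> 252" "398 \<le> 2048 * B" "2048 * B \<le> 416"
    moreover from this have "339 / 1000 \<le> u - v \<and> u - v \<le> 4854 / 10000"
      "3788 / 10000 \<le> u + v" "u + v \<le> 4922 / 10000"
      unfolding le ge using rt_bounds sumA by linarith+
    ultimately show ?thesis by blast
  qed
qed

text \<open>
  The certificate at the point, or at its mirror image if \<open>u + v < 0\<close>: outside the three classes that allow another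
  region, a bad point near the stable line is close to the critical point itself.
\<close>

lemma stable_arm:
  assumes st: "st f u v" and u: "- 32 / 10000 \<le> u" "u \<le> 202 / 10000" and v: "- 46 / 100 \<le> v" "v \<le> 6 / 10"
    and f: "\<not> 23 dvd (f - 18)" "\<not> 23 dvd (f - 5)" "\<not> 23 dvd (f - 19)"
  shows "\<bar>v\<bar> \<le> 58 / 1000"
proof (cases "0 \<le> u + v")
  case True
  from suspicious_uv[OF st True] u v f(1) rt_bounds have "(u + v \<le> 625 / 10000 \<and> - 501 / 10000 \<le> u - v) \<or> 339 / 1000 \<le> u - v"
    by linarith
  then show ?thesis using u True v by linarith
next
  case False
  have "st (- f) (- v) (- u)" by (rule st_mirror) fact
  from suspicious_uv[OF this] u v False rt_bounds
  have "(- v - u \<le> 625 / 10000 \<and> - v + u \<le> 473 / 10000) \<or> 23 dvd (- f - 18) \<or> 23 dvd (- f - 4)"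
    by linarith
  moreover have "\<not> 23 dvd (- f - 18)" "\<not> 23 dvd (- f - 4)"
    using f(2,3) by presburger+
  ultimately show ?thesis using u False v by linarith
qed

text \<open>
  One step backwards brings a point of the unstable arm to the stable line, where \<open>stable_arm\<close> applies; stepping
  forwards again divides the bound for \<open>v\<close> by about 25.
\<close>

lemma arm_state:
  assumes st: "st f u v" and u: "- 75 / 1000 \<le> u" "u \<le> 1 / 2" and v: "- 18 / 1000 \<le> v" "v \<le> 24 / 1000"
    and f: "23 dvd (f - 18) \<or> 23 dvd (f - 4) \<or> 23 dvd (f - 2)"
  shows "\<bar>v\<bar> \<le> 24 / 10000"
proof -
  have e: "0 < eps" "0 < eps'" using eps_bounds eps'_bounds by linarith+
  have st1: "st (f - 10) (eps' * u) (eps * v)" by (rule st_bwd) fact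
  have "eps' * (- 75 / 1000) \<le> eps' * u" "eps' * u \<le> eps' * (1 / 2)"
    using u e by (intro mult_left_mono; simp)+
  then have u1: "- 31 / 10000 \<le> eps' * u" "eps' * u \<le> 201 / 10000" using eps'_bounds by linarith+
  have "eps * (- 18 / 1000) \<le> eps * v" "eps * v \<le> eps * (24 / 1000)"
    using v e by (intro mult_left_mono; simp)+
  then have v1: "- 46 / 100 \<le> eps * v" "eps * v \<le> 6 / 10" using eps_bounds by linarith+
  have f1: "\<not> 23 dvd (f - 10 - 18)" "\<not> 23 dvd (f - 10 - 5)" "\<not> 23 dvd (f - 10 - 19)"
    using f by presburger+
  have "\<bar>eps * v\<bar> \<le> 58 / 1000"
    by (rule stable_arm[OF st1 _ _ v1 f1]) (use u1 in simp_all)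
  then have "eps' * \<bar>eps * v\<bar> \<le> 401 / 10000 * (58 / 1000)" using eps'_bounds by (intro mult_mono) auto
  then have "eps' * \<bar>eps * v\<bar> \<le> 24 / 10000" by simp
  then have "\<bar>eps' * (eps * v)\<bar> \<le> 24 / 10000" by (rule near_abs_le)
  then show ?thesis by (simp flip: mult.assoc)
qed

text \<open>
  In each region of the certificate other than the one around 0, a few explicit integers confine the point or its
  successor to the thin strip excluded by \<open>no_state\<close>.
\<close>

lemma bad_near_cycle:
  assumes st: "st f u v" and nz: "u \<noteq> 0" "v \<noteq> 0"
    and r: "0 \<le> u + v" "u + v \<le> 1" "- 28 / 10 < u - v" "u - v \<le> 7 / 46 * rt"
  shows False
proof -
  have e: "0 < eps" "0 < eps'" using eps_bounds eps'_bounds by linarith+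
  from suspicious_uv[OF st r(1,2) _ r(4)] r(3)
  consider (c) "u + v \<le> 625 / 10000" "- 501 / 10000 \<le> u - v" "u - v \<le> 473 / 10000"
    | (x) "23 dvd (f - 18)" "u + v \<le> 21875 / 100000" "- 664 / 10000 \<le> u - v" "u - v \<le> 2258 / 10000"
    | (q) "23 dvd (f - 4)" "3788 / 10000 \<le> u + v" "u + v \<le> 4922 / 10000" "339 / 1000 \<le> u - v" "u - v \<le> 4854 / 10000"
    by linarith
  then show False
  proof cases
    case c
    show False
    proof (cases "23 dvd (f - 18) \<or> 23 dvd (f - 2)")
      case True
      have "- 18 / 1000 \<le> v"
      proof (rule ccontr)
        assume n: "\<not> ?thesis"
        have "23 dvd (5 - f)"
          by (rule st_class[OF st, of 5 1 "52338 / 10000" "1907 / 10000"], simp)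
             (use n c r(1) rt_bounds in \<open>unfold num, linarith+\<close>)
        then show False using True by presburger
      qed
      moreover have "v \<le> 107 / 10000"
      proof (rule ccontr)
        assume n: "\<not> ?thesis"
        have "23 dvd (- 11 - f)"
          by (rule st_class[OF st, of "- 11" "- 1" "1116 / 100" "873 / 10000"], simp)
             (use n c r(1) rt_bounds in \<open>unfold num, linarith+\<close>)
        then show False using True by presburger
      qed
      ultimately have v: "\<bar>v\<bar> \<le> 24 / 10000"
        by (intro arm_state[OF st]) (use c r(1) True in auto)
      show False
        by (rule no_state[OF st nz _ _ v]) (use c r(1) in linarith)+
    next
      case False
      have "- 45 / 1000 \<le> u"
      proof (rule ccontr)
        assume n: "\<not> ?thesis"
        have "23 dvd (2 - f)"
          by (rule st_class[OF st, of 2 0 "3998 / 10000" "25 / 10"], simp)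
             (use n c r(1) rt_bounds in \<open>unfold num, linarith+\<close>)
        then show False using False by presburger
      qed
      have "u \<le> 2 / 100"
      proof (rule ccontr)
        assume n: "\<not> ?thesis"
        have "23 dvd (- 5 - f)"
          by (rule st_class[OF st, of "- 5" 1 "1888 / 10000" "5266 / 1000"], simp)
             (use n c r(1) rt_bounds in \<open>unfold num, linarith+\<close>)
        then show False using False by presburger
      qed
      have "eps * (- 45 / 1000) \<le> eps * u" "eps * u \<le> eps * (2 / 100)"
        using \<open>- 45 / 1000 \<le> u\<close> \<open>u \<le> 2 / 100\<close> e by (intro mult_left_mono; simp)+
      then have u1: "- 115 / 100 \<le> eps * u" "eps * u \<le> 1 / 2" using eps_bounds by linarith+
      have "eps' * \<bar>v\<bar> \<le> 401 / 10000 * (57 / 1000)"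
        using c r(1) eps'_bounds by (intro mult_mono) auto
      then have "eps' * \<bar>v\<bar> \<le> 24 / 10000" by simp
      then have v1: "\<bar>eps' * v\<bar> \<le> 24 / 10000" by (rule near_abs_le)
      have "eps * u \<noteq> 0" "eps' * v \<noteq> 0" using nz e by simp_all
      from no_state[OF st_fwd[OF st] this u1 v1] show False .
    qed
  next
    case x
    have "- 18 / 1000 \<le> v"
    proof (rule ccontr)
      assume n: "\<not> ?thesis"
      have "23 dvd (5 - f)"
        by (rule st_class[OF st, of 5 1 "5242 / 1000" "1907 / 10000"], simp)
           (use n x r(1) rt_bounds in \<open>unfold num, linarith+\<close>)
      then show False using x(1) by presburger
    qed
    moreover have "v \<le> 107 / 10000"
    proof (rule ccontr)
      assume n: "\<not> ?thesis"
      have "23 dvd (- 11 - f)"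
        by (rule st_class[OF st, of "- 11" "- 1" "1133 / 100" "873 / 10000"], simp)
           (use n x r(1) rt_bounds in \<open>unfold num, linarith+\<close>)
      then show False using x(1) by presburger
    qed
    ultimately have v: "\<bar>v\<bar> \<le> 24 / 10000"
      by (intro arm_state[OF st]) (use x r(1) in auto)
    show False
      by (rule no_state[OF st nz _ _ v]) (use x r(1) in linarith)+
  next
    case q
    have "- 18 / 1000 \<le> v"
    proof (rule ccontr)
      assume n: "\<not> ?thesis"
      have "23 dvd (5 - f)"
        by (rule st_class[OF st, of 5 1 "5 / 1" "1907 / 10000"], simp)
           (use n q r(1) rt_bounds in \<open>unfold num, linarith+\<close>)
      then show False using q(1) by presburger
    qed
    moreover have "v \<le> 15 / 1000"
    proof (rule ccontr)
      assume n: "\<not> ?thesis"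
      have "23 dvd (- 11 - f)"
        by (rule st_class[OF st, of "- 11" "- 1" "116 / 10" "83 / 1000"], simp)
           (use n q r(1) rt_bounds in \<open>unfold num, linarith+\<close>)
      then show False using q(1) by presburger
    qed
    ultimately have v: "\<bar>v\<bar> \<le> 24 / 10000"
      by (intro arm_state[OF st]) (use q r(1) in auto)
    show False
      by (rule no_state[OF st nz _ _ v]) (use q r(1) in linarith)+
  qed
qed

text \<open>
  Multiplication by \<open>eps\<close> moves the point away from 0 along the expanding direction until the integer 1, which is not in
  the excepted class, is close to it.
\<close>

lemma bad_near_lattice:
  assumes bad: "bad f x y" and f: "23 dvd f" and x: "0 < x" "x \<le> 205 / 10000" and y: "\<bar>y\<bar> \<le> 205 / 10000"
  shows False
proof -
  have e1: "eps > 1" "eps > 0" and e2: "0 < eps'" "eps' < 1" using eps_bounds eps'_bounds by linarith+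
  have "\<exists>j. \<not> eps ^ j * x \<le> 205 / 10000"
  proof -
    obtain j where "1 / x < eps ^ j" using real_arch_pow[OF e1(1)] by blast
    then have "1 < eps ^ j * x" using x by (simp add: field_simps)
    then show ?thesis by (intro exI[of _ j]) auto
  qed
  define j where "j = (LEAST j. \<not> eps ^ j * x \<le> 205 / 10000)"
  have j: "205 / 10000 < eps ^ j * x"
    using LeastI_ex[OF \<open>\<exists>j. \<not> eps ^ j * x \<le> 205 / 10000\<close>] unfolding j_def by simp
  have b: "bad f (eps ^ i * x) (eps' ^ i * y)" for i
    by (induction i) (use bad bad_eps in \<open>auto simp: mult.assoc\<close>)
  obtain i where i: "j = Suc i" using j x(2) by (cases j) auto
  then have "eps ^ i * x \<le> 205 / 10000"
    using not_less_Least[of i "\<lambda>j. \<not> eps ^ j * x \<le> 205 / 10000"] by (simp add: j_def)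
  then have "eps * (eps ^ i * x) \<le> eps * (205 / 10000)" using e1 by (intro mult_left_mono) auto
  then have "eps * (eps ^ i * x) \<le> 1" using eps_bounds by linarith
  then have hi: "eps ^ j * x \<le> 1" using i by (simp add: mult.assoc)
  have "eps' * \<bar>eps' ^ i * y\<bar> \<le> 1 / 20 * (205 / 10000)"
  proof (rule mult_mono)
    have "eps' ^ i * \<bar>y\<bar> \<le> 1 * (205 / 10000)" using y e2 by (intro mult_mono) (auto simp: power_le_one)
    then show "\<bar>eps' ^ i * y\<bar> \<le> 205 / 10000" using e2 by (simp add: abs_mult)
  qed (use eps'_bounds in auto)
  then have y': "\<bar>eps' ^ j * y\<bar> \<le> 205 / 200000" using i e2 by (simp add: abs_mult mult.assoc)
  have "\<not> 23 dvd (2 - f)"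
  proof
    assume "23 dvd (2 - f)"
    from dvd_add[OF this f] show False by simp
  qed
  then have "kap \<le> \<bar>(eps ^ j * x - (of_int 2 + of_int 0 * rt) / 2) * (eps' ^ j * y - (of_int 2 - of_int 0 * rt) / 2)\<bar>"
    by (intro badD[OF b]) auto
  also have "\<dots> \<le> (9795 / 10000) * (201 / 200)" unfolding abs_mult
    by (intro mult_mono) (use j hi y' in auto)
  finally show False using kap_bounds by linarith
qed

lemma rt_irrational:
  assumes "A \<in> \<rat>" "B \<in> \<rat>" "A + B * rt = 0"
  shows "A = 0 \<and> B = 0"
proof (cases "B = 0")
  case False
  then have "rt = - A / B" using assms(3) by (simp add: field_simps)
  then have "rt \<in> \<rat>" using assms by simp
  then obtain m n :: nat where mn: "n \<noteq> 0" "\<bar>rt\<bar> = real m / real n" "coprime m n"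
    by (rule Rats_abs_nat_div_natE)
  then have "real m = rt * real n" by (simp add: field_simps)
  then have "real m ^ 2 = 69 * real n ^ 2" by (simp add: power_mult_distrib)
  then have "real (m ^ 2) = real (69 * n ^ 2)" by simp
  then have eq: "m ^ 2 = 69 * n ^ 2" unfolding of_nat_eq_iff .
  have "(3::nat) dvd m ^ 2" unfolding eq by (rule dvd_mult2) simp
  then have "3 dvd m" by (rule prime_dvd_power_nat[rotated]) simp
  then obtain k where k: "m = 3 * k" by blast
  then have "3 * k ^ 2 = 23 * n ^ 2" using eq by (simp add: power_mult_distrib)
  then have "3 dvd 23 * n ^ 2" by (metis dvd_triv_left)
  moreover have "3 dvd 23 * b \<Longrightarrow> 3 dvd b" for b :: nat by presburger
  ultimately have "3 dvd n ^ 2" by blast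
  then have "3 dvd n" by (rule prime_dvd_power_nat[rotated]) simp
  then show ?thesis using \<open>3 dvd m\<close> mn(3) by (metis coprime_common_divisor_nat numeral_eq_one_iff semiring_norm(86))
qed (use assms in simp)

text \<open>
  Translation and the reflections reduce to the rectangle of the certificate. A bad point there lies on one of the
  two axes through the critical point or the origin, and an axis contains only one point with rational coordinates.
\<close>

theorem bad_rational:
  assumes bad: "bad f (A + B * rt) (A - B * rt)" and rat: "A \<in> \<rat>" "B \<in> \<rat>"
  shows "\<exists>a b k::int. even (a + b) \<and> k \<in> {- 1, 0, 1} \<and> A = a / 2 \<and> B = b / 2 + 4 * k / 23"
proof -
  define b0 where "b0 = round (2 * B)"
  define B1 where "B1 = B - b0 / 2"
  define a1 where "a1 = round (A - b0 / 2)"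
  define a0 where "a0 = b0 + 2 * a1"
  define A1 where "A1 = A - a0 / 2"
  have ev: "even (a0 + b0)" by (simp add: a0_def)
  have "\<bar>2 * B - b0\<bar> \<le> 1 / 2" using of_int_round_abs_le[of "2 * B"] by (simp add: b0_def abs_minus_commute)
  then have B1: "\<bar>B1\<bar> \<le> 1 / 4" unfolding B1_def by linarith
  have "\<bar>(A - b0 / 2) - a1\<bar> \<le> 1 / 2" using of_int_round_abs_le[of "A - b0 / 2"] by (simp add: a1_def abs_minus_commute)
  then have A1: "\<bar>A1\<bar> \<le> 1 / 2" by (simp add: A1_def a0_def add_divide_distrib algebra_simps)
  have rat1: "\<bar>A1\<bar> \<in> \<rat>" "\<bar>B1\<bar> \<in> \<rat>" using rat by (simp_all add: A1_def B1_def)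
  have "bad (f - a0) (A + B * rt - (of_int a0 + of_int b0 * rt) / 2) (A - B * rt - (of_int a0 - of_int b0 * rt) / 2)"
    by (rule bad_shift[OF bad ev])
  also have "A + B * rt - (of_int a0 + of_int b0 * rt) / 2 = A1 + B1 * rt"
    by (simp add: A1_def B1_def left_diff_distrib add_divide_distrib)
  also have "A - B * rt - (of_int a0 - of_int b0 * rt) / 2 = A1 - B1 * rt"
    by (simp add: A1_def B1_def left_diff_distrib diff_divide_distrib)
  finally have b1: "bad (f - a0) (A1 + B1 * rt) (A1 - B1 * rt)" .
  have "\<exists>g. bad g (\<bar>A1\<bar> + \<bar>B1\<bar> * rt) (\<bar>A1\<bar> - \<bar>B1\<bar> * rt)"
  proof -
    consider "A1 \<ge> 0" "B1 \<ge> 0" | "A1 \<ge> 0" "B1 < 0" | "A1 < 0" "B1 \<ge> 0" | "A1 < 0" "B1 < 0" by linarith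
    then show ?thesis
    proof cases
      case 1 then show ?thesis using b1 by auto
    next
      case 2 then show ?thesis using bad_conj[OF b1] by auto
    next
      case 3 then show ?thesis using bad_conj[OF bad_minus[OF b1]] by (auto simp: algebra_simps)
    next
      case 4 then show ?thesis using bad_minus[OF b1] by (auto simp: algebra_simps)
    qed
  qed
  then obtain g where g: "bad g (\<bar>A1\<bar> + \<bar>B1\<bar> * rt) (\<bar>A1\<bar> - \<bar>B1\<bar> * rt)" by blast
  have "A1 = 0 \<and> (B1 = 0 \<or> \<bar>B1\<bar> = 4 / 23)"
  proof -
    define u where "u = \<bar>A1\<bar> + (\<bar>B1\<bar> - 4 / 23) * rt"
    define v where "v = \<bar>A1\<bar> - (\<bar>B1\<bar> - 4 / 23) * rt"
    have xy: "\<bar>A1\<bar> + \<bar>B1\<bar> * rt = s + u" "\<bar>A1\<bar> - \<bar>B1\<bar> * rt = - s + v"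
      by (simp_all add: u_def v_def s_def left_diff_distrib)
    have stuv: "st g u v" using g unfolding st_def xy .
    have sum: "u + v = 2 * \<bar>A1\<bar>" "u - v = 2 * ((\<bar>B1\<bar> - 4 / 23) * rt)" by (simp_all add: u_def v_def)
    show ?thesis
    proof (cases "u = 0 \<or> v = 0")
      case True
      then have "\<bar>A1\<bar> + (\<bar>B1\<bar> - 4 / 23) * rt = 0 \<or> \<bar>A1\<bar> + (- (\<bar>B1\<bar> - 4 / 23)) * rt = 0"
        by (auto simp: u_def v_def algebra_simps)
      then have "\<bar>A1\<bar> = 0 \<and> \<bar>B1\<bar> = 4 / 23"
        using rt_irrational[of "\<bar>A1\<bar>" "\<bar>B1\<bar> - 4 / 23"] rt_irrational[of "\<bar>A1\<bar>" "- (\<bar>B1\<bar> - 4 / 23)"] rat1 by auto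
      then show ?thesis by simp
    next
      case nz: False
      have up: "u - v \<le> 7 / 46 * rt"
      proof -
        have "(\<bar>B1\<bar> - 4 / 23) * rt \<le> (7 / 92) * rt" using B1 by (intro mult_right_mono) auto
        then show ?thesis unfolding sum by simp
      qed
      have "u - v \<le> - 28 / 10"
      proof (rule ccontr)
        assume "\<not> u - v \<le> - 28 / 10"
        then show False using bad_near_cycle[OF stuv] nz A1 up sum(1) by auto
      qed
      then have Bs: "\<bar>B1\<bar> \<le> 1 / 100"
      proof -
        have "(\<bar>B1\<bar> - 4 / 23) * rt \<le> - 14 / 10" using \<open>u - v \<le> - 28 / 10\<close> sum(2) by linarith
        then have "\<bar>B1\<bar> * rt \<le> 5 / 100" using rt_bounds by (simp add: left_diff_distrib)
        moreover have "\<bar>B1\<bar> * 8 \<le> \<bar>B1\<bar> * rt" using rt_bounds by (intro mult_left_mono) auto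
        ultimately show ?thesis by linarith
      qed
      have "suspicious g \<bar>A1\<bar> \<bar>B1\<bar>" by (rule bad_suspicious[OF g]) (use A1 B1 in auto)
      then have z: "23 dvd g" "1024 * \<bar>A1\<bar> \<le> 4" "2048 * \<bar>B1\<bar> \<le> 4"
        using Bs unfolding suspicious_def by auto
      have Brt: "\<bar>B1\<bar> * rt \<le> 4 / 2048 * (831 / 100)" using z rt_bounds by (intro mult_mono) auto
      have Brt0: "0 \<le> \<bar>B1\<bar> * rt" by simp
      have "\<bar>A1\<bar> + \<bar>B1\<bar> * rt = 0"
      proof (rule ccontr)
        assume "\<bar>A1\<bar> + \<bar>B1\<bar> * rt \<noteq> 0"
        then have pos: "0 < \<bar>A1\<bar> + \<bar>B1\<bar> * rt" using Brt0 by linarith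
        have "\<bar>A1\<bar> + \<bar>B1\<bar> * rt \<le> 205 / 10000" "\<bar>\<bar>A1\<bar> - \<bar>B1\<bar> * rt\<bar> \<le> 205 / 10000"
          using z(2) Brt Brt0 abs_ge_zero[of A1] by linarith+
        with bad_near_lattice[OF g z(1) pos] show False by blast
      qed
      then show ?thesis using rt_irrational[OF rat1] by auto
    qed
  qed
  then obtain k :: int where k: "k \<in> {- 1, 0, 1}" "A1 = 0" "B1 = 4 * k / 23"
  proof (elim conjE disjE, goal_cases)
    case 1 then show ?case using that[of 0] by simp
  next
    case 2 then show ?case using that[of 1] that[of "- 1"] by (cases "B1 \<ge> 0") auto
  qed
  then show ?thesis using ev by (intro exI[of _ a0] exI[of _ b0] exI[of _ k]) (auto simp: A1_def B1_def)
qed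

section \<open>The field, its conjugation and its norm\<close>

definition KK :: "real set" where "KK = {a + b * rt | a b. a \<in> \<rat> \<and> b \<in> \<rat>}"

definition ZK :: "real set" where "ZK = {(of_int a + of_int b * rt) / 2 | a b. even (a + b)}"

lemma KK_I: "a \<in> \<rat> \<Longrightarrow> b \<in> \<rat> \<Longrightarrow> a + b * rt \<in> KK"
  unfolding KK_def by blast

lemma KK_E:
  assumes "x \<in> KK"
  obtains a b where "a \<in> \<rat>" "b \<in> \<rat>" "x = a + b * rt"
  using assms unfolding KK_def by blast

lemma ZK_I: "even (a + b) \<Longrightarrow> (of_int a + of_int b * rt) / 2 \<in> ZK"
  unfolding ZK_def by blast

lemma ZK_E:
  assumes "x \<in> ZK"
  obtains a b where "even (a + b)" "x = (of_int a + of_int b * rt) / 2"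
  using assms unfolding ZK_def by blast

lemma Rats_KK: "x \<in> \<rat> \<Longrightarrow> x \<in> KK"
  using KK_I[of x 0] by simp

lemma KK_add: assumes "x \<in> KK" "y \<in> KK" shows "x + y \<in> KK"
proof -
  obtain a b c d where "a \<in> \<rat>" "b \<in> \<rat>" "x = a + b * rt" "c \<in> \<rat>" "d \<in> \<rat>" "y = c + d * rt"
    using assms by (metis KK_E)
  moreover have "(a + c) + (b + d) * rt \<in> KK" using calculation by (intro KK_I) auto
  ultimately show ?thesis by (simp add: distrib_right add_ac)
qed

lemma KK_minus: assumes "x \<in> KK" shows "- x \<in> KK"
proof -
  obtain a b where "a \<in> \<rat>" "b \<in> \<rat>" "x = a + b * rt" using assms by (rule KK_E)
  moreover have "(- a) + (- b) * rt \<in> KK" using calculation by (intro KK_I) auto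
  ultimately show ?thesis by simp
qed

lemma KK_diff: "x \<in> KK \<Longrightarrow> y \<in> KK \<Longrightarrow> x - y \<in> KK"
  using KK_add[of x "- y"] KK_minus[of y] by simp

lemma quad_mult: "(a + b * rt) * (c + d * rt) = (a * c + 69 * b * d) + (a * d + b * c) * rt"
  by (simp add: algebra_simps)

lemma KK_mult: assumes "x \<in> KK" "y \<in> KK" shows "x * y \<in> KK"
proof -
  obtain a b c d where *: "a \<in> \<rat>" "b \<in> \<rat>" "x = a + b * rt" "c \<in> \<rat>" "d \<in> \<rat>" "y = c + d * rt"
    using assms by (metis KK_E)
  show ?thesis unfolding * quad_mult using * by (intro KK_I) auto
qed

text \<open>
  As the field consists of real numbers, conjugation has to be read off the rational coordinates, which are unique.
\<close>

definition cj :: "real \<Rightarrow> real" where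
  "cj x = (THE y. \<exists>a\<in>\<rat>. \<exists>b\<in>\<rat>. x = a + b * rt \<and> y = a - b * rt)"

lemma quad_eq_iff:
  assumes "a \<in> \<rat>" "b \<in> \<rat>" "c \<in> \<rat>" "d \<in> \<rat>"
  shows "a + b * rt = c + d * rt \<longleftrightarrow> a = c \<and> b = d"
proof
  assume "a + b * rt = c + d * rt"
  then have "(a - c) + (b - d) * rt = 0" by (simp add: left_diff_distrib)
  with rt_irrational[of "a - c" "b - d"] assms show "a = c \<and> b = d" by auto
qed auto

lemma cj_eq: assumes "a \<in> \<rat>" "b \<in> \<rat>" shows "cj (a + b * rt) = a - b * rt"
  unfolding cj_def
proof (rule the_equality)
  show "\<exists>a'\<in>\<rat>. \<exists>b'\<in>\<rat>. a + b * rt = a' + b' * rt \<and> a - b * rt = a' - b' * rt" using assms by blast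
  fix y assume "\<exists>a'\<in>\<rat>. \<exists>b'\<in>\<rat>. a + b * rt = a' + b' * rt \<and> y = a' - b' * rt"
  then obtain a' b' where *: "a' \<in> \<rat>" "b' \<in> \<rat>" "a + b * rt = a' + b' * rt" "y = a' - b' * rt" by blast
  then show "y = a - b * rt" using quad_eq_iff[OF assms *(1,2)] by simp
qed

lemma cj_rat: "a \<in> \<rat> \<Longrightarrow> cj a = a"
  using cj_eq[of a 0] by simp

lemma cj_add: assumes "x \<in> KK" "y \<in> KK" shows "cj (x + y) = cj x + cj y"
proof -
  obtain a b c d where *: "a \<in> \<rat>" "b \<in> \<rat>" "x = a + b * rt" "c \<in> \<rat>" "d \<in> \<rat>" "y = c + d * rt"
    using assms by (metis KK_E)
  have "x + y = (a + c) + (b + d) * rt" unfolding * by (simp add: distrib_right)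
  then have "cj (x + y) = (a + c) - (b + d) * rt" using * by (simp only: cj_eq Rats_add)
  also have "\<dots> = cj x + cj y" using * by (simp add: cj_eq distrib_right)
  finally show ?thesis .
qed

lemma cj_mult: assumes "x \<in> KK" "y \<in> KK" shows "cj (x * y) = cj x * cj y"
proof -
  obtain a b c d where *: "a \<in> \<rat>" "b \<in> \<rat>" "x = a + b * rt" "c \<in> \<rat>" "d \<in> \<rat>" "y = c + d * rt"
    using assms by (metis KK_E)
  have "cj (x * y) = (a * c + 69 * b * d) - (a * d + b * c) * rt"
    unfolding * quad_mult using * by (intro cj_eq) auto
  also have "\<dots> = (a - b * rt) * (c - d * rt)" by (simp add: algebra_simps)
  finally show ?thesis using * cj_eq[of a b] cj_eq[of c d] by simp
qed

lemma cj_KK: assumes "x \<in> KK" shows "cj x \<in> KK"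
proof -
  obtain a b where *: "a \<in> \<rat>" "b \<in> \<rat>" "x = a + b * rt" using assms by (rule KK_E)
  have "a + (- b) * rt \<in> KK" using * by (intro KK_I) auto
  then show ?thesis using * cj_eq[of a b] by simp
qed

lemma cj_cj: assumes "x \<in> KK" shows "cj (cj x) = x"
proof -
  obtain a b where *: "a \<in> \<rat>" "b \<in> \<rat>" "x = a + b * rt" using assms by (rule KK_E)
  have "cj (a + (- b) * rt) = a - (- b) * rt" using * by (intro cj_eq) auto
  then show ?thesis using * cj_eq[of a b] by simp
qed

lemma cj_minus: assumes "x \<in> KK" shows "cj (- x) = - cj x"
  using cj_mult[OF Rats_KK assms, of "- 1"] cj_rat[of "- 1"] by simp

lemma cj_diff: "x \<in> KK \<Longrightarrow> y \<in> KK \<Longrightarrow> cj (x - y) = cj x - cj y"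
  using cj_add[of x "- y"] cj_minus[of y] KK_minus[of y] by simp

lemma cj_eq_0_iff: assumes "x \<in> KK" shows "cj x = 0 \<longleftrightarrow> x = 0"
  using cj_cj[OF assms] cj_rat[of 0] by auto

lemma KK_inverse: assumes "x \<in> KK" shows "inverse x \<in> KK"
proof (cases "x = 0")
  case False
  obtain a b where *: "a \<in> \<rat>" "b \<in> \<rat>" "x = a + b * rt" using assms by (rule KK_E)
  have n: "x * cj x = a * a - 69 * (b * b)" unfolding *(3) cj_eq[OF *(1,2)] by (simp add: algebra_simps)
  have "x * cj x \<noteq> 0" using False cj_eq_0_iff[OF assms] by simp
  then have "inverse x = inverse (x * cj x) * cj x" using False by (simp add: field_simps)
  moreover have "inverse (x * cj x) \<in> KK" unfolding n using * by (intro Rats_KK) auto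
  ultimately show ?thesis using KK_mult cj_KK[OF assms] by metis
qed (use Rats_KK in simp)

lemma KK_divide: "x \<in> KK \<Longrightarrow> y \<in> KK \<Longrightarrow> x / y \<in> KK"
  unfolding divide_inverse by (intro KK_mult KK_inverse)

lemma cj_inverse: assumes "x \<in> KK" shows "cj (inverse x) = inverse (cj x)"
proof (cases "x = 0")
  case False
  have "cj (inverse x) * cj x = 1"
    using cj_mult[OF KK_inverse[OF assms] assms] False cj_rat[of 1] by simp
  then show ?thesis by (metis inverse_unique mult.commute)
qed (simp add: cj_rat)

lemma cj_divide: "x \<in> KK \<Longrightarrow> y \<in> KK \<Longrightarrow> cj (x / y) = cj x / cj y"
  unfolding divide_inverse by (simp add: cj_mult cj_inverse KK_inverse)

lemma ZK_KK: "x \<in> ZK \<Longrightarrow> x \<in> KK"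
  by (elim ZK_E) (use KK_I[of "of_int a / 2" "of_int b / 2" for a b] in \<open>simp add: add_divide_distrib\<close>)

lemma cj_ZK_eq: "cj ((of_int a + of_int b * rt) / 2) = (of_int a - of_int b * rt) / 2"
  using cj_eq[of "of_int a / 2" "of_int b / 2"] by (simp add: add_divide_distrib diff_divide_distrib)

lemma ZK_add: assumes "x \<in> ZK" "y \<in> ZK" shows "x + y \<in> ZK"
proof -
  obtain a b c d where *: "even (a + b)" "x = (of_int a + of_int b * rt) / 2"
    "even (c + d)" "y = (of_int c + of_int d * rt) / 2" using assms by (metis ZK_E)
  have "x + y = (of_int (a + c) + of_int (b + d) * rt) / 2"
    unfolding * by (simp add: add_divide_distrib distrib_right)
  moreover have "even ((a + c) + (b + d))" using *(1,3) by presburger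
  ultimately show ?thesis using ZK_I by metis
qed

lemma ZK_minus: assumes "x \<in> ZK" shows "- x \<in> ZK"
proof -
  obtain a b where *: "even (a + b)" "x = (of_int a + of_int b * rt) / 2" using assms by (rule ZK_E)
  have "- x = (of_int (- a) + of_int (- b) * rt) / 2" unfolding * by (simp add: add_divide_distrib)
  moreover have "even (- a + - b)" using *(1) by presburger
  ultimately show ?thesis using ZK_I by metis
qed

lemma ZK_diff: "x \<in> ZK \<Longrightarrow> y \<in> ZK \<Longrightarrow> x - y \<in> ZK"
  using ZK_add[of x "- y"] ZK_minus[of y] by simp

lemma ZK_mult: assumes "x \<in> ZK" "y \<in> ZK" shows "x * y \<in> ZK"
proof -
  obtain a b c d where *: "even (a + b)" "x = (of_int a + of_int b * rt) / 2"
    "even (c + d)" "y = (of_int c + of_int d * rt) / 2" using assms by (metis ZK_E)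
  obtain k l where kl: "a = 2 * k - b" "c = 2 * l - d"
    using *(1,3) by (metis add_diff_cancel_right' evenE)
  define e g where "e = 2 * k * l - k * d - b * l + 35 * b * d" and "g = k * d + b * l - b * d"
  have "x * y = ((of_int a * of_int c + 69 * of_int b * of_int d) + (of_int a * of_int d + of_int b * of_int c) * rt) / 4"
    unfolding * by (simp only: times_divide_times_eq quad_mult)
  also have "of_int a * of_int c + 69 * of_int b * of_int d = (2 * of_int e :: real)"
    by (simp add: kl e_def algebra_simps)
  also have "of_int a * of_int d + of_int b * of_int c = (2 * of_int g :: real)"
    by (simp add: kl g_def algebra_simps)
  also have "(2 * of_int e + 2 * of_int g * rt) / 4 = (of_int e + of_int g * rt) / 2"
    by (simp add: add_divide_distrib)
  finally have "x * y = (of_int e + of_int g * rt) / 2" .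
  moreover have "e + g = 2 * (k * l + 17 * b * d)" by (simp add: e_def g_def algebra_simps)
  then have "even (e + g)" by simp
  ultimately show ?thesis using ZK_I by metis
qed

lemma ZK_int: "of_int n \<in> ZK"
  using ZK_I[of "2 * n" 0] by simp

lemma ZK_0 [simp]: "0 \<in> ZK" and ZK_1 [simp]: "1 \<in> ZK" and ZK_numeral [simp]: "numeral k \<in> ZK"
  using ZK_int[of 0] ZK_int[of 1] ZK_int[of "numeral k"] by simp_all

lemma ZK_rt: "rt \<in> ZK"
  using ZK_I[of 0 2] by simp

lemma ZK_cj: assumes "x \<in> ZK" shows "cj x \<in> ZK"
proof -
  obtain a b where *: "even (a + b)" "x = (of_int a + of_int b * rt) / 2" using assms by (rule ZK_E)
  have "cj x = (of_int a + of_int (- b) * rt) / 2" unfolding * cj_ZK_eq by simp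
  moreover have "even (a + - b)" using *(1) by simp
  ultimately show ?thesis using ZK_I by metis
qed

lemma ZK_eps: "eps \<in> ZK" "eps' \<in> ZK"
  using ZK_I[of 25 3] ZK_I[of 25 "- 3"] by (simp_all add: eps_def eps'_def)

lemma cj_eps: "cj eps = eps'" "cj eps' = eps"
  using cj_ZK_eq[of 25 3] cj_ZK_eq[of 25 "- 3"] by (simp_all add: eps_def eps'_def)

definition nm :: "real \<Rightarrow> real" where "nm x = x * cj x"

lemma nm_mult: "x \<in> KK \<Longrightarrow> y \<in> KK \<Longrightarrow> nm (x * y) = nm x * nm y"
  by (simp add: nm_def cj_mult mult_ac)

lemma nm_quad: assumes "a \<in> \<rat>" "b \<in> \<rat>" shows "nm (a + b * rt) = a * a - 69 * (b * b)"
  unfolding nm_def cj_eq[OF assms] by (simp add: algebra_simps)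

lemma nm_rat: assumes "x \<in> KK" shows "nm x \<in> \<rat>"
  using assms by (elim KK_E) (simp add: nm_quad)

lemma nm_eq_0_iff: "x \<in> KK \<Longrightarrow> nm x = 0 \<longleftrightarrow> x = 0"
  by (simp add: nm_def cj_eq_0_iff)

lemma nm_cj: "x \<in> KK \<Longrightarrow> nm (cj x) = nm x"
  by (simp add: nm_def cj_cj mult.commute)

lemma nm_ZK_eq: "nm ((of_int a + of_int b * rt) / 2) = (of_int a * of_int a - 69 * (of_int b * of_int b)) / 4"
  using nm_quad[of "of_int a / 2" "of_int b / 2"] by (simp add: add_divide_distrib diff_divide_distrib)

lemma nm_ZK: assumes "x \<in> ZK" obtains n :: int where "nm x = of_int n"
proof -
  obtain a b where *: "even (a + b)" "x = (of_int a + of_int b * rt) / 2" using assms by (rule ZK_E)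
  obtain k where k: "a = 2 * k - b" using *(1) by (metis add_diff_cancel_right' evenE)
  have "of_int a * of_int a - 69 * (of_int b * of_int b) = 4 * (of_int (k * k - k * b - 17 * (b * b)) :: real)"
    by (simp add: k algebra_simps)
  then have "nm x = of_int (k * k - k * b - 17 * (b * b))"
    unfolding * nm_ZK_eq by simp
  then show ?thesis by (rule that)
qed

section \<open>The weighted norm of an element\<close>

text \<open>
  The prime above 23 is the only one and has norm 23; an element whose norm is \<open>n\<close> contains it exactly
  \<open>multiplicity 23 n\<close> times. Hence the weighted norm of an element depends only on its norm.
\<close>

definition wz :: "real \<Rightarrow> int \<Rightarrow> real" where
  "wz c n = \<bar>of_int n\<bar> * (c / 23) ^ multiplicity 23 n"

lemma prime_23: "prime (23 :: int)"
proof -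
  have "prime (23 :: nat)" by (simp add: prime_nat_iff' atLeastLessThan_nat_numeral)
  then show ?thesis by (metis of_nat_numeral prime_nat_int_transfer)
qed

lemma wz_mult: "wz c (m * n) = wz c m * wz c n"
proof (cases "m = 0 \<or> n = 0")
  case False
  then have "multiplicity 23 (m * n) = multiplicity 23 m + multiplicity 23 n"
    using prime_elem_multiplicity_mult_distrib[of 23 m n] prime_23 by auto
  then show ?thesis by (simp add: wz_def abs_mult power_add mult_ac)
qed (auto simp: wz_def)

lemma wz_nonneg: "c > 0 \<Longrightarrow> 0 \<le> wz c n" by (simp add: wz_def)

lemma wz_eq_0_iff: "c > 0 \<Longrightarrow> wz c n = 0 \<longleftrightarrow> n = 0" by (simp add: wz_def)

lemma wz_0 [simp]: "wz c 0 = 0" by (simp add: wz_def)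

lemma wz_not_dvd: "\<not> 23 dvd n \<Longrightarrow> wz c n = \<bar>of_int n\<bar>"
  by (simp add: wz_def not_dvd_imp_multiplicity_0)

lemma wz_1 [simp]: "wz c 1 = 1" using wz_not_dvd[of 1] by simp

lemma wz_minus [simp]: "wz c (- n) = wz c n"
  using wz_mult[of c "- 1" n] wz_not_dvd[of "- 1" c] by simp

lemma wz_23: "c > 0 \<Longrightarrow> wz c 23 = c"
  using prime_23 by (simp add: wz_def multiplicity_self)

lemma wz_ge: assumes "c \<ge> 23" "23 ^ k dvd n" shows "\<bar>of_int n\<bar> * (c / 23) ^ k \<le> wz c n"
proof (cases "n = 0")
  case False
  then have "k \<le> multiplicity 23 n" using assms(2) by (intro multiplicity_geI) (auto)
  then show ?thesis unfolding wz_def using assms(1) by (intro mult_left_mono power_increasing) auto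
qed simp

lemma wz_le: assumes "0 < c" "c \<le> 23" "23 ^ k dvd n" shows "wz c n \<le> \<bar>of_int n\<bar> * (c / 23) ^ k"
proof (cases "n = 0")
  case False
  then have "k \<le> multiplicity 23 n" using assms(3) by (intro multiplicity_geI) (auto)
  then show ?thesis unfolding wz_def using assms(1,2) by (intro mult_left_mono power_decreasing) auto
qed simp

text \<open>
  The multiplicative extension of \<open>wz\<close> to rational numbers.
\<close>

definition W :: "real \<Rightarrow> real \<Rightarrow> real" where
  "W c r = (THE w. \<exists>m n::int. n \<noteq> 0 \<and> r = of_int m / of_int n \<and> w = wz c m / wz c n)"

lemma W_eq: assumes "c > 0" "n \<noteq> 0" shows "W c (of_int m / of_int n) = wz c m / wz c n"
  unfolding W_def
proof (rule the_equality)
  show "\<exists>m' n'::int. n' \<noteq> 0 \<and> (of_int m / of_int n :: real) = of_int m' / of_int n' \<and> wz c m / wz c n = wz c m' / wz c n'"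
    using assms(2) by blast
  fix w assume "\<exists>m' n'::int. n' \<noteq> 0 \<and> (of_int m / of_int n :: real) = of_int m' / of_int n' \<and> w = wz c m' / wz c n'"
  then obtain m' n' :: int where *: "n' \<noteq> 0" "(of_int m / of_int n :: real) = of_int m' / of_int n'" "w = wz c m' / wz c n'"
    by blast
  have "(of_int (m * n') :: real) = of_int (m' * n)" using *(1,2) assms(2) by (simp add: frac_eq_eq)
  then have "m * n' = m' * n" by (simp only: of_int_eq_iff)
  then have "wz c m * wz c n' = wz c m' * wz c n" by (metis wz_mult)
  then show "w = wz c m / wz c n" using * assms wz_eq_0_iff[OF assms(1)] by (simp add: frac_eq_eq)
qed

lemma W_int: "c > 0 \<Longrightarrow> W c (of_int n) = wz c n"
  using W_eq[of c 1 n] by simp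

lemma Rats_frac: assumes "r \<in> \<rat>" obtains m n :: int where "n > 0" "r = of_int m / of_int n"
  using assms by (elim Rats_cases') auto

lemma W_mult: assumes "c > 0" "r \<in> \<rat>" "r' \<in> \<rat>" shows "W c (r * r') = W c r * W c r'"
proof -
  obtain m n :: int where 1: "n > 0" "r = of_int m / of_int n" using Rats_frac[OF assms(2)] by blast
  obtain m' n' :: int where 2: "n' > 0" "r' = of_int m' / of_int n'" using Rats_frac[OF assms(3)] by blast
  have "r * r' = of_int (m * m') / of_int (n * n')" using 1 2 by simp
  then have "W c (r * r') = wz c (m * m') / wz c (n * n')" using W_eq[of c "n * n'" "m * m'"] 1 2 assms(1) by simp
  then show ?thesis using 1 2 assms(1) W_eq[of c n m] W_eq[of c n' m'] by (simp add: wz_mult)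
qed

lemma W_nonneg: assumes "c > 0" "r \<in> \<rat>" shows "0 \<le> W c r"
proof -
  obtain m n :: int where 1: "n > 0" "r = of_int m / of_int n" using Rats_frac[OF assms(2)] by blast
  then show ?thesis using W_eq[of c n m] assms(1) by (simp add: wz_nonneg)
qed

lemma W_eq_0_iff: assumes "c > 0" "r \<in> \<rat>" shows "W c r = 0 \<longleftrightarrow> r = 0"
proof -
  obtain m n :: int where 1: "n > 0" "r = of_int m / of_int n" using Rats_frac[OF assms(2)] by blast
  then show ?thesis using W_eq[of c n m] assms(1) by (simp add: wz_eq_0_iff)
qed

text \<open>
  For \<open>c \<ge> 23\<close> the weight exceeds the absolute value only through factors 23 of the numerator. This lemma and the
  next two convert between weights and absolute values.
\<close>

lemma W_le_abs:
  assumes "c \<ge> 23" "\<not> 23 dvd m" "n \<noteq> 0"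
  shows "W c (of_int m / of_int n) \<le> \<bar>of_int m / of_int n\<bar>"
proof -
  have "\<bar>of_int n\<bar> \<le> wz c n" using wz_ge[of c 0 n] assms(1) by simp
  then show ?thesis using assms by (simp add: W_eq wz_not_dvd frac_le)
qed

lemma W_ge_abs:
  assumes "c \<ge> 23" "\<not> 23 dvd n" "23 ^ k dvd m" "n \<noteq> 0"
  shows "\<bar>of_int m / of_int n\<bar> * (c / 23) ^ k \<le> W c (of_int m / of_int n)"
  using assms wz_ge[OF assms(1,3)] by (simp add: W_eq wz_not_dvd divide_right_mono)

lemma W_ge_abs_small:
  assumes "0 < c" "c \<le> 23" "\<not> 23 dvd m" "23 ^ k dvd n" "n \<noteq> 0"
  shows "\<bar>of_int m / of_int n\<bar> * (23 / c) ^ k \<le> W c (of_int m / of_int n)"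
proof -
  have "\<bar>of_int m\<bar> / (\<bar>of_int n\<bar> * (c / 23) ^ k) \<le> \<bar>of_int m\<bar> / wz c n"
    using assms wz_le[OF assms(1,2,4)] wz_eq_0_iff[of c n] wz_nonneg[of c n]
    by (intro divide_left_mono mult_pos_pos) auto
  moreover have "\<bar>of_int m / of_int n\<bar> * (23 / c) ^ k = \<bar>of_int m\<bar> / (\<bar>of_int n\<bar> * (c / 23) ^ k)"
    by (simp add: power_divide)
  ultimately show ?thesis using assms by (simp add: W_eq wz_not_dvd)
qed

definition F :: "real \<Rightarrow> real \<Rightarrow> real" where "F c x = W c (nm x)"

lemma F_mult: "c > 0 \<Longrightarrow> x \<in> KK \<Longrightarrow> y \<in> KK \<Longrightarrow> F c (x * y) = F c x * F c y"
  by (simp add: F_def nm_mult W_mult nm_rat)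

lemma F_nonneg: "c > 0 \<Longrightarrow> x \<in> KK \<Longrightarrow> 0 \<le> F c x"
  by (simp add: F_def W_nonneg nm_rat)

lemma F_eq_0_iff: "c > 0 \<Longrightarrow> x \<in> KK \<Longrightarrow> F c x = 0 \<longleftrightarrow> x = 0"
  by (simp add: F_def W_eq_0_iff nm_rat nm_eq_0_iff)

lemma F_unit: assumes "c > 0" "\<bar>nm x\<bar> = 1" shows "F c x = 1"
proof -
  from assms(2) consider "nm x = of_int 1" | "nm x = of_int (- 1)" by fastforce
  then show ?thesis by cases (simp_all only: F_def W_int[OF assms(1)] wz_minus wz_1)
qed

section \<open>The upper bound for the Euclidean minimum\<close>

lemma common_denominator_23:
  fixes A B :: real
  assumes "A \<in> \<rat>" "B \<in> \<rat>"
  obtains m n d :: int where "d > 0" "A = of_int m / of_int d" "B = of_int n / of_int d"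
    "\<not> (23 dvd d \<and> 23 dvd m \<and> 23 dvd n)"
proof -
  define P where "P = (\<lambda>d::nat. d > 0 \<and> (\<exists>m n::int. A = of_int m / of_nat d \<and> B = of_int n / of_nat d))"
  obtain m1 d1 :: int where 1: "d1 > 0" "A = of_int m1 / of_int d1" using Rats_frac[OF assms(1)] by blast
  obtain m2 d2 :: int where 2: "d2 > 0" "B = of_int m2 / of_int d2" using Rats_frac[OF assms(2)] by blast
  have "P (nat (d1 * d2))"
  proof -
    have "real (nat (d1 * d2)) = of_int (d1 * d2)" using 1 2 by simp
    moreover have "A = of_int (m1 * d2) / of_int (d1 * d2)" "B = of_int (m2 * d1) / of_int (d1 * d2)"
      using 1 2 by simp_all
    ultimately show ?thesis unfolding P_def using 1 2 by (intro conjI exI[of _ "m1 * d2"] exI[of _ "m2 * d1"]) auto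
  qed
  define d where "d = (LEAST d. P d)"
  have Pd: "P d" unfolding d_def by (rule LeastI) fact
  then obtain m n :: int where mn: "d > 0" "A = of_int m / of_nat d" "B = of_int n / of_nat d"
    unfolding P_def by blast
  have "\<not> (23 dvd d \<and> 23 dvd m \<and> 23 dvd n)"
  proof
    assume *: "23 dvd d \<and> 23 dvd m \<and> 23 dvd n"
    then obtain d' m' n' where e: "d = 23 * d'" "m = 23 * m'" "n = 23 * n'" by (elim conjE dvdE)
    have "P d'" unfolding P_def using mn e by auto
    then have "d \<le> d'" unfolding d_def by (rule Least_le)
    then show False using e mn(1) by simp
  qed
  then have "\<not> (23 dvd int d \<and> 23 dvd m \<and> 23 dvd n)"
    using int_dvd_int_iff[of 23 d] by simp
  then show ?thesis using that[of "int d" m n] mn by simp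
qed

lemma not_dvd_23_mult: "\<not> 23 dvd m \<Longrightarrow> \<not> 23 dvd n \<Longrightarrow> \<not> (23::int) dvd m * n"
  using prime_dvd_mult_iff[OF prime_23] by blast

text \<open>
  If \<open>z = (m + n rt) / d\<close> in lowest terms at 23, the norm of \<open>z - q\<close> has a numerator divisible by 23 only when \<open>q\<close>
  solves a congruence modulo the prime above 23, which has at most one solution.
\<close>

lemma F_le_norm_outside_class:
  assumes "z \<in> KK" "c \<ge> 23"
  shows "\<exists>r::int. \<forall>a b. \<not> 23 dvd (a - r) \<longrightarrow>
    F c (z - (of_int a + of_int b * rt) / 2) \<le> \<bar>nm (z - (of_int a + of_int b * rt) / 2)\<bar>"
proof -
  obtain A B where AB: "A \<in> \<rat>" "B \<in> \<rat>" "z = A + B * rt" using assms(1) by (rule KK_E)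
  obtain m n d :: int where d: "d > 0" "A = of_int m / of_int d" "B = of_int n / of_int d"
    "\<not> (23 dvd d \<and> 23 dvd m \<and> 23 dvd n)" using common_denominator_23[OF AB(1,2)] by blast
  define e g where "e = (\<lambda>a::int. 2 * m - a * d)" and "g = (\<lambda>b::int. 2 * n - b * d)"
  have N: "nm (z - (of_int a + of_int b * rt) / 2) = of_int (e a * e a - 69 * (g b * g b)) / of_int (4 * (d * d))" for a b
  proof -
    have "z - (of_int a + of_int b * rt) / 2 = (A - of_int a / 2) + (B - of_int b / 2) * rt"
      by (simp add: AB(3) add_divide_distrib left_diff_distrib)
    moreover have "A - of_int a / 2 = of_int (e a) / of_int (2 * d)" "B - of_int b / 2 = of_int (g b) / of_int (2 * d)"
      using d(1) by (simp_all add: d(2,3) e_def g_def diff_divide_distrib)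
    moreover have "nm ((A - of_int a / 2) + (B - of_int b / 2) * rt)
      = (A - of_int a / 2) * (A - of_int a / 2) - 69 * ((B - of_int b / 2) * (B - of_int b / 2))"
      using AB by (intro nm_quad) auto
    ultimately show ?thesis using d(1) by (simp add: diff_divide_distrib)
  qed
  have le: "F c (z - (of_int a + of_int b * rt) / 2) \<le> \<bar>nm (z - (of_int a + of_int b * rt) / 2)\<bar>"
    if "\<not> 23 dvd e a" for a b
  proof -
    have "\<not> 23 dvd e a * e a" using not_dvd_23_mult that by blast
    moreover have "(23::int) dvd 69 * (g b * g b)" by (rule dvd_mult2) simp
    ultimately have "\<not> 23 dvd e a * e a - 69 * (g b * g b)"
      by (metis diff_add_cancel dvd_add)
    then show ?thesis unfolding F_def N using assms(2) d(1) by (intro W_le_abs) auto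
  qed
  show ?thesis
  proof (cases "23 dvd d")
    case False
    then have "coprime d 23" using prime_23 by (metis coprime_commute prime_imp_coprime)
    then obtain x y where xy: "x * d + y * 23 = 1" using bezout_int[of d 23] by auto
    define r where "r = 2 * m * x"
    have "d * r - 2 * m = 2 * m * (x * d + y * 23 - 1) - 23 * (2 * m * y)" by (simp add: r_def algebra_simps)
    then have r: "23 dvd (d * r - 2 * m)" using xy by simp
    have "\<not> 23 dvd e a" if "\<not> 23 dvd (a - r)" for a
    proof
      assume "23 dvd e a"
      from dvd_add[OF this r] have "23 dvd (e a + (d * r - 2 * m))" .
      then have "23 dvd d * (r - a)" by (simp add: e_def algebra_simps)
      then have "23 dvd (r - a)" using False prime_dvd_mult_iff[OF prime_23] by blast
      then show False using that by (simp add: dvd_diff_commute)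
    qed
    then show ?thesis using le by blast
  next
    case d23: True
    show ?thesis
    proof (cases "23 dvd m")
      case False
      have "\<not> 23 dvd e a" for a
      proof
        assume "23 dvd e a"
        moreover have "23 dvd a * d" using d23 by simp
        ultimately have "23 dvd (e a + a * d)" by (rule dvd_add)
        then have "23 dvd 2 * m" by (simp add: e_def)
        then show False using False by presburger
      qed
      then show ?thesis using le by blast
    next
      case True
      then have n: "\<not> 23 dvd n" using d(4) d23 by blast
      obtain m' d' where md: "m = 23 * m'" "d = 23 * d'" using True d23 by (elim dvdE)
      define e' where "e' = (\<lambda>a::int. 2 * m' - a * d')"
      have "F c (z - (of_int a + of_int b * rt) / 2) \<le> \<bar>nm (z - (of_int a + of_int b * rt) / 2)\<bar>" for a b
      proof -
        have "\<not> 23 dvd g b"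
        proof
          assume "23 dvd g b"
          moreover have "23 dvd b * d" using d23 by simp
          ultimately have "23 dvd (g b + b * d)" by (rule dvd_add)
          then have "23 dvd 2 * n" by (simp add: g_def)
          then show False using n by presburger
        qed
        then have "\<not> 23 dvd 3 * (g b * g b)" using not_dvd_23_mult by simp
        moreover have "23 dvd 23 * (e' a * e' a)" by simp
        ultimately have nd: "\<not> 23 dvd 23 * (e' a * e' a) - 3 * (g b * g b)"
          by (metis diff_add_cancel dvd_add diff_diff_eq2 add_diff_cancel_left' dvd_diff)
        have "e a * e a - 69 * (g b * g b) = 23 * (23 * (e' a * e' a) - 3 * (g b * g b))"
          by (simp add: e_def e'_def md algebra_simps)
        moreover have "4 * (d * d) = 23 * (92 * (d' * d'))" by (simp add: md)
        ultimately have "nm (z - (of_int a + of_int b * rt) / 2)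
            = of_int (23 * (e' a * e' a) - 3 * (g b * g b)) / of_int (92 * (d' * d'))"
          unfolding N by (simp only: of_int_mult of_int_numeral mult_divide_mult_cancel_left_if) simp
        then show ?thesis unfolding F_def using nd assms(2) d(1) md by (simp only: W_le_abs) (intro W_le_abs, auto)
      qed
      then show ?thesis by blast
    qed
  qed
qed

lemma s_KK: "s \<in> KK"
  using KK_I[of 0 "4 / 23"] by (simp add: s_def)

text \<open>
  A point at which the estimate fails would be bad for the class in which the weight may exceed the norm.
\<close>

theorem norm_covering:
  assumes "z \<in> KK" "c \<ge> 23" "z - s \<notin> ZK" "z + s \<notin> ZK"
  shows "\<exists>q\<in>ZK. F c (z - q) < kap"
proof (rule ccontr)
  assume n: "\<not> ?thesis"
  obtain A B where AB: "A \<in> \<rat>" "B \<in> \<rat>" "z = A + B * rt" using assms(1) by (rule KK_E)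
  obtain r where r: "\<And>a b. \<not> 23 dvd (a - r) \<Longrightarrow>
    F c (z - (of_int a + of_int b * rt) / 2) \<le> \<bar>nm (z - (of_int a + of_int b * rt) / 2)\<bar>"
    using F_le_norm_outside_class[OF assms(1,2)] by blast
  have "bad r (A + B * rt) (A - B * rt)"
    unfolding bad_def
  proof (intro allI impI)
    fix a b :: int assume ab: "even (a + b)" "\<not> 23 dvd (a - r)"
    have q: "(of_int a + of_int b * rt) / 2 \<in> ZK" by (rule ZK_I) fact
    then have "kap \<le> F c (z - (of_int a + of_int b * rt) / 2)" using n by (meson not_le)
    also have "\<dots> \<le> \<bar>nm (z - (of_int a + of_int b * rt) / 2)\<bar>" by (rule r) fact
    also have "cj (z - (of_int a + of_int b * rt) / 2) = (A - B * rt) - (of_int a - of_int b * rt) / 2"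
      using cj_diff[OF assms(1) ZK_KK[OF q]] cj_eq[OF AB(1,2)] by (simp add: AB(3) cj_ZK_eq)
    then have "nm (z - (of_int a + of_int b * rt) / 2) = (A + B * rt - (of_int a + of_int b * rt) / 2) * (A - B * rt - (of_int a - of_int b * rt) / 2)"
      by (simp only: nm_def AB(3))
    finally show "kap \<le> \<bar>(A + B * rt - (of_int a + of_int b * rt) / 2) * (A - B * rt - (of_int a - of_int b * rt) / 2)\<bar>" .
  qed
  from bad_rational[OF this AB(1,2)] obtain a b k :: int
    where abk: "even (a + b)" "k \<in> {- 1, 0, 1}" "A = a / 2" "B = b / 2 + 4 * k / 23" by blast
  have z: "z = (of_int a + of_int b * rt) / 2 + of_int k * s"
    by (simp add: AB(3) abk(3,4) s_def add_divide_distrib distrib_right)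
  have q: "(of_int a + of_int b * rt) / 2 \<in> ZK" by (rule ZK_I) fact
  from abk(2) consider "k = - 1" | "k = 0" | "k = 1" by blast
  then show False
  proof cases
    case 1 then show False using z q assms(4) by simp
  next
    case 2
    then have "F c (z - z) < kap" using kap_bounds by (simp add: F_def nm_def W_int[of c 0, simplified] assms(2) less_le_trans[OF _ assms(2)])
    moreover have "z = (of_int a + of_int b * rt) / 2" using 2 z by simp
    then have "z \<in> ZK" using q by (simp only:)
    ultimately show False using n by blast
  next
    case 3 then show False using z q assms(3) by simp
  qed
qed

section \<open>The critical point\<close>

lemma square_mod_3: "(x * x) mod 3 = 0 \<or> (x * x) mod 3 = (1::int)"
proof -
  have "x mod 3 = 0 \<or> x mod 3 = 1 \<or> x mod 3 = 2" by presburger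
  moreover have "(x * x) mod 3 = ((x mod 3) * (x mod 3)) mod 3" by (simp add: mod_mult_eq)
  ultimately show ?thesis by auto
qed

text \<open>
  The form is, up to the factor 92, the norm of \<open>s - q\<close>. It is fixed modulo 23 and divisible by 4, and the remaining
  values below 100 are excluded modulo 3 and 9.
\<close>

lemma critical_form_bound:
  fixes a b :: int
  assumes "even (a + b)"
  shows "100 \<le> \<bar>23 * (a * a) - 3 * ((8 - 23 * b) * (8 - 23 * b))\<bar>"
    and "\<not> 23 dvd (23 * (a * a) - 3 * ((8 - 23 * b) * (8 - 23 * b)))"
proof -
  define V where "V = 23 * (a * a) - 3 * ((8 - 23 * b) * (8 - 23 * b))"
  have "V = 23 * (a * a + 48 * b - 69 * (b * b)) - 192" by (simp add: V_def algebra_simps)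
  then obtain t where t: "V = 23 * t - 192" by blast
  obtain k where k: "a = 2 * k - b" using assms by (metis add_diff_cancel_right' evenE)
  have "V = 4 * (23 * (k * k) - 23 * (k * b) - 391 * (b * b) + 276 * b - 48)" by (simp add: V_def k algebra_simps)
  then obtain t' where t': "V = 4 * t'" by blast
  have 84: "V \<noteq> 84"
  proof
    assume V84: "V = 84"
    then have "3 dvd a * a" using V_def by presburger
    then have "3 dvd a" using prime_dvd_mult_iff[of "3::int" a a] by simp
    then obtain a' where a': "a = 3 * a'" by (elim dvdE)
    have "3 * (23 * (a' * a')) - (8 - 23 * b) * (8 - 23 * b) = 28" using V84 by (simp add: V_def a')
    moreover have "(8 - 23 * b) * (8 - 23 * b) mod 3 = 0 \<or> (8 - 23 * b) * (8 - 23 * b) mod 3 = 1"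
      by (rule square_mod_3)
    ultimately show False by presburger
  qed
  have 8: "V \<noteq> - 8"
  proof
    assume "V = - 8"
    then have "a * a mod 3 = 2" using V_def by presburger
    then show False using square_mod_3[of a] by simp
  qed
  show "\<not> 23 dvd V" using t by presburger
  show "100 \<le> \<bar>V\<bar>"
  proof (rule ccontr)
    assume "\<not> 100 \<le> \<bar>V\<bar>"
    then have "- 100 < V" "V < 100" by auto
    then have "V = 84 \<or> V = - 8" using t t' by presburger
    then show False using 84 8 by blast
  qed
qed

lemma nm_critical:
  "nm (s - (of_int a + of_int b * rt) / 2)
     = of_int (23 * (a * a) - 3 * ((8 - 23 * b) * (8 - 23 * b))) / of_int 92"
proof -
  define r where "r = (of_int (8 - 23 * b) :: real)"
  have "4 / 23 - of_int b / 2 = r / 46" by (simp add: r_def diff_divide_distrib)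
  then have "s - (of_int a + of_int b * rt) / 2 = (- of_int a / 2) + (r / 46) * rt"
    by (simp add: s_def add_divide_distrib left_diff_distrib flip: \<open>4 / 23 - of_int b / 2 = r / 46\<close>)
  then have "nm (s - (of_int a + of_int b * rt) / 2)
      = (- of_int a / 2) * (- of_int a / 2) - 69 * ((r / 46) * (r / 46))"
    using nm_quad[of "- of_int a / 2" "r / 46"] by (simp add: r_def)
  also have "\<dots> = (23 * (of_int a * of_int a) - 3 * (r * r)) / 92" by (simp add: diff_divide_distrib)
  finally show ?thesis by (simp add: r_def)
qed

lemma F_critical_ge:
  assumes "c > 0" "q \<in> ZK"
  shows "25 / c \<le> F c (s - q)"
proof -
  obtain a b where q: "even (a + b)" "q = (of_int a + of_int b * rt) / 2" using assms(2) by (rule ZK_E)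
  define V where "V = 23 * (a * a) - 3 * ((8 - 23 * b) * (8 - 23 * b))"
  have V: "100 \<le> \<bar>V\<bar>" "\<not> 23 dvd V" using critical_form_bound[OF q(1)] by (simp_all add: V_def)
  have w: "wz c 92 = 4 * c" using wz_mult[of c 4 23] wz_23[OF assms(1)] wz_not_dvd[of 4 c] by simp
  have "F c (s - q) = \<bar>of_int V\<bar> / (4 * c)"
    unfolding F_def q(2) nm_critical V_def[symmetric] using assms(1) V(2) by (subst W_eq) (auto simp: w wz_not_dvd)
  moreover have "100 \<le> \<bar>of_int V :: real\<bar>" using V(1) by linarith
  then have "100 / (4 * c) \<le> \<bar>of_int V\<bar> / (4 * c)" using assms(1) by (intro divide_right_mono) auto
  ultimately show ?thesis using assms(1) by simp
qed

lemma F_critical_1: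
  assumes "c > 0"
  shows "F c (s - 1) = 25 / c"
proof -
  have w: "wz c 92 = 4 * c" using wz_mult[of c 4 23] wz_23[OF assms(1)] wz_not_dvd[of 4 c] by simp
  have "nm (s - 1) = of_int (- 100) / of_int 92" using nm_critical[of 2 0] by simp
  then have "F c (s - 1) = wz c (- 100) / wz c 92" unfolding F_def using assms by (simp only: W_eq)
  then show ?thesis using w by (simp add: wz_not_dvd)
qed

lemma F_minus: "c > 0 \<Longrightarrow> x \<in> KK \<Longrightarrow> F c (- x) = F c x"
  by (simp add: F_def nm_def cj_minus)

section \<open>Powers of the fundamental unit modulo powers of 23\<close>

text \<open>
  The coordinates of \<open>2 eps ^ n\<close>, as integers.
\<close>

fun eP :: "nat \<Rightarrow> int" where
  "eP 0 = 2" | "eP (Suc 0) = 25" | "eP (Suc (Suc n)) = 25 * eP (Suc n) - eP n"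

fun eQ :: "nat \<Rightarrow> int" where
  "eQ 0 = 0" | "eQ (Suc 0) = 3" | "eQ (Suc (Suc n)) = 25 * eQ (Suc n) - eQ n"

lemma eps_sq: "eps * eps = 25 * eps - 1" "eps' * eps' = 25 * eps' - 1"
  by (simp_all add: eps_def eps'_def field_simps)

lemma eps_power: "eps ^ n = (of_int (eP n) + of_int (eQ n) * rt) / 2"
proof (induction n rule: eP.induct)
  case (3 n)
  have "eps ^ Suc (Suc n) = 25 * eps ^ Suc n - eps ^ n"
    using eps_sq(1) by (simp add: left_diff_distrib flip: mult.assoc)
  then show ?case unfolding 3 by (simp add: left_diff_distrib diff_divide_distrib add_divide_distrib)
qed (simp_all add: eps_def)

lemma eps'_power: "eps' ^ n = (of_int (eP n) - of_int (eQ n) * rt) / 2"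
proof (induction n rule: eP.induct)
  case (3 n)
  have "eps' ^ Suc (Suc n) = 25 * eps' ^ Suc n - eps' ^ n"
    using eps_sq(2) by (simp add: left_diff_distrib flip: mult.assoc)
  then show ?case unfolding 3 by (simp add: left_diff_distrib diff_divide_distrib add_divide_distrib)
qed (simp_all add: eps'_def)

lemma eps_eps'_power: "eps ^ n * eps' ^ n = 1" "eps' ^ n * eps ^ n = 1"
  by (simp_all flip: power_mult_distrib)

lemma eP_eQ_pell: "eP n * eP n - 69 * (eQ n * eQ n) = 4"
proof -
  have "(of_int (eP n * eP n - 69 * (eQ n * eQ n)) :: real) = 4 * (eps ^ n * eps' ^ n)"
    unfolding eps_power eps'_power by (simp add: algebra_simps)
  then have "(of_int (eP n * eP n - 69 * (eQ n * eQ n)) :: real) = of_int 4" by (simp add: eps_eps'_power)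
  then show ?thesis by (simp only: of_int_eq_iff)
qed

lemma eP_eQ_add: "2 * eP (m + n) = eP m * eP n + 69 * (eQ m * eQ n)" "2 * eQ (m + n) = eP m * eQ n + eQ m * eP n"
proof -
  have "(of_int (2 * eP (m + n)) + of_int (2 * eQ (m + n)) * rt :: real) = 4 * eps ^ (m + n)"
    unfolding eps_power by simp
  also have "\<dots> = (of_int (eP m) + of_int (eQ m) * rt) * (of_int (eP n) + of_int (eQ n) * rt)"
    unfolding power_add eps_power[of m] eps_power[of n] by simp
  also have "\<dots> = of_int (eP m * eP n + 69 * (eQ m * eQ n)) + of_int (eP m * eQ n + eQ m * eP n) * rt"
    unfolding quad_mult by simp
  finally have "(of_int (2 * eP (m + n)) :: real) = of_int (eP m * eP n + 69 * (eQ m * eQ n))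
      \<and> (of_int (2 * eQ (m + n)) :: real) = of_int (eP m * eQ n + eQ m * eP n)"
    by (subst (asm) quad_eq_iff) auto
  then show "2 * eP (m + n) = eP m * eP n + 69 * (eQ m * eQ n)" "2 * eQ (m + n) = eP m * eQ n + eQ m * eP n"
    by (simp_all only: of_int_eq_iff)
qed

lemma eP_eQ_even: "even (eP n + eQ n)"
proof (induction n rule: eP.induct)
  case (3 n)
  then show ?case by simp
qed simp_all

lemma eP_mod_23: "23 dvd eP n - 2"
proof (induction n rule: eP.induct)
  case (3 n)
  have "eP (Suc (Suc n)) - 2 = 25 * (eP (Suc n) - 2) - (eP n - 2) + 23 * 2" by simp
  also have "23 dvd \<dots>" by (rule dvd_add[OF dvd_diff[OF dvd_mult[OF 3(1)] 3(2)] dvd_triv_left])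
  finally show ?case .
qed simp_all

lemma power_dvd_cancel:
  assumes "23 ^ k dvd a * b" "\<not> 23 dvd b"
  shows "(23::int) ^ k dvd a"
proof -
  have "coprime 23 b" by (rule prime_imp_coprime[OF prime_23 assms(2)])
  then have "coprime (23 ^ k) b" by simp
  then show ?thesis using assms(1) coprime_dvd_mult_left_iff by blast
qed

text \<open>
  By the Pell equation, \<open>(eP n - 2) * (eP n + 2)\<close> is divisible by \<open>69 (eQ n)\<^sup>2\<close>, and \<open>eP n + 2\<close> is prime to 23.
\<close>

lemma eP_cong_2:
  assumes "23 ^ k dvd eQ n"
  shows "23 ^ (2 * k + 1) dvd eP n - 2"
proof (rule power_dvd_cancel)
  have "(eP n - 2) * (eP n + 2) = 69 * (eQ n * eQ n)" using eP_eQ_pell[of n] by (simp add: algebra_simps)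
  moreover have "23 * (23 ^ k * 23 ^ k) dvd 69 * (eQ n * eQ n)"
    by (intro mult_dvd_mono assms) simp
  moreover have "(23::int) * (23 ^ k * 23 ^ k) = 23 ^ (2 * k + 1)" by (simp add: power_add mult_2)
  ultimately show "23 ^ (2 * k + 1) dvd (eP n - 2) * (eP n + 2)" by (simp only:)
  show "\<not> 23 dvd eP n + 2" using eP_mod_23[of n] by presburger
qed

text \<open>
  The binomial expansion of the \<open>i\<close>-th power of \<open>eP m + eQ m * rt\<close> modulo \<open>529 * eQ m\<close>.
\<close>

lemma eQ_multiple:
  assumes "23 dvd eQ m"
  shows "\<exists>w. 2 ^ i * eQ (m * i) = eQ m * w \<and> 529 dvd w - 2 ^ i * int i"
proof (induction i)
  case (Suc i)
  then obtain w where w: "2 ^ i * eQ (m * i) = eQ m * w" "529 dvd w - 2 ^ i * int i" by blast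
  have "23 dvd eQ m * w" using assms by simp
  then have "23 dvd 2 ^ i * eQ (m * i)" using w(1) by simp
  moreover have "\<not> 23 dvd (2::int) ^ i"
  proof
    assume "23 dvd (2::int) ^ i"
    from prime_dvd_power[OF prime_23 this] show False by simp
  qed
  ultimately have Qi: "23 dvd eQ (m * i)" using prime_dvd_mult_iff[OF prime_23] by blast
  have 1: "529 dvd eP (m * i) - 2"
    by (rule dvd_trans[OF _ eP_cong_2[of 1 "m * i"]]) (use Qi in simp_all)
  have 2: "529 dvd eP m - 2"
    by (rule dvd_trans[OF _ eP_cong_2[of 1 m]]) (use assms in simp_all)
  define w' where "w' = 2 ^ i * eP (m * i) + w * eP m"
  have "2 ^ Suc i * eQ (m * Suc i) = 2 ^ i * (2 * eQ (m * i + m))" by (simp add: add.commute)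
  also have "\<dots> = 2 ^ i * eP (m * i) * eQ m + (2 ^ i * eQ (m * i)) * eP m"
    unfolding eP_eQ_add by (simp add: algebra_simps)
  also have "\<dots> = eQ m * w'" unfolding w(1) w'_def by (simp add: algebra_simps)
  finally have "2 ^ Suc i * eQ (m * Suc i) = eQ m * w'" .
  moreover have "w' - 2 ^ Suc i * int (Suc i) = 2 ^ i * (eP (m * i) - 2) + w * (eP m - 2) + 2 * (w - 2 ^ i * int i)"
    unfolding w'_def by (simp add: algebra_simps)
  then have "529 dvd w' - 2 ^ Suc i * int (Suc i)"
    using dvd_add[OF dvd_add[OF dvd_mult[OF 1] dvd_mult[OF 2]] dvd_mult[OF w(2)]] by (simp only:)
  ultimately show ?case by blast
qed (intro exI[of _ 0], simp)

lemma eQ_23: "eQ 23 = 23 * 716881358470215457978680881739"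
proof -
  have 1: "eP 1 = 25" "eQ 1 = 3" by simp_all
  have 2: "eP 2 = 623" "eQ 2 = 75"
    by (simp_all add: numeral_2_eq_2)
  have 4: "eP 4 = 388127" "eQ 4 = 46725"
    using eP_eQ_add[of 2 2] by (simp_all add: 2)
  have 8: "eP 8 = 150642568127" "eQ 8 = 18135234075"
    using eP_eQ_add[of 4 4] by (simp_all add: 4)
  have 16: "eP 16 = 22693183331897836288127" "eQ 16 = 2731938234642279327525"
    using eP_eQ_add[of 8 8] by (simp_all add: 8)
  have 20: "eP 20 = 8807837167001043056962828127" "eQ 20 = 1060338991189965174558514875"
    using eP_eQ_add[of 16 4] by (simp_all add: 4 16)
  have 22: "eP 22 = 5487268417224859801414078200623" "eQ 22 = 660589489518213266511083438325"
    using eP_eQ_add[of 20 2] by (simp_all add: 2 20)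
  have 23: "eP 23 = 136961867380445820601573113374425" "eQ 23 = 16488271244814955533509660279997"
    using eP_eQ_add[of 22 1] by (simp_all add: 1 22)
  show ?thesis using 23 by simp
qed

text \<open>
  Raising a unit to the 23rd power increases the exponent of 23 in \<open>eQ\<close> by exactly one. The expansion
  applies once \<open>eQ\<close> is divisible by 23; the explicit value of \<open>eQ 23\<close> starts the induction.
\<close>

lemma eQ_power_23: "\<exists>u. eQ (23 ^ k) = 23 ^ k * u \<and> \<not> 23 dvd u"
proof (induction k)
  case (Suc k)
  show ?case
  proof (cases "k = 0")
    case True
    then show ?thesis using eQ_23 by simp
  next
    case False
    obtain u where u: "eQ (23 ^ k) = 23 ^ k * u" "\<not> 23 dvd u" using Suc by blast
    have "23 dvd eQ (23 ^ k)" unfolding u(1) using False by (simp add: dvd_power)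
    from eQ_multiple[OF this, of 23] obtain w where
      w: "2 ^ 23 * eQ (23 ^ k * 23) = eQ (23 ^ k) * w" "529 dvd w - 2 ^ 23 * int 23" by blast
    obtain x where x: "w - 2 ^ 23 * int 23 = 529 * x" using w(2) by (elim dvdE)
    define y where "y = 2 ^ 23 + 23 * x"
    have wy: "w = 23 * y" using x by (simp add: y_def)
    have "y = 8388608 + 23 * x" by (simp add: y_def)
    then have y: "\<not> 23 dvd y" by presburger
    have eq: "eQ (23 ^ Suc k) * 2 ^ 23 = 23 ^ Suc k * (u * y)"
      using w(1) unfolding wy u(1) by (simp add: mult_ac)
    have "23 ^ Suc k dvd eQ (23 ^ Suc k)"
      by (rule power_dvd_cancel[of _ _ "2 ^ 23"]) (unfold eq, rule dvd_triv_left, simp)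
    then obtain u' where u': "eQ (23 ^ Suc k) = 23 ^ Suc k * u'" by (elim dvdE)
    have "u' * 2 ^ 23 = u * y" using eq unfolding u' by simp
    moreover have "\<not> 23 dvd u * y" using u(2) y not_dvd_23_mult by blast
    ultimately have "\<not> 23 dvd u'" by (metis dvd_mult2)
    then show ?thesis using u' by blast
  qed
qed (intro exI[of _ 3], simp)

text \<open>
  For the points \<open>cz\<close> of the locale \<open>heteroclinic\<close> below, \<open>(eps ^ n + 1) * (cz - 2) = eE n / 2 + eD n / 138 * rt\<close>. If
  both numbers are divisible by high powers of 23, then \<open>cz\<close> is congruent to 2 modulo a high power of the prime above
  23, and the integer 2, the only one closer than the bound allows, gets a large weight.
\<close>

definition eE :: "nat \<Rightarrow> int" where "eE n = 57 * eQ n - 7 * eP n - 4"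
definition eD :: "nat \<Rightarrow> int" where "eD n = 57 * eP n - 483 * eQ n + 24"

lemma eD_mod_23: "23 dvd eD n"
proof -
  have "eD n = 57 * (eP n - 2) + 23 * (6 - 21 * eQ n)" by (simp add: eD_def)
  also have "23 dvd \<dots>" by (rule dvd_add[OF dvd_mult[OF eP_mod_23] dvd_triv_left])
  finally show ?thesis .
qed

lemma eD_eE: "eD n * (eD n - 48) = 69 * (eE n * (eE n + 8))"
proof -
  have "eD n * (eD n - 48) - 69 * (eE n * (eE n + 8)) = - 132 * (eP n * eP n - 69 * (eQ n * eQ n) - 4)"
    by (simp add: eD_def eE_def algebra_simps)
  then show ?thesis using eP_eQ_pell[of n] by simp
qed

lemma eE_shift:
  assumes "23 ^ k dvd eE n" "eQ (23 ^ k) = 23 ^ k * u"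
  shows "\<exists>x. 2 * eE (n + 23 ^ k) = 2 * eE n + 23 ^ k * (23 * x - u)"
proof -
  define m where "m = (23::nat) ^ k"
  have "23 ^ (2 * k + 1) dvd eP m - 2" using eP_cong_2[of k m] assms(2) by (simp add: m_def)
  then obtain z where z: "eP m = 2 + 23 ^ (2 * k + 1) * z" by (elim dvdE) (simp add: algebra_simps)
  obtain d where d: "eD n = 23 * d" using eD_mod_23[of n] by (elim dvdE)
  have Qm: "eQ m = 23 ^ k * u" using assms(2) by (simp add: m_def)
  have "2 * eE (n + m) = 57 * (2 * eQ (n + m)) - 7 * (2 * eP (n + m)) - 8" by (simp add: eE_def)
  also have "\<dots> = eQ m * (eD n - 24) + eP m * (eE n + 4) - 8"
    unfolding eP_eQ_add by (simp add: eD_def eE_def algebra_simps)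
  also have "\<dots> = 2 * eE n + 23 ^ k * (23 * (d * u - u + 23 ^ k * z * (eE n + 4)) - u)"
    unfolding z d Qm by (simp add: algebra_simps power_add mult_2 power_mult power2_eq_square)
  finally show ?thesis unfolding m_def by blast
qed

lemma eE_shift_dvd:
  assumes "23 ^ k dvd eE n"
  shows "23 ^ k dvd eE (n + 23 ^ k * j)"
proof (induction j)
  case (Suc j)
  obtain u where u: "eQ (23 ^ k) = 23 ^ k * u" using eQ_power_23[of k] by blast
  obtain x where "2 * eE (n + 23 ^ k * j + 23 ^ k) = 2 * eE (n + 23 ^ k * j) + 23 ^ k * (23 * x - u)"
    using eE_shift[OF Suc u] by blast
  then have "23 ^ k dvd eE (n + 23 ^ k * j + 23 ^ k) * 2" using Suc by (simp add: mult.commute)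
  then have "23 ^ k dvd eE (n + 23 ^ k * j + 23 ^ k)" by (rule power_dvd_cancel) simp
  then show ?case by (simp add: add_ac)
qed (use assms in simp)

text \<open>
  Hensel lifting: by \<open>eE_shift\<close>, adding a multiple of \<open>23 ^ k\<close> to the exponent \<open>n\<close> changes \<open>eE n\<close> modulo \<open>23 ^ (k + 1)\<close>
  by an arbitrary multiple of \<open>23 ^ k\<close>.
\<close>

lemma eE_solvable: "\<exists>n. 23 ^ k dvd eE n"
proof (induction k)
  case (Suc k)
  then obtain n where n: "23 ^ k dvd eE n" by blast
  obtain u where u: "eQ (23 ^ k) = 23 ^ k * u" "\<not> 23 dvd u" using eQ_power_23[of k] by blast
  define m where "m = (23::nat) ^ k"
  have ex: "\<exists>e x. eE (n + m * j) = 23 ^ k * e \<and> 2 * e = 2 * (eE n div 23 ^ k) + 23 * x - int j * u" for j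
  proof (induction j)
    case 0
    then show ?case using n by (intro exI[of _ "eE n div 23 ^ k"] exI[of _ 0]) simp
  next
    case (Suc j)
    then obtain e x where e: "eE (n + m * j) = 23 ^ k * e" "2 * e = 2 * (eE n div 23 ^ k) + 23 * x - int j * u" by blast
    obtain y where y: "2 * eE (n + m * j + m) = 2 * eE (n + m * j) + 23 ^ k * (23 * y - u)"
      using eE_shift[OF _ u(1), of "n + m * j"] e(1) by (auto simp: m_def)
    obtain e' where e': "eE (n + m * Suc j) = 23 ^ k * e'"
      using eE_shift_dvd[OF n, of "Suc j"] by (auto simp: m_def elim: dvdE)
    have "n + m * j + m = n + m * Suc j" by simp
    with y have "2 * eE (n + m * Suc j) = 2 * eE (n + m * j) + 23 ^ k * (23 * y - u)" by (simp only:)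
    then have "23 ^ k * (2 * e') = 23 ^ k * (2 * e + (23 * y - u))"
      unfolding e(1) e' by (simp only: distrib_left mult.left_commute)
    then have "2 * e' = 2 * e + (23 * y - u)" by simp
    then show ?case using e' e(2) by (intro exI[of _ e'] exI[of _ "x + y"]) (simp add: algebra_simps)
  qed
  define e0 where "e0 = eE n div 23 ^ k"
  have "coprime u 23" using prime_imp_coprime[OF prime_23 u(2)] by (simp add: coprime_commute)
  then obtain x y where xy: "x * u + y * 23 = 1" using bezout_int[of u 23] by auto
  define j where "j = nat ((2 * e0 * x) mod 23)"
  have "int j = (2 * e0 * x) mod 23" by (simp add: j_def)
  then obtain z where z: "int j = 2 * e0 * x + 23 * z"
    by (metis add_diff_cancel_left' minus_mult_div_eq_mod mult_minus_right uminus_add_conv_diff add.commute diff_conv_add_uminus)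
  obtain e w where e: "eE (n + m * j) = 23 ^ k * e" "2 * e = 2 * e0 + 23 * w - int j * u"
    using ex[of j] by (auto simp: e0_def)
  have "2 * e = 2 * e0 * (x * u + y * 23) + 23 * w - int j * u" using e(2) xy by simp
  also have "\<dots> = 23 * (2 * e0 * y + w - z * u)" unfolding z by (simp add: algebra_simps)
  finally have "23 dvd 2 * e" by simp
  then have "23 dvd e" by presburger
  then have "23 ^ Suc k dvd eE (n + m * j)" unfolding e(1) by (simp add: mult_dvd_mono mult.commute)
  then show ?case by blast
qed simp

theorem critical_exponents: "\<exists>n\<ge>N. 23 ^ k dvd eE n \<and> 23 ^ Suc k dvd eD n"
proof -
  obtain n0 where "23 ^ k dvd eE n0" using eE_solvable by blast
  from eE_shift_dvd[OF this, of N] have E: "23 ^ k dvd eE (n0 + 23 ^ k * N)" .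
  define n where "n = n0 + 23 ^ k * N"
  have "23 ^ Suc k dvd eD n * (eD n - 48)"
    unfolding eD_eE using E by (simp add: n_def mult_dvd_mono)
  moreover have "\<not> 23 dvd eD n - 48" using eD_mod_23[of n] by presburger
  ultimately have "23 ^ Suc k dvd eD n" by (rule power_dvd_cancel)
  moreover have "n \<ge> N" unfolding n_def by (simp add: trans_le_add2)
  ultimately show ?thesis using E n_def by blast
qed

section \<open>Points homoclinic to the critical point\<close>

text \<open>
  Multiplication by a power of the unit makes the two coordinates of a point of small norm small simultaneously. This
  reduces infinitely many integers \<open>q\<close> to finitely many for each position on the orbit.
\<close>

lemma balance:
  fixes x y :: real
  assumes "\<rho> > 0" "\<bar>x * y\<bar> * eps \<le> \<rho> * \<rho>"
  shows "(\<exists>K. \<bar>eps' ^ K * x\<bar> \<le> \<rho> \<and> \<bar>eps ^ K * y\<bar> \<le> \<rho>) \<or> (\<exists>K. \<bar>eps ^ K * x\<bar> \<le> \<rho> \<and> \<bar>eps' ^ K * y\<bar> \<le> \<rho>)"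
proof -
  have e: "0 < eps" "0 < eps'" "eps' < 1" using eps_bounds eps'_bounds by linarith+
  have main: "\<exists>K. \<bar>eps' ^ K * x\<bar> \<le> \<rho> \<and> \<bar>eps ^ K * y\<bar> \<le> \<rho>"
    if xy: "\<bar>x * y\<bar> * eps \<le> \<rho> * \<rho>" and x: "\<rho> < \<bar>x\<bar>" for x y :: real
  proof -
    have "\<exists>K. \<bar>eps' ^ K * x\<bar> \<le> \<rho>"
    proof -
      have "0 < \<rho> / \<bar>x\<bar>" using assms(1) x by auto
      then obtain K where "eps' ^ K < \<rho> / \<bar>x\<bar>" using real_arch_pow_inv[OF _ e(3)] by blast
      then have "eps' ^ K * \<bar>x\<bar> \<le> \<rho>" using x assms(1) by (simp add: pos_less_divide_eq)
      then show ?thesis using e by (intro exI[of _ K]) (simp add: abs_mult)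
    qed
    define K where "K = (LEAST K. \<bar>eps' ^ K * x\<bar> \<le> \<rho>)"
    have K: "\<bar>eps' ^ K * x\<bar> \<le> \<rho>" unfolding K_def by (rule LeastI_ex) fact
    have "K \<noteq> 0" using K x by (intro notI) simp
    then obtain i where i: "K = Suc i" using not0_implies_Suc by blast
    have "\<rho> < \<bar>eps' ^ i * x\<bar>"
      using not_less_Least[of i "\<lambda>K. \<bar>eps' ^ K * x\<bar> \<le> \<rho>"] i unfolding K_def[symmetric] by simp
    then have x': "\<rho> < eps' ^ i * \<bar>x\<bar>" using e by (simp add: abs_mult)
    have "\<rho> * (eps ^ K * \<bar>y\<bar>) \<le> (eps' ^ i * \<bar>x\<bar>) * (eps ^ K * \<bar>y\<bar>)"
      using x' e by (intro mult_right_mono) auto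
    also have "\<dots> = (eps' ^ i * eps ^ i) * (\<bar>x * y\<bar> * eps)" by (simp add: i abs_mult mult_ac)
    also have "\<dots> \<le> \<rho> * \<rho>" using xy by (simp add: eps_eps'_power)
    finally have "eps ^ K * \<bar>y\<bar> \<le> \<rho>" using assms(1) by simp
    then have "\<bar>eps ^ K * y\<bar> \<le> \<rho>" using e by (simp add: abs_mult)
    then show ?thesis using K by blast
  qed
  consider "\<bar>x\<bar> \<le> \<rho>" "\<bar>y\<bar> \<le> \<rho>" | "\<rho> < \<bar>x\<bar>" | "\<rho> < \<bar>y\<bar>" by linarith
  then show ?thesis
  proof cases
    case 1 then show ?thesis by (intro disjI1 exI[of _ 0]) simp
  next
    case 2 then show ?thesis using main[OF assms(2)] by blast
  next
    case 3
    have "\<bar>y * x\<bar> * eps \<le> \<rho> * \<rho>" using assms(2) by (simp add: mult.commute)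
    from main[OF this 3] show ?thesis by blast
  qed
qed

lemma cj_s: "cj s = - s"
  using cj_eq[of 0 "4 / 23"] by (simp add: s_def)

lemma KK_eps: "eps \<in> KK" "eps' \<in> KK" by (simp_all add: ZK_eps ZK_KK)

lemma ZK_power: "x \<in> ZK \<Longrightarrow> x ^ n \<in> ZK"
  by (induction n) (simp_all add: ZK_mult)

lemma KK_power: "x \<in> KK \<Longrightarrow> x ^ n \<in> KK"
  by (induction n) (simp_all add: KK_mult Rats_KK)

lemma cj_power: "x \<in> KK \<Longrightarrow> cj (x ^ n) = cj x ^ n"
  by (induction n) (simp_all add: cj_mult KK_power cj_rat)

lemma nm_eps_power: "nm (eps ^ n) = 1" "nm (eps' ^ n) = 1"
  by (simp_all add: nm_def cj_power KK_eps cj_eps eps_eps'_power)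

lemma F_eps: assumes "c > 0" "x \<in> KK" shows "F c (eps ^ n * x) = F c x" "F c (eps' ^ n * x) = F c x"
  using assms by (simp_all add: F_mult KK_power KK_eps F_unit nm_eps_power)

lemma F_cj: "x \<in> KK \<Longrightarrow> F c (cj x) = F c x"
  by (simp add: F_def nm_cj)

text \<open>
  The critical point is fixed by the units, modulo the ring of integers.
\<close>

lemma s_eps_power: "s * (eps ^ n - 1) \<in> ZK" "s * (eps' ^ n - 1) \<in> ZK"
proof -
  obtain t where t: "eP n - 2 = 23 * t" using eP_mod_23[of n] by (elim dvdE)
  have t': "real_of_int (eP n) = 2 + 23 * of_int t" using t by (simp add: algebra_simps flip: of_int_eq_iff[where 'a = real])
  have e: "even (eP n + eQ n)" by (rule eP_eQ_even)
  have "s * (eps ^ n - 1) = (of_int (12 * eQ n) + of_int (4 * t) * rt) / 2"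
    unfolding eps_power s_def t' by (simp add: algebra_simps add_divide_distrib diff_divide_distrib)
  moreover have "(of_int (12 * eQ n) + of_int (4 * t) * rt) / 2 \<in> ZK" by (rule ZK_I) simp
  ultimately show "s * (eps ^ n - 1) \<in> ZK" by (simp only:)
  have "s * (eps' ^ n - 1) = (of_int (- 12 * eQ n) + of_int (4 * t) * rt) / 2"
    unfolding eps'_power s_def t' by (simp add: algebra_simps add_divide_distrib diff_divide_distrib)
  moreover have "(of_int (- 12 * eQ n) + of_int (4 * t) * rt) / 2 \<in> ZK" by (rule ZK_I) simp
  ultimately show "s * (eps' ^ n - 1) \<in> ZK" by (simp only:)
qed

lemma ZK_minus_cj: assumes "x \<in> ZK" obtains b :: int where "x - cj x = of_int b * rt"
proof -
  obtain a b where *: "even (a + b)" "x = (of_int a + of_int b * rt) / 2" using assms by (rule ZK_E)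
  have "x - cj x = of_int b * rt" unfolding * cj_ZK_eq by (simp add: add_divide_distrib diff_divide_distrib)
  then show ?thesis by (rule that)
qed

lemma eps_power_gt: "n > 0 \<Longrightarrow> 24 < eps ^ n"
proof -
  assume "n > 0"
  then obtain i where i: "n = Suc i" using gr0_implies_Suc by blast
  have "1 \<le> eps ^ i" using eps_bounds by (intro one_le_power) linarith
  then have "eps * 1 \<le> eps * eps ^ i" using eps_bounds by (intro mult_left_mono) linarith+
  then show ?thesis using eps_bounds unfolding i power_Suc by linarith
qed

lemma eps'_power_inverse: "eps' ^ n = 1 / eps ^ n"
proof -
  have "eps ^ n \<noteq> 0" using eps_bounds by simp
  then show ?thesis using eps_eps'_power(2)[of n] by (simp add: nonzero_eq_divide_eq)
qed

text \<open>
  The point \<open>hz = s + 1 / (eps ^ n - 1)\<close> is periodic modulo the ring of integers with period \<open>n\<close>. Its orbit runs along an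
  orbit that is homoclinic to the critical point.
\<close>

locale homoclinic =
  fixes n :: nat
  assumes n: "n > 0"
begin

definition "en = eps ^ n"
definition "hz = s + 1 / (en - 1)"

lemma en: "24 < en" unfolding en_def by (rule eps_power_gt) (rule n)

lemma en_ZK: "en \<in> ZK" unfolding en_def by (intro ZK_power ZK_eps)

lemma cj_en: "cj en = 1 / en"
  unfolding en_def by (simp add: cj_power KK_eps cj_eps eps'_power_inverse)

lemma hz_KK: "hz \<in> KK"
  unfolding hz_def by (intro KK_add s_KK KK_divide KK_diff ZK_KK en_ZK ZK_1)

lemma cj_hz: "cj hz = - hz - 1"
proof -
  have "cj hz = - s + 1 / (1 / en - 1)"
    unfolding hz_def using en_ZK
    by (simp add: cj_add cj_divide cj_diff s_KK ZK_KK KK_diff KK_divide cj_s cj_en cj_rat)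
  also have "1 / (1 / en - 1) = - 1 - 1 / (en - 1)"
    using en by (simp add: divide_simps) (simp add: algebra_simps)
  finally show ?thesis by (simp add: hz_def)
qed

text \<open>
  The translates of \<open>hz\<close> and their negatives. This set is stable under conjugation and under the \<open>n\<close>-th power of the unit,
  which allows the exponent of the balancing unit to be reduced modulo the period.
\<close>

definition "orb = {w. \<exists>q\<in>ZK. w = hz - q \<or> w = - (hz - q)}"

lemma orb_I: "q \<in> ZK \<Longrightarrow> hz - q \<in> orb" "q \<in> ZK \<Longrightarrow> - (hz - q) \<in> orb"
  unfolding orb_def by blast+

lemma orb_E:
  assumes "w \<in> orb"
  obtains q where "q \<in> ZK" "w = hz - q" | q where "q \<in> ZK" "w = - (hz - q)"
  using assms unfolding orb_def by blast

lemma hz_diff_KK: "q \<in> ZK \<Longrightarrow> hz - q \<in> KK"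
  by (intro KK_diff hz_KK ZK_KK)

lemma orb_KK: "w \<in> orb \<Longrightarrow> w \<in> KK"
  by (elim orb_E) (simp_all only: hz_diff_KK KK_minus)

lemma orb_cj: assumes "w \<in> orb" shows "cj w \<in> orb"
proof -
  have c: "cj (hz - q) = - (hz - (- 1 - cj q))" "- 1 - cj q \<in> ZK" if "q \<in> ZK" for q
  proof -
    show "cj (hz - q) = - (hz - (- 1 - cj q))" using cj_hz that by (simp add: cj_diff hz_KK ZK_KK)
    have "- 1 \<in> ZK" using ZK_int[of "- 1"] by simp
    then show "- 1 - cj q \<in> ZK" by (intro ZK_diff ZK_cj that)
  qed
  from assms show ?thesis
  proof (cases rule: orb_E)
    case (1 q)
    then show ?thesis using orb_I(2)[OF c(2)] c(1) by simp
  next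
    case (2 q)
    then have "cj w = hz - (- 1 - cj q)" using c(1) cj_minus[OF hz_diff_KK[of q]] by simp
    then show ?thesis using orb_I(1)[OF c(2)] 2(1) by simp
  qed
qed

lemma orb_shift: assumes "w \<in> orb" shows "en * w \<in> orb"
proof -
  have r: "s * (en - 1) \<in> ZK" using s_eps_power(1)[of n] by (simp add: en_def)
  have "en * hz = hz + s * (en - 1) + 1" unfolding hz_def using en by (simp add: field_simps)
  then have c: "en * (hz - q) = hz - (en * q - s * (en - 1) - 1)" for q by (simp add: right_diff_distrib)
  have z: "en * q - s * (en - 1) - 1 \<in> ZK" if "q \<in> ZK" for q
    by (rule ZK_diff[OF ZK_diff[OF ZK_mult[OF en_ZK that] r] ZK_1])
  from assms show ?thesis
  proof (cases rule: orb_E)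
    case (1 q)
    then show ?thesis using orb_I(1)[OF z] by (simp only: c)
  next
    case (2 q)
    then show ?thesis using orb_I(2)[OF z] by (simp only: mult_minus_right c)
  qed
qed

text \<open>
  At every time of the period the difference of the two coordinates of the orbit stays, modulo \<open>rt\<close>, away from 0.
  Hence no integer is close in both coordinates.
\<close>

lemma orb_far_from_lattice:
  assumes "w \<in> orb" "\<bar>eps ^ K * w\<bar> \<le> 1 / 2" "\<bar>eps' ^ K * cj w\<bar> \<le> 1 / 2"
  shows False
  using assms
proof (induction K arbitrary: w rule: less_induct)
  case (less K)
  have wK: "w \<in> KK" by (rule orb_KK[OF less.prems(1)])
  show False
  proof (cases "K < n")
    case False
    have 1: "eps ^ (K - n) * (en * w) = eps ^ K * w"
      unfolding en_def using False by (simp flip: power_add mult.assoc)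
    have "cj (en * w) = eps' ^ n * cj w"
      using wK by (simp add: en_def cj_mult cj_power KK_eps KK_power cj_eps)
    then have 2: "eps' ^ (K - n) * cj (en * w) = eps' ^ K * cj w"
      using False by (simp flip: power_add mult.assoc)
    show False
      by (rule less.IH[of "K - n", OF _ orb_shift[OF less.prems(1)]])
         (use less.prems n False in \<open>simp_all add: 1 2\<close>)
  next
    case True
    obtain q where q: "q \<in> ZK" "w = hz - q \<or> w = - (hz - q)" using less.prems(1) unfolding orb_def by blast
    have cjq: "cj (hz - q) = cj hz - cj q" by (intro cj_diff hz_KK ZK_KK q)
    have b: "\<bar>eps ^ K * (hz - q)\<bar> \<le> 1 / 2" "\<bar>eps' ^ K * (cj hz - cj q)\<bar> \<le> 1 / 2"
      using less.prems(2,3) q(2) cjq cj_minus[OF KK_diff[OF hz_KK ZK_KK[OF q(1)]]]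
      by (auto simp: abs_mult abs_minus_commute)
    define g where "g = s * (eps ^ K - 1) - eps ^ K * q"
    have "g \<in> ZK" unfolding g_def by (intro ZK_diff s_eps_power ZK_mult ZK_power ZK_eps q)
    then obtain b :: int where gb: "g - cj g = of_int b * rt" by (rule ZK_minus_cj)
    have cjg: "cj g = - s * (eps' ^ K - 1) - eps' ^ K * cj q"
      unfolding g_def using q(1)
      by (simp add: cj_diff cj_mult cj_power KK_mult KK_diff KK_power KK_eps s_KK ZK_KK cj_s cj_eps cj_rat Rats_KK)
    have e1: "eps ^ K * (hz - q) = s + g + eps ^ K / (en - 1)"
      unfolding g_def hz_def by (simp add: algebra_simps)
    have e2: "eps' ^ K * (cj hz - cj q) = - s + cj g - eps' ^ K * (1 + 1 / (en - 1))"
      unfolding cjg cj_hz by (simp add: hz_def algebra_simps)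
    have f: "0 < 1 / (en - 1)" "1 / (en - 1) \<le> 1 / 23" using en by (simp_all add: divide_simps)
    have A1: "0 \<le> eps ^ K / (en - 1)" "eps ^ K / (en - 1) \<le> 5 / 100"
    proof -
      show "0 \<le> eps ^ K / (en - 1)" using en eps_bounds by simp
      have "n = Suc K + (n - Suc K)" using True by simp
      then have "en = eps * eps ^ K * eps ^ (n - Suc K)" unfolding en_def by (metis power_Suc power_add)
      moreover have "1 \<le> eps ^ (n - Suc K)" using eps_bounds by (intro one_le_power) linarith
      moreover have "24 * eps ^ K \<le> eps * eps ^ K" using eps_bounds by (intro mult_right_mono) auto
      moreover have "eps * eps ^ K * 1 \<le> eps * eps ^ K * eps ^ (n - Suc K)"
        using calculation(2) eps_bounds by (intro mult_left_mono) auto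
      ultimately have "24 * eps ^ K \<le> en" by linarith
      then show "eps ^ K / (en - 1) \<le> 5 / 100" using en by (simp add: pos_divide_le_eq)
    qed
    have A2: "0 \<le> eps' ^ K * (1 + 1 / (en - 1))" "eps' ^ K * (1 + 1 / (en - 1)) \<le> 105 / 100"
    proof -
      show "0 \<le> eps' ^ K * (1 + 1 / (en - 1))" using f eps'_bounds by simp
      have "eps' ^ K \<le> 1" using eps'_bounds by (intro power_le_one) linarith+
      then have "eps' ^ K * (1 + 1 / (en - 1)) \<le> 1 * (1 + 1 / (en - 1))" using f by (intro mult_right_mono) auto
      moreover have "1 * (1 + 1 / (en - 1)) \<le> 105 / 100" using f by simp
      ultimately show "eps' ^ K * (1 + 1 / (en - 1)) \<le> 105 / 100" by (rule order_trans)
    qed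
    have s: "144 / 100 < s" "s < 145 / 100" using rt_bounds by (simp_all add: s_def)
    have br: "- 5 < of_int b * rt" "of_int b * rt < - 1"
      using b e1 e2 A1 A2 s gb by linarith+
    have "b \<ge> 0 \<or> b \<le> - 1" by linarith
    then show False
    proof
      assume "b \<ge> 0"
      then have "0 \<le> of_int b * rt" by simp
      then show False using br(2) by linarith
    next
      assume "b \<le> - 1"
      then have "of_int b \<le> (- 1 :: real)" by linarith
      then have "of_int b * rt \<le> - 1 * rt" by (intro mult_right_mono) auto
      then show False using br(1) rt_bounds by linarith
    qed
  qed
qed

text \<open>
  If the norm were smaller than \<open>1/100\<close>, balancing would bring both coordinates below \<open>1/2\<close>.
\<close>

lemma nm_hz_ge: assumes "q \<in> ZK" shows "1 / 100 \<le> \<bar>nm (hz - q)\<bar>"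
proof (rule ccontr)
  assume "\<not> ?thesis"
  then have "\<bar>nm (hz - q)\<bar> * eps \<le> 1 / 100 * 25" using eps_bounds by (intro mult_mono) auto
  then have "\<bar>(hz - q) * cj (hz - q)\<bar> * eps \<le> 1 / 2 * (1 / 2)" by (simp add: nm_def)
  from balance[OF _ this]
  have bal: "(\<exists>K. \<bar>eps' ^ K * (hz - q)\<bar> \<le> 1 / 2 \<and> \<bar>eps ^ K * cj (hz - q)\<bar> \<le> 1 / 2) \<or>
      (\<exists>K. \<bar>eps ^ K * (hz - q)\<bar> \<le> 1 / 2 \<and> \<bar>eps' ^ K * cj (hz - q)\<bar> \<le> 1 / 2)" by simp
  have o: "hz - q \<in> orb" by (rule orb_I(1)[OF assms])
  have cc: "cj (cj (hz - q)) = hz - q" by (intro cj_cj hz_diff_KK assms)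
  from bal show False
  proof (elim disjE exE conjE)
    fix K assume "\<bar>eps' ^ K * (hz - q)\<bar> \<le> 1 / 2" "\<bar>eps ^ K * cj (hz - q)\<bar> \<le> 1 / 2"
    then show False using orb_far_from_lattice[OF orb_cj[OF o], of K] cc by simp
  next
    fix K assume "\<bar>eps ^ K * (hz - q)\<bar> \<le> 1 / 2" "\<bar>eps' ^ K * cj (hz - q)\<bar> \<le> 1 / 2"
    then show False using orb_far_from_lattice[OF o, of K] by simp
  qed
qed

end

text \<open>
  For \<open>n = 23 ^ k\<close> the denominator of the norm of \<open>hz - q\<close> is divisible by \<open>23 ^ k\<close> and its numerator is prime to 23. The
  norm is bounded below, and the weight is larger by the factor \<open>(23 / c) ^ k\<close> at least.
\<close>

theorem F_unbounded:
  assumes c: "0 < c" "c < 23"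
  shows "\<exists>z\<in>KK. \<forall>q\<in>ZK. B \<le> F c (z - q)"
proof -
  have "1 < 23 / c" using c by simp
  then obtain k0 where k0: "100 * B < (23 / c) ^ k0" using real_arch_pow by blast
  define k where "k = Suc k0"
  have "(23 / c) ^ k0 \<le> (23 / c) ^ k" using \<open>1 < 23 / c\<close> unfolding k_def by (intro power_increasing) auto
  then have k: "B \<le> 1 / 100 * (23 / c) ^ k" using k0 by linarith
  define n where "n = (23::nat) ^ k"
  interpret homoclinic n by unfold_locales (simp add: n_def)
  obtain u where u: "eQ n = 23 ^ k * u" using eQ_power_23[of k] unfolding n_def by blast
  have Q23: "23 dvd eQ n" unfolding u k_def by simp
  have "23 ^ (2 * k + 1) dvd eP n - 2" by (rule eP_cong_2) (simp add: u)
  then have Pk: "23 ^ k dvd eP n - 2" by (rule power_le_dvd) simp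
  obtain t where t: "eP n - 2 = 23 * t" using eP_mod_23[of n] by (elim dvdE)
  have P: "real_of_int (eP n) = 2 + 23 * of_int t" using t by (simp add: algebra_simps flip: of_int_eq_iff[where 'a = real])
  have "B \<le> F c (hz - q)" if qZ: "q \<in> ZK" for q
  proof -
    obtain a b where q: "even (a + b)" "q = (of_int a + of_int b * rt) / 2" using qZ by (rule ZK_E)
    define M N where "M = 4 + 24 * eQ n - 23 * (a * t) - 69 * (b * eQ n)"
      and "N = 8 * t - a * eQ n - 23 * (b * t)"
    have th: "en - 1 = (23 * of_int t + of_int (eQ n) * rt) / 2"
      unfolding en_def eps_power P by (simp add: add_divide_distrib)
    have "1 / (en - 1) * (en - 1) = 1" using en by simp
    then have "(hz - q) * (en - 1) = s * (en - 1) + 1 - q * (en - 1)"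
      unfolding hz_def by (simp add: left_diff_distrib distrib_right)
    also have "s * (en - 1) = 6 * of_int (eQ n) + 2 * of_int t * rt"
      unfolding th s_def by (simp add: algebra_simps add_divide_distrib)
    also have "q * (en - 1) = ((of_int a * (23 * of_int t) + 69 * of_int b * of_int (eQ n))
        + (of_int a * of_int (eQ n) + of_int b * (23 * of_int t)) * rt) / 4"
      unfolding th q(2) by (simp only: times_divide_times_eq quad_mult)
    finally have prod: "(hz - q) * (en - 1) = of_int M / 4 + of_int N / 4 * rt"
      unfolding M_def N_def
      by (simp add: add_divide_distrib diff_divide_distrib distrib_right left_diff_distrib)
    have en1: "en - 1 \<in> KK" by (intro KK_diff ZK_KK en_ZK ZK_1)
    have hq: "hz - q \<in> KK" by (intro hz_diff_KK qZ)
    have nm1: "nm (hz - q) * nm (en - 1) = of_int M / 4 * (of_int M / 4) - 69 * (of_int N / 4 * (of_int N / 4))"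
      unfolding nm_mult[OF hq en1, symmetric] prod by (intro nm_quad) auto
    have nm2: "nm (en - 1) = of_int (2 - eP n)"
    proof -
      have "nm (en - 1) = (en - 1) * (1 / en - 1)"
        by (simp add: nm_def cj_diff ZK_KK en_ZK cj_en cj_rat)
      also have "\<dots> = en * (1 / en) - en - 1 / en + 1" by (simp add: left_diff_distrib right_diff_distrib diff_divide_distrib)
      also have "\<dots> = 2 - (en + 1 / en)" using en by simp
      also have "1 / en = eps' ^ n" unfolding en_def by (rule eps'_power_inverse[symmetric])
      finally show ?thesis unfolding en_def eps_power eps'_power by (simp add: add_divide_distrib diff_divide_distrib)
    qed
    have P2: "eP n \<noteq> 2"
    proof
      assume "eP n = 2"
      then have "nm (en - 1) = 0" using nm2 by simp
      then show False using nm_eq_0_iff[OF en1] en by simp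
    qed
    have "nm (hz - q) * of_int (16 * (2 - eP n)) = 16 * (nm (hz - q) * of_int (2 - eP n))"
      by (simp only: of_int_mult of_int_numeral mult.left_commute)
    also have "\<dots> = 16 * (of_int M / 4 * (of_int M / 4) - 69 * (of_int N / 4 * (of_int N / 4)))"
      using nm1 unfolding nm2 by (simp only:)
    also have "\<dots> = of_int (M * M - 69 * (N * N))" by simp
    finally have "nm (hz - q) * of_int (16 * (2 - eP n)) = of_int (M * M - 69 * (N * N))" .
    moreover have "real_of_int (16 * (2 - eP n)) \<noteq> 0" using P2 by simp
    ultimately have nmq: "nm (hz - q) = of_int (M * M - 69 * (N * N)) / of_int (16 * (2 - eP n))"
      using nonzero_eq_divide_eq by blast
    have "23 dvd M - 4"
    proof -
      have "M - 4 = 24 * eQ n + 23 * (- (a * t) - 3 * (b * eQ n))" by (simp add: M_def)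
      also have "23 dvd \<dots>" by (rule dvd_add[OF dvd_mult[OF Q23] dvd_triv_left])
      finally show ?thesis .
    qed
    then have "\<not> 23 dvd M" by presburger
    then have "\<not> 23 dvd M * M" using not_dvd_23_mult by blast
    moreover have "(23::int) dvd 69 * (N * N)" by (rule dvd_mult2) simp
    ultimately have nd: "\<not> 23 dvd M * M - 69 * (N * N)" using dvd_add[of 23 "M * M - 69 * (N * N)" "69 * (N * N)"] by auto
    have "23 ^ k dvd 16 * (2 - eP n)" using Pk by (intro dvd_mult) (simp add: dvd_diff_commute)
    then have "\<bar>nm (hz - q)\<bar> * (23 / c) ^ k \<le> F c (hz - q)"
      unfolding F_def nmq using c nd P2 by (intro W_ge_abs_small) auto
    moreover have "1 / 100 * (23 / c) ^ k \<le> \<bar>nm (hz - q)\<bar> * (23 / c) ^ k"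
      using nm_hz_ge[OF qZ] c by (intro mult_right_mono) auto
    ultimately show ?thesis using k by linarith
  qed
  then show ?thesis using hz_KK by blast
qed

section \<open>Points near the heteroclinic orbit\<close>

text \<open>
  The point \<open>cz\<close> satisfies \<open>eps ^ n * cz = - cz\<close> modulo the ring of integers. Its orbit follows the heteroclinic orbit from
  \<open>s\<close> to \<open>- s\<close> and then returns along the negative of that orbit; \<open>tau\<close> is the conjugate of \<open>tt\<close>.
\<close>

locale heteroclinic = homoclinic n for n
begin

definition "cz = s + tt * (en / (en + 1))"
definition "tau = - rt - 5 + 2 * s"

lemma cz_eq: "(en + 1) * cz = (rt - 5 - s) * en + s"
proof -
  have "(en + 1) * cz = (en + 1) * s + tt * ((en + 1) * (en / (en + 1)))"
    by (simp add: cz_def distrib_left mult_ac)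
  also have "(en + 1) * (en / (en + 1)) = en" using en by simp
  also have "tt = rt - 5 - 2 * s" by (simp add: tt_def s_def)
  finally show ?thesis by (simp add: algebra_simps)
qed

lemma en_KK: "en \<in> KK" by (rule ZK_KK[OF en_ZK])

lemma cz_KK: "cz \<in> KK"
proof -
  have "tt \<in> KK" using KK_I[of "- 5" "15 / 23"] by (simp add: tt_def)
  then show ?thesis unfolding cz_def
    by (intro KK_add s_KK KK_mult KK_divide en_KK ZK_KK[OF ZK_1])
qed

lemma cj_cz: "cj cz = - s + tau * (1 / (en + 1))"
proof -
  have "cj tt = tau"
    using cj_eq[of "- 5" "15 / 23"] by (simp add: tt_def tau_def s_def)
  moreover have "tt \<in> KK" using KK_I[of "- 5" "15 / 23"] by (simp add: tt_def)
  ultimately have "cj cz = - s + tau * (1 / en / (1 / en + 1))"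
    unfolding cz_def
    by (simp add: cj_add cj_mult cj_divide s_KK KK_mult KK_divide KK_add en_KK Rats_KK cj_s cj_en cj_rat)
  also have "1 / en / (1 / en + 1) = 1 / (en + 1)"
  proof -
    have "1 / en + 1 = (en + 1) / en" using en by (simp add: add_divide_distrib)
    then show ?thesis using en by simp
  qed
  finally show ?thesis .
qed

lemma eps_cz: "eps * cz = cj cz + (23 + 3 * rt)"
proof -
  have et: "eps * tt = 5 + rt - 2 * s" by (rule eps_tt)
  have f: "en / (en + 1) = 1 - 1 / (en + 1)" using en by (simp add: divide_simps)
  have "eps * cz = eps * s + eps * tt * (en / (en + 1))" by (simp add: cz_def distrib_left)
  also have "\<dots> = (s + 18 + 2 * rt) - tau * (1 - 1 / (en + 1))"
    unfolding eps_s(1) et f by (simp add: tau_def add_divide_distrib algebra_simps)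
  also have "\<dots> = cj cz + (2 * s + 18 + 2 * rt - tau)" unfolding cj_cz by (simp add: algebra_simps)
  finally show ?thesis by (simp add: tau_def)
qed

text \<open>
  The translates of \<open>cz\<close> and their negatives, with the symmetries \<open>w \<mapsto> eps' * cj w\<close> and \<open>w \<mapsto> eps' ^ n * w\<close>.
\<close>

definition "corb = {w. \<exists>q\<in>ZK. w = cz - q \<or> w = - (cz - q)}"

lemma corb_I: "q \<in> ZK \<Longrightarrow> cz - q \<in> corb" "q \<in> ZK \<Longrightarrow> - (cz - q) \<in> corb"
  unfolding corb_def by blast+

lemma corb_E:
  assumes "w \<in> corb"
  obtains q where "q \<in> ZK" "w = cz - q" | q where "q \<in> ZK" "w = - (cz - q)"
  using assms unfolding corb_def by blast

lemma cz_diff_KK: "q \<in> ZK \<Longrightarrow> cz - q \<in> KK"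
  by (intro KK_diff cz_KK ZK_KK)

lemma corb_KK: "w \<in> corb \<Longrightarrow> w \<in> KK"
  by (elim corb_E) (simp_all only: cz_diff_KK KK_minus)

lemma corb_minus: "w \<in> corb \<Longrightarrow> - w \<in> corb"
  by (elim corb_E) (use corb_I in force)+

lemma eps'_en: "eps' ^ n * en = 1" unfolding en_def by (rule eps_eps'_power)

lemma corb_cj: assumes "w \<in> corb" shows "eps' * cj w \<in> corb"
proof -
  have c: "eps' * cj (cz - q) \<in> corb" if q: "q \<in> ZK" for q
  proof -
    have "cj (cz - q) = eps * cz - (23 + 3 * rt) - cj q"
      using eps_cz cj_diff[OF cz_KK ZK_KK[OF q]] by simp
    then have "eps' * cj (cz - q) = eps' * eps * cz - eps' * (23 + 3 * rt) - eps' * cj q"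
      by (simp add: right_diff_distrib mult.assoc)
    then have "eps' * cj (cz - q) = cz - (eps' * (23 + 3 * rt + cj q))"
      by (simp add: distrib_left)
    moreover have "eps' * (23 + 3 * rt + cj q) \<in> ZK"
      by (intro ZK_mult ZK_add ZK_eps ZK_cj q ZK_rt ZK_numeral)
    ultimately show ?thesis using corb_I(1) by simp
  qed
  from assms show ?thesis
  proof (cases rule: corb_E)
    case (1 q)
    then show ?thesis using c by simp
  next
    case (2 q)
    then have "eps' * cj w = - (eps' * cj (cz - q))" using cj_minus[OF cz_diff_KK[of q]] by simp
    then show ?thesis using corb_minus[OF c[OF 2(1)]] by simp
  qed
qed

lemma corb_shift: assumes "w \<in> corb" shows "eps' ^ n * w \<in> corb"
proof -
  define r where "r = (rt - 5) * en - s * (en - 1)"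
  have rZ: "r \<in> ZK"
    unfolding r_def
    by (rule ZK_diff[OF ZK_mult[OF ZK_diff[OF ZK_rt ZK_numeral] en_ZK] s_eps_power(1)[of n, folded en_def]])
  have "en * cz = - cz + r" using cz_eq by (simp add: r_def algebra_simps)
  then have "eps' ^ n * (en * cz) = eps' ^ n * (- cz + r)" by simp
  then have "cz = - (eps' ^ n * cz) + eps' ^ n * r"
    using eps'_en by (simp add: distrib_left right_diff_distrib flip: mult.assoc)
  then have c: "eps' ^ n * (cz - q) = - (cz - eps' ^ n * (r - q))" for q
    by (simp add: right_diff_distrib)
  have z: "eps' ^ n * (r - q) \<in> ZK" if "q \<in> ZK" for q
    by (intro ZK_mult ZK_power ZK_eps ZK_diff rZ that)
  from assms show ?thesis
  proof (cases rule: corb_E)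
    case (1 q)
    then show ?thesis using corb_I(2)[OF z] by (simp only: c)
  next
    case (2 q)
    then show ?thesis using corb_I(1)[OF z] by (simp only: mult_minus_right c minus_minus)
  qed
qed

text \<open>
  The shift reduces the exponent \<open>K\<close> modulo \<open>n\<close>, and the conjugation exchanges the two halves of the period.
\<close>

lemma corb_balanced:
  assumes "w \<in> corb" "\<bar>eps' ^ K * w\<bar> \<le> 5" "\<bar>eps ^ K * cj w\<bar> \<le> 5" "c > 0"
  shows "\<exists>w'\<in>corb. \<exists>J. 2 * J < n \<and> F c w' = F c w \<and> \<bar>nm w'\<bar> = \<bar>nm w\<bar> \<and> \<bar>eps' ^ J * w'\<bar> \<le> 5 \<and> \<bar>eps ^ J * cj w'\<bar> \<le> 5"
  using assms(1-3)
proof (induction K arbitrary: w rule: less_induct)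
  case (less K)
  have wK: "w \<in> KK" by (rule corb_KK[OF less.prems(1)])
  define w1 where "w1 = eps' ^ n * w"
  have w1: "w1 \<in> corb" unfolding w1_def by (rule corb_shift[OF less.prems(1)])
  have cj1: "cj w1 = eps ^ n * cj w"
    using wK by (simp add: w1_def cj_mult cj_power KK_eps KK_power cj_eps)
  have inv1: "F c w1 = F c w" "nm w1 = nm w"
    unfolding w1_def using assms(4) wK by (simp_all add: F_eps nm_mult KK_power KK_eps nm_eps_power)
  consider "2 * K < n" | "n \<le> K" | "K < n" "n \<le> 2 * K" by linarith
  then show ?case
  proof cases
    case 1
    then show ?thesis using less.prems by blast
  next
    case 2
    have "eps' ^ (K - n) * w1 = eps' ^ K * w" unfolding w1_def using 2 by (simp flip: power_add mult.assoc)
    moreover have "eps ^ (K - n) * cj w1 = eps ^ K * cj w" unfolding cj1 using 2 by (simp flip: power_add mult.assoc)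
    ultimately show ?thesis using less.IH[of "K - n" w1] less.prems(2,3) w1 inv1 2 n by simp
  next
    case 3
    define w2 where "w2 = eps' * cj w1"
    have w1K: "w1 \<in> KK" by (rule corb_KK[OF w1])
    have w2: "w2 \<in> corb" unfolding w2_def by (rule corb_cj[OF w1])
    have cj2: "cj w2 = eps * w1" using w1K by (simp add: w2_def cj_mult KK_eps cj_KK cj_eps cj_cj)
    have inv2: "F c w2 = F c w" "nm w2 = nm w"
      unfolding w2_def using assms(4) w1K F_eps(2)[of c "cj w1" 1] nm_eps_power(2)[of 1]
      by (simp_all add: cj_KK F_cj nm_mult KK_eps nm_cj inv1)
    define L where "L = n - K - 1"
    have nL: "n = K + Suc L" using 3 unfolding L_def by linarith
    have "eps' ^ L * w2 = eps ^ K * cj w"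
    proof -
      have "eps' ^ L * w2 = (eps' ^ Suc L * eps ^ Suc L) * (eps ^ K * cj w)"
        unfolding w2_def cj1 nL by (simp add: power_add mult_ac)
      then show ?thesis by (simp only: eps_eps'_power mult_1)
    qed
    moreover have "eps ^ L * cj w2 = eps' ^ K * w"
    proof -
      have "eps ^ L * cj w2 = (eps ^ Suc L * eps' ^ Suc L) * (eps' ^ K * w)"
        unfolding cj2 w1_def nL by (simp add: power_add mult_ac)
      then show ?thesis by (simp only: eps_eps'_power mult_1)
    qed
    moreover have "L < K" using 3 nL by linarith
    ultimately show ?thesis using less.IH[of L w2] less.prems(2,3) w2 inv2 by simp
  qed
qed

end

section \<open>Norms near the heteroclinic orbit\<close>

lemma abs_mult_ge_1:
  fixes x y :: real
  assumes "\<alpha> \<le> \<bar>x\<bar>" "\<beta> \<le> \<bar>y\<bar>" "0 \<le> \<alpha>" "0 \<le> \<beta>" "1 \<le> \<alpha> * \<beta>"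
  shows "1 \<le> \<bar>x * y\<bar>"
proof -
  have "\<alpha> * \<beta> \<le> \<bar>x\<bar> * \<bar>y\<bar>" using assms by (intro mult_mono) auto
  then show ?thesis using assms(5) by (simp add: abs_mult)
qed

lemma s_bounds: "1444 / 1000 < s" "s < 1445 / 1000"
  using rt_bounds by (simp_all add: s_def)

lemma tt_bounds: "4173 / 10000 < tt" "tt < 4174 / 10000"
  using rt_bounds by (simp_all add: tt_def)

text \<open>
  The value \<open>kap\<close> is attained at the exit point \<open>u = tt\<close> itself, by the integer \<open>(5 + rt) / 2\<close>.
\<close>

lemma kap_factor: "(5 / 2 + rt / 2 - s - tt) * (rt / 2 - 5 / 2 - s) = kap"
proof -
  have 1: "5 / 2 + rt / 2 - s - tt = 15 / 2 + - 15 / 46 * rt" by (simp add: s_def tt_def)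
  have 2: "rt / 2 - 5 / 2 - s = - 5 / 2 + 15 / 46 * rt" by (simp add: s_def)
  show ?thesis unfolding 1 2 quad_mult by (simp add: kap_def diff_divide_distrib)
qed

text \<open>
  Only finitely many integers have both coordinates within 5 of the point. All of them are far away in norm,
  except \<open>(5 + rt) / 2\<close>, for which the minimum over the segment is \<open>kap\<close>, and 2, which is close to the point once \<open>u\<close> is
  large.
\<close>

lemma lattice_near_critical:
  fixes a b :: int
  assumes ab: "even (a + b)" and u: "0 \<le> u" "u \<le> tt" and v: "\<bar>v\<bar> \<le> 1 / 100"
    and x: "x = s + u - (of_int a + of_int b * rt) / 2" "\<bar>x\<bar> \<le> 5"
    and y: "y = - s + v - (of_int a - of_int b * rt) / 2" "\<bar>y\<bar> \<le> 5"
    and ex: "a = 4 \<Longrightarrow> b = 0 \<Longrightarrow> u \<le> 2 / 100"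
  shows "kap - 5 * \<bar>v\<bar> \<le> \<bar>x * y\<bar>"
proof -
  have x': "x = s + u - of_int a / 2 - of_int b * rt / 2" using x(1) by (simp add: add_divide_distrib)
  have y': "y = - s + v - of_int a / 2 + of_int b * rt / 2" using y(1) by (simp add: diff_divide_distrib)
  note bd = s_bounds tt_bounds u v rt_bounds
  have one: "kap - 5 * \<bar>v\<bar> \<le> \<bar>x * y\<bar>" if "1 \<le> \<bar>x * y\<bar>" using that kap_bounds by linarith
  have "x - y = 2 * s + u - v - of_int b * rt" using x' y' by simp
  then have br: "- 8 < of_int b * rt" "of_int b * rt < 14" using x(2) y(2) bd by linarith+
  have b01: "b = 0 \<or> b = 1"
  proof -
    have "b > - 1"
    proof (rule ccontr)
      assume "\<not> b > - 1"
      then have "of_int b \<le> (- 1 :: real)" by linarith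
      then have "of_int b * rt \<le> - 1 * rt" by (intro mult_right_mono) auto
      then show False using br rt_bounds by linarith
    qed
    moreover have "b < 2"
    proof (rule ccontr)
      assume "\<not> b < 2"
      then have "2 \<le> (of_int b :: real)" by linarith
      then have "2 * rt \<le> of_int b * rt" by (intro mult_right_mono) auto
      then show False using br rt_bounds by linarith
    qed
    ultimately show ?thesis by linarith
  qed
  then show ?thesis
  proof
    assume b: "b = 0"
    then obtain k where k: "a = 2 * k" using ab by (auto elim: evenE)
    have xy: "x = s + u - of_int k" "y = - s + v - of_int k" using x' y' b k by simp_all
    have "- 4 < real_of_int k" "real_of_int k < 4" using xy x(2) y(2) bd by linarith+
    then have "k \<in> {- 3, - 2, - 1, 0, 1, 2, 3}" by force
    then consider "k = - 3" | "k = - 2" | "k = - 1" | "k = 0" | "k = 1" | "k = 2" | "k = 3" by blast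
    then have "1 \<le> \<bar>x * y\<bar>"
    proof cases
      case 1 show ?thesis by (rule abs_mult_ge_1[of 4 _ "3 / 2"]) (use 1 xy bd in linarith)+
    next
      case 2 show ?thesis by (rule abs_mult_ge_1[of 3 _ "1 / 2"]) (use 2 xy bd in linarith)+
    next
      case 3 show ?thesis by (rule abs_mult_ge_1[of "244 / 100" _ "43 / 100"]) (use 3 xy bd in linarith)+
    next
      case 4 show ?thesis by (rule abs_mult_ge_1[of "14 / 10" _ "14 / 10"]) (use 4 xy bd in linarith)+
    next
      case 5 show ?thesis by (rule abs_mult_ge_1[of "44 / 100" _ "243 / 100"]) (use 5 xy bd in linarith)+
    next
      case 6
      have "u \<le> 2 / 100" using ex b k 6 by simp
      show ?thesis by (rule abs_mult_ge_1[of "1 / 2" _ 3]) (use \<open>u \<le> 2 / 100\<close> 6 xy bd in linarith)+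
    next
      case 7 show ?thesis by (rule abs_mult_ge_1[of 1 _ 4]) (use 7 xy bd in linarith)+
    qed
    then show ?thesis by (rule one)
  next
    assume b: "b = 1"
    then obtain k where k: "a = 2 * k + 1" using ab by (metis add_diff_cancel_right' evenE oddE even_add odd_one)
    have xy: "x = s + u - of_int k - 1 / 2 - rt / 2" "y = - s + v - of_int k - 1 / 2 + rt / 2"
      using x' y' b k by (simp_all add: add_divide_distrib)
    have "- 3 < real_of_int k" "real_of_int k < 3" using xy x(2) y(2) bd by linarith+
    then have "k \<in> {- 2, - 1, 0, 1, 2}" by force
    then consider "k = - 2" | "k = - 1" | "k = 0" | "k = 1" | "k = 2" by blast
    then show ?thesis
    proof cases
      case 1 show ?thesis by (rule one, rule abs_mult_ge_1[of "7 / 10" _ 4]) (use 1 xy bd in linarith)+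
    next
      case 2 show ?thesis by (rule one, rule abs_mult_ge_1[of "17 / 10" _ 3]) (use 2 xy bd in linarith)+
    next
      case 3 show ?thesis by (rule one, rule abs_mult_ge_1[of 2 _ 2]) (use 3 xy bd in linarith)+
    next
      case 4 show ?thesis by (rule one, rule abs_mult_ge_1[of 3 _ 1]) (use 4 xy bd in linarith)+
    next
      case 5
      define \<alpha> \<beta> where "\<alpha> = 5 / 2 + rt / 2 - s - tt" and "\<beta> = rt / 2 - 5 / 2 - s"
      have ab: "0 \<le> \<alpha>" "\<alpha> \<le> 5" "1 / 5 \<le> \<beta>" using bd unfolding \<alpha>_def \<beta>_def by linarith+
      have xa: "\<alpha> \<le> \<bar>x\<bar>" using xy(1) 5 u bd unfolding \<alpha>_def by linarith
      have yb: "\<beta> - \<bar>v\<bar> \<le> \<bar>y\<bar>" using xy(2) 5 unfolding \<beta>_def by linarith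
      have "\<alpha> * (\<beta> - \<bar>v\<bar>) \<le> \<bar>x\<bar> * \<bar>y\<bar>" using xa yb ab v by (intro mult_mono) auto
      moreover have "\<alpha> * \<bar>v\<bar> \<le> 5 * \<bar>v\<bar>" using ab by (intro mult_right_mono) auto
      moreover have "\<alpha> * \<beta> = kap" unfolding \<alpha>_def \<beta>_def by (rule kap_factor)
      ultimately show ?thesis by (simp add: abs_mult right_diff_distrib)
    qed
  qed
qed

context heteroclinic
begin

text \<open>
  Before the middle of the period, the orbit has run through the unstable segment of \<open>s\<close> only, at a distance of order
  \<open>eps' ^ (n div 2)\<close> from it.
\<close>

lemma balanced_norm_ge:
  assumes q: "q \<in> ZK" and small: "11 * eps' ^ (n div 2) \<le> 1 / 100" and J: "2 * J < n"
    and b: "\<bar>eps' ^ J * (cz - q)\<bar> \<le> 5" "\<bar>eps ^ J * cj (cz - q)\<bar> \<le> 5" and q2: "q \<noteq> 2"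
  shows "kap - 55 * eps' ^ (n div 2) \<le> \<bar>nm (cz - q)\<bar>"
proof -
  define u where "u = eps' ^ J * (tt * (en / (en + 1)))"
  define v where "v = eps ^ J * (tau * (1 / (en + 1)))"
  define p where "p = eps' ^ J * q - s * (eps' ^ J - 1)"
  have e: "0 < eps" "0 < eps'" "eps' < 1" using eps_bounds eps'_bounds by linarith+
  have f: "0 \<le> en / (en + 1)" "en / (en + 1) \<le> 1" using en by simp_all
  have pZ: "p \<in> ZK" unfolding p_def by (rule ZK_diff[OF ZK_mult[OF ZK_power[OF ZK_eps(2)] q] s_eps_power(2)])
  have cjp: "cj p = eps ^ J * cj q + s * (eps ^ J - 1)"
    unfolding p_def using q
    by (simp add: cj_diff cj_mult cj_power KK_mult KK_diff KK_power KK_eps s_KK ZK_KK cj_s cj_eps cj_rat Rats_KK)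
  have ux: "eps' ^ J * (cz - q) = s + u - p" unfolding u_def p_def cz_def by (simp add: algebra_simps)
  have vy: "eps ^ J * cj (cz - q) = - s + v - cj p"
    unfolding cjp v_def cj_diff[OF cz_KK ZK_KK[OF q]] cj_cz by (simp add: algebra_simps)
  have u0: "0 \<le> u" unfolding u_def using e f tt_bounds by (intro mult_nonneg_nonneg zero_le_power) auto
  have eJ: "eps' ^ J \<le> 1" using e by (simp add: power_le_one)
  have u1: "u \<le> eps' ^ J * tt"
  proof -
    have "tt * (en / (en + 1)) \<le> tt * 1" using f tt_bounds by (intro mult_left_mono) auto
    then show ?thesis unfolding u_def using e by (intro mult_left_mono) auto
  qed
  have "eps' ^ J * tt \<le> 1 * tt" using eJ tt_bounds by (intro mult_right_mono) auto
  then have u2: "u \<le> tt" using u1 by linarith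
  have tau: "\<bar>tau\<bar> \<le> 11" using rt_bounds s_bounds unfolding tau_def by linarith
  have v1: "\<bar>v\<bar> \<le> 11 * eps' ^ (n div 2)"
  proof -
    have "eps ^ J * (1 / (en + 1)) \<le> eps ^ J * (1 / en)" using en e by (intro mult_left_mono) (auto simp: frac_le)
    also have "1 / en = eps' ^ n" unfolding en_def by (rule eps'_power_inverse[symmetric])
    also have "eps ^ J * eps' ^ n = eps' ^ (n - J)"
    proof -
      have "eps' ^ n = eps' ^ J * eps' ^ (n - J)" using J by (simp flip: power_add)
      then show ?thesis by (simp add: eps_eps'_power flip: mult.assoc)
    qed
    also have "eps' ^ (n - J) \<le> eps' ^ (n div 2)" using e J by (intro power_decreasing) auto
    finally have *: "eps ^ J * (1 / (en + 1)) \<le> eps' ^ (n div 2)" .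
    have "\<bar>v\<bar> = \<bar>tau\<bar> * (eps ^ J * (1 / (en + 1)))" unfolding v_def using e en by (simp add: abs_mult)
    also have "\<dots> \<le> 11 * eps' ^ (n div 2)" using tau * e en by (intro mult_mono) auto
    finally show ?thesis .
  qed
  then have v2: "\<bar>v\<bar> \<le> 1 / 100" using small by linarith
  obtain a b' where ab: "even (a + b')" "p = (of_int a + of_int b' * rt) / 2" using pZ by (rule ZK_E)
  have "u \<le> 2 / 100" if "a = 4" "b' = 0"
  proof (cases J)
    case 0
    then have "q = 2" using ab(2) that unfolding p_def by simp
    then show ?thesis using q2 by simp
  next
    case (Suc i)
    have "eps' ^ i \<le> 1" using e by (simp add: power_le_one)
    then have "eps' * eps' ^ i \<le> eps' * 1" using e by (intro mult_left_mono) auto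
    then have "eps' ^ J \<le> 401 / 10000" using eps'_bounds unfolding Suc power_Suc by linarith
    then have "eps' ^ J * tt \<le> 401 / 10000 * (4174 / 10000)" using e tt_bounds by (intro mult_mono) auto
    then show ?thesis using u1 by simp
  qed
  then have "kap - 5 * \<bar>v\<bar> \<le> \<bar>(eps' ^ J * (cz - q)) * (eps ^ J * cj (cz - q))\<bar>"
    using b ux vy ab(2) cj_ZK_eq[of a b']
    by (intro lattice_near_critical[OF ab(1) u0 u2 v2]) simp_all
  also have "(eps' ^ J * (cz - q)) * (eps ^ J * cj (cz - q)) = (eps' ^ J * eps ^ J) * nm (cz - q)"
    by (simp add: nm_def mult_ac)
  also have "\<dots> = nm (cz - q)" by (simp only: eps_eps'_power mult_1)
  finally show ?thesis using v1 by linarith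
qed

lemma nm_en_plus_1: "nm (en + 1) = of_int (2 + eP n)"
proof -
  have "nm (en + 1) = (en + 1) * (1 / en + 1)"
    by (simp add: nm_def cj_add en_KK Rats_KK cj_en cj_rat)
  also have "\<dots> = en * (1 / en) + en + 1 / en + 1" by (simp add: distrib_left distrib_right add_divide_distrib)
  also have "\<dots> = 2 + (en + 1 / en)" using en by simp
  also have "1 / en = eps' ^ n" unfolding en_def by (rule eps'_power_inverse[symmetric])
  finally show ?thesis unfolding en_def eps_power eps'_power by (simp add: add_divide_distrib diff_divide_distrib)
qed

lemma denominator: "\<not> 23 dvd 2 + eP n" "2 + eP n \<noteq> 0"
proof -
  show n23: "\<not> 23 dvd 2 + eP n" using eP_mod_23[of n] by presburger
  then show "2 + eP n \<noteq> 0" by auto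
qed

text \<open>
  The denominator is prime to 23 because \<open>eP n\<close> is congruent to 2; so the weight of a translate is never below its norm.
\<close>

lemma nm_cz_diff:
  assumes "q \<in> ZK"
  shows "\<exists>m. nm (cz - q) = of_int m / of_int (2 + eP n)"
proof -
  have "(en + 1) * (cz - q) = (rt - 5) * en - s * (en - 1) - q * (en + 1)"
    using cz_eq by (simp add: algebra_simps)
  moreover have "(rt - 5) * en - s * (en - 1) - q * (en + 1) \<in> ZK"
    by (rule ZK_diff[OF ZK_diff[OF ZK_mult[OF ZK_diff[OF ZK_rt ZK_numeral] en_ZK] s_eps_power(1)[of n, folded en_def]]
        ZK_mult[OF assms ZK_add[OF en_ZK ZK_1]]])
  ultimately obtain m :: int where m: "nm ((en + 1) * (cz - q)) = of_int m" using nm_ZK by metis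
  have "nm (cz - q) * of_int (2 + eP n) = of_int m"
    using m nm_mult[OF KK_add[OF en_KK ZK_KK[OF ZK_1]] cz_diff_KK[OF assms]]
    unfolding nm_en_plus_1 by (simp only: mult.commute)
  moreover have "real_of_int (2 + eP n) \<noteq> 0" using denominator(2) by (simp only: of_int_eq_0_iff not_False_eq_True)
  ultimately have "nm (cz - q) = of_int m / of_int (2 + eP n)" using nonzero_eq_divide_eq by blast
  then show ?thesis ..
qed

lemma F_cz_ge_norm:
  assumes "c \<ge> 23" "q \<in> ZK"
  shows "\<bar>nm (cz - q)\<bar> \<le> F c (cz - q)"
proof -
  obtain m where eq: "nm (cz - q) = of_int m / of_int (2 + eP n)" using nm_cz_diff[OF assms(2)] by blast
  have "\<bar>of_int m / of_int (2 + eP n)\<bar> * (c / 23) ^ 0 \<le> W c (of_int m / of_int (2 + eP n))"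
    by (rule W_ge_abs) (use assms denominator in auto)
  then show ?thesis unfolding F_def eq by simp
qed

text \<open>
  The norms of the points congruent to \<open>s\<close> or \<open>- s\<close> include \<open>- 48 / 23\<close>, whose denominator is not prime to 23.
\<close>

lemma cz_not_critical: "cz - s \<notin> ZK" "cz + s \<notin> ZK"
proof -
  have nx: "nm s = - 48 / 23" using nm_quad[of 0 "4 / 23"] by (simp add: s_def)
  have ne: "nm (cz - q) \<noteq> - 48 / 23" if q: "q \<in> ZK" for q
  proof
    assume e: "nm (cz - q) = - 48 / 23"
    obtain m where "nm (cz - q) = of_int m / of_int (2 + eP n)" using nm_cz_diff[OF q] by blast
    then have "of_int m / of_int (2 + eP n) = (- 48 / 23 :: real)" unfolding e by (rule sym)
    moreover have "real_of_int (2 + eP n) \<noteq> 0" using denominator(2) by (simp only: of_int_eq_0_iff not_False_eq_True)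
    ultimately have "of_int m = (- 48 / 23) * real_of_int (2 + eP n)" using nonzero_divide_eq_eq by blast
    then have "of_int m * 23 = (- 48) * real_of_int (2 + eP n)" by linarith
    then have "real_of_int (m * 23) = real_of_int (- 48 * (2 + eP n))" by (simp only: of_int_mult of_int_minus of_int_numeral)
    then have "m * 23 = - 48 * (2 + eP n)" by (simp only: of_int_eq_iff)
    then have "23 * (- m) = 48 * (2 + eP n)" by linarith
    then have "23 dvd 48 * (2 + eP n)" using dvd_triv_left[of 23 "- m"] by (simp only:)
    then have "23 dvd (48::int) \<or> 23 dvd 2 + eP n" using prime_dvd_mult_iff[OF prime_23] by blast
    moreover have "\<not> 23 dvd (48::int)" by simp
    ultimately show False using denominator(1) by blast
  qed
  show "cz - s \<notin> ZK" using ne[of "cz - s"] nx unfolding diff_diff_eq2 add_diff_cancel_left' by blast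
  have "nm (- s) = - 48 / 23" using nx cj_minus[OF s_KK] by (simp add: nm_def)
  moreover have "cz - (cz + s) = - s" by simp
  ultimately show "cz + s \<notin> ZK" using ne[of "cz + s"] by metis
qed

text \<open>
  The norm of \<open>cz - 2\<close> is only about one half, but its numerator contains \<open>23 ^ 10\<close>, so that the weight is larger by
  \<open>(25 / 23) ^ 10\<close> at least.
\<close>

lemma F_cz_2:
  assumes c: "c \<ge> 25" and small: "11 * eps' ^ (n div 2) \<le> 1 / 100"
    and k: "23 ^ 5 dvd eE n" "23 ^ 6 dvd eD n"
  shows "kap \<le> F c (cz - 2)"
proof -
  obtain e where e: "eE n = 23 ^ 5 * e" using k(1) by (elim dvdE)
  obtain d where d: "eD n = 23 ^ 6 * d" using k(2) by (elim dvdE)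
  have "(en + 1) * (cz - 2) = of_int (eE n) / 2 + of_int (eD n) / 138 * rt"
  proof -
    have "(en + 1) * (cz - 2) = (rt - 7 - s) * en + (s - 2)" using cz_eq by (simp add: algebra_simps)
    also have "(rt - 7 - s) * en = (- 7 + 19 / 23 * rt) * (of_int (eP n) / 2 + of_int (eQ n) / 2 * rt)"
      unfolding en_def eps_power by (simp add: s_def add_divide_distrib)
    also have "s - 2 = - 2 + 4 / 23 * rt" by (simp add: s_def)
    finally have "(en + 1) * (cz - 2) = (- 7 * (of_int (eP n) / 2) + 69 * (19 / 23) * (of_int (eQ n) / 2))
        + (- 7 * (of_int (eQ n) / 2) + 19 / 23 * (of_int (eP n) / 2)) * rt + (- 2 + 4 / 23 * rt)"
      unfolding quad_mult .
    then show ?thesis unfolding eE_def eD_def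
      by (simp add: add_divide_distrib diff_divide_distrib distrib_right left_diff_distrib)
  qed
  then have "nm ((en + 1) * (cz - 2)) = of_int (eE n) / 2 * (of_int (eE n) / 2) - 69 * (of_int (eD n) / 138 * (of_int (eD n) / 138))"
    using nm_quad[of "of_int (eE n) / 2" "of_int (eD n) / 138"] by simp
  also have "\<dots> = of_int (23 ^ 10 * (3 * (e * e) - 23 * (d * d))) / 12"
    unfolding e d by (simp add: diff_divide_distrib)
  finally have N: "nm ((en + 1) * (cz - 2)) = of_int (23 ^ 10 * (3 * (e * e) - 23 * (d * d))) / 12" .
  have "nm (cz - 2) * of_int (12 * (2 + eP n)) = 12 * (of_int (2 + eP n) * nm (cz - 2))"
    by (simp only: of_int_mult of_int_numeral mult_ac)
  also have "\<dots> = 12 * nm ((en + 1) * (cz - 2))"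
    using nm_mult[OF KK_add[OF en_KK ZK_KK[OF ZK_1]] cz_diff_KK[of 2]] unfolding nm_en_plus_1 by simp
  also have "\<dots> = of_int (23 ^ 10 * (3 * (e * e) - 23 * (d * d)))" unfolding N by simp
  finally have "nm (cz - 2) * of_int (12 * (2 + eP n)) = of_int (23 ^ 10 * (3 * (e * e) - 23 * (d * d)))" .
  moreover have "real_of_int (12 * (2 + eP n)) \<noteq> 0" using denominator(2) by (simp only: of_int_eq_0_iff) simp
  ultimately have eq: "nm (cz - 2) = of_int (23 ^ 10 * (3 * (e * e) - 23 * (d * d))) / of_int (12 * (2 + eP n))"
    using nonzero_eq_divide_eq by blast
  have nd: "\<not> 23 dvd 12 * (2 + eP n)" by (rule not_dvd_23_mult[OF _ denominator(1)]) simp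
  have ge: "\<bar>nm (cz - 2)\<bar> * (c / 23) ^ 10 \<le> F c (cz - 2)"
    unfolding F_def eq by (rule W_ge_abs) (use c nd denominator(2) in auto)
  have nm: "47 / 100 \<le> \<bar>nm (cz - 2)\<bar>"
  proof -
    have f: "0 \<le> en / (en + 1)" "en / (en + 1) \<le> 1" using en by simp_all
    have "tt * (en / (en + 1)) \<le> tt * 1" using f tt_bounds by (intro mult_left_mono) auto
    moreover have "s + tt = 19 / 23 * rt - 5" by (simp add: s_def tt_def)
    ultimately have 1: "1380 / 10000 \<le> \<bar>cz - 2\<bar>" using rt_bounds unfolding cz_def by linarith
    have e: "0 < eps'" "eps' < 1" using eps'_bounds by linarith+
    have "\<bar>tau\<bar> * (1 / (en + 1)) \<le> 11 * (1 / 25)"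
      using rt_bounds s_bounds en unfolding tau_def by (intro mult_mono) (auto simp: divide_simps)
    have tau: "tau < 0" using rt_bounds s_bounds unfolding tau_def by linarith
    have "tau * (1 / (en + 1)) \<le> 0" using tau en by (intro mult_nonpos_nonneg) auto
    then have 2: "344 / 100 \<le> \<bar>cj (cz - 2)\<bar>"
      using cj_diff[OF cz_KK ZK_KK[of 2]] s_bounds by (simp add: cj_rat cj_cz)
    have "1380 / 10000 * (344 / 100) \<le> \<bar>cz - 2\<bar> * \<bar>cj (cz - 2)\<bar>" using 1 2 by (intro mult_mono) auto
    then show ?thesis by (simp add: nm_def abs_mult)
  qed
  have "(25 / 23) ^ 10 \<le> (c / 23) ^ 10" using c by (intro power_mono) auto
  then have "47 / 100 * (25 / 23) ^ 10 \<le> \<bar>nm (cz - 2)\<bar> * (c / 23) ^ 10"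
    using nm by (intro mult_mono) auto
  moreover have "1 \<le> 47 / 100 * (25 / 23 :: real) ^ 10" by (simp add: power_divide)
  ultimately show ?thesis using ge kap_bounds by linarith
qed

lemma F_cz_ge:
  assumes c: "c \<ge> 25" and small: "11 * eps' ^ (n div 2) \<le> 1 / 100"
    and k: "23 ^ 5 dvd eE n" "23 ^ 6 dvd eD n" and q: "q \<in> ZK"
  shows "kap - 55 * eps' ^ (n div 2) \<le> F c (cz - q)"
proof (rule ccontr)
  assume neg: "\<not> ?thesis"
  have c0: "c > 0" "c \<ge> 23" using c by linarith+
  have e: "0 < eps'" using eps'_bounds by linarith
  have o: "cz - q \<in> corb" by (rule corb_I(1)[OF q])
  have cc: "cj (cj (cz - q)) = cz - q" by (intro cj_cj cz_diff_KK q)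
  have "\<bar>nm (cz - q)\<bar> \<le> kap" using F_cz_ge_norm[OF c0(2) q] neg e zero_le_power[of eps' "n div 2"] by linarith
  then have "\<bar>nm (cz - q)\<bar> * eps \<le> 1 * 25" using kap_bounds eps_bounds by (intro mult_mono) auto
  then have "\<bar>(cz - q) * cj (cz - q)\<bar> * eps \<le> 5 * 5" by (simp add: nm_def)
  from balance[OF _ this]
  have bal: "(\<exists>K. \<bar>eps' ^ K * (cz - q)\<bar> \<le> 5 \<and> \<bar>eps ^ K * cj (cz - q)\<bar> \<le> 5) \<or>
      (\<exists>K. \<bar>eps ^ K * (cz - q)\<bar> \<le> 5 \<and> \<bar>eps' ^ K * cj (cz - q)\<bar> \<le> 5)" by simp
  have "\<exists>w\<in>corb. \<exists>K. F c w = F c (cz - q) \<and> \<bar>eps' ^ K * w\<bar> \<le> 5 \<and> \<bar>eps ^ K * cj w\<bar> \<le> 5"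
    using bal
  proof (elim disjE exE conjE)
    fix K assume "\<bar>eps' ^ K * (cz - q)\<bar> \<le> 5" "\<bar>eps ^ K * cj (cz - q)\<bar> \<le> 5"
    then show ?thesis using o by blast
  next
    fix K assume K: "\<bar>eps ^ K * (cz - q)\<bar> \<le> 5" "\<bar>eps' ^ K * cj (cz - q)\<bar> \<le> 5"
    show ?thesis
    proof (cases K)
      case 0
      then show ?thesis using K o by (intro bexI[OF _ o] exI[of _ 0]) simp
    next
      case (Suc i)
      define w where "w = eps' * cj (cz - q)"
      have "w \<in> corb" unfolding w_def by (rule corb_cj[OF o])
      moreover have "F c w = F c (cz - q)"
        unfolding w_def using F_eps(2)[OF c0(1) cj_KK[OF cz_diff_KK[OF q]], of 1] F_cj[OF cz_diff_KK[OF q]] by simp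
      moreover have "eps' ^ i * w = eps' ^ K * cj (cz - q)" unfolding w_def Suc by simp
      moreover have "cj w = eps * (cz - q)"
        unfolding w_def using cc by (simp add: cj_mult KK_eps cj_KK cz_diff_KK q cj_eps)
      then have "eps ^ i * cj w = eps ^ K * (cz - q)" unfolding Suc by simp
      ultimately show ?thesis using K by (intro bexI[of _ w] exI[of _ i]) simp_all
    qed
  qed
  then obtain w K where w: "w \<in> corb" "F c w = F c (cz - q)" "\<bar>eps' ^ K * w\<bar> \<le> 5" "\<bar>eps ^ K * cj w\<bar> \<le> 5" by blast
  obtain w' J where w': "w' \<in> corb" "2 * J < n" "F c w' = F c w" "\<bar>eps' ^ J * w'\<bar> \<le> 5" "\<bar>eps ^ J * cj w'\<bar> \<le> 5"
    using corb_balanced[OF w(1,3,4) c0(1)] by blast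
  obtain p where p: "p \<in> ZK" "F c (cz - p) = F c w'" "\<bar>eps' ^ J * (cz - p)\<bar> \<le> 5" "\<bar>eps ^ J * cj (cz - p)\<bar> \<le> 5"
    using w'(1)
  proof (cases rule: corb_E)
    case (1 p)
    then show ?thesis using that[of p] w' by simp
  next
    case (2 p)
    have KK: "cz - p \<in> KK" by (rule cz_diff_KK[OF 2(1)])
    have "F c (cz - p) = F c w'" unfolding 2(2) F_minus[OF c0(1) KK] ..
    moreover have "\<bar>eps' ^ J * (cz - p)\<bar> \<le> 5" using w'(4) unfolding 2(2) mult_minus_right abs_minus_cancel .
    moreover have "\<bar>eps ^ J * cj (cz - p)\<bar> \<le> 5" using w'(5) unfolding 2(2) cj_minus[OF KK] mult_minus_right abs_minus_cancel .
    ultimately show ?thesis using that[of p] 2(1) by blast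
  qed
  have "kap - 55 * eps' ^ (n div 2) \<le> F c (cz - p)"
  proof (cases "p = 2")
    case True
    have "0 \<le> eps' ^ (n div 2)" using e by simp
    then show ?thesis using F_cz_2[OF c small k] True by simp
  next
    case False
    show ?thesis using balanced_norm_ge[OF p(1) small w'(2) p(3,4) False] F_cz_ge_norm[OF c0(2) p(1)] by linarith
  qed
  then show False using neg p(2) w'(3) w(2) by simp
qed

end

theorem F_critical_lower:
  assumes "c \<ge> 25" "\<delta> > 0"
  shows "\<exists>z\<in>KK. z - s \<notin> ZK \<and> z + s \<notin> ZK \<and> (\<forall>q\<in>ZK. kap - \<delta> \<le> F c (z - q))"
proof -
  have e: "0 < eps'" "eps' < 1" using eps'_bounds by linarith+
  define \<mu> where "\<mu> = min (1 / 1100) (\<delta> / 55)"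
  have "0 < \<mu>" using assms(2) by (simp add: \<mu>_def)
  then obtain m where m: "eps' ^ m < \<mu>" using real_arch_pow_inv[OF _ e(2)] by blast
  obtain n where nn: "n \<ge> 2 * m + 1" "23 ^ 5 dvd eE n" "23 ^ Suc 5 dvd eD n"
    using critical_exponents by blast
  interpret heteroclinic n by unfold_locales (use nn(1) in simp)
  have "2 * m div 2 \<le> n div 2" using nn(1) by (intro div_le_mono) simp
  then have "m \<le> n div 2" by simp
  then have "eps' ^ (n div 2) \<le> eps' ^ m" using e by (intro power_decreasing) auto
  then have *: "eps' ^ (n div 2) \<le> 1 / 1100" "eps' ^ (n div 2) \<le> \<delta> / 55" using m unfolding \<mu>_def by linarith+
  have "kap - \<delta> \<le> F c (cz - q)" if "q \<in> ZK" for q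
    using F_cz_ge[OF assms(1) _ nn(2) _ that] nn(3) * by simp
  then show ?thesis using cz_KK cz_not_critical by blast
qed

section \<open>The ring of integers\<close>

text \<open>
  Evaluation of an integral polynomial at a real number.
\<close>

definition evi :: "real \<Rightarrow> int poly \<Rightarrow> real" where "evi x p = poly (map_poly of_int p) x"

lemma evi_add: "evi x (p + q) = evi x p + evi x q"
proof -
  have "map_poly of_int (p + q) = (map_poly of_int p + map_poly of_int q :: real poly)"
    by (simp add: poly_eq_iff coeff_map_poly)
  then show ?thesis by (simp add: evi_def)
qed

lemma evi_smult: "evi x (smult a p) = of_int a * evi x p"
  by (simp add: evi_def map_poly_smult)

lemma evi_pCons: "evi x (pCons a p) = of_int a + x * evi x p"
  by (simp add: evi_def map_poly_pCons)

lemma evi_0 [simp]: "evi x 0 = 0" by (simp add: evi_def)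

lemma evi_mult: "evi x (p * q) = evi x p * evi x q"
proof (induction p)
  case (pCons a p)
  have "evi x (pCons a p * q) = evi x (smult a q) + evi x (pCons 0 (p * q))" by (simp add: evi_add)
  then show ?case using pCons by (simp add: evi_smult evi_pCons distrib_right)
qed simp

text \<open>
  Gauss's lemma: the primitive integral quadratic polynomial of a quadratic irrationality divides, up to a constant
  factor, every integral polynomial which vanishes there; if one of these is monic, so is the quadratic one, up to sign.
\<close>

lemma primitive_quadratic_monic:
  assumes x: "algebraic_int x" and irr: "\<And>r0 r1::int. of_int r0 + of_int r1 * x = 0 \<Longrightarrow> r0 = 0 \<and> r1 = 0"
    and M: "evi x M = 0" "degree M = 2" "content M = 1"
  shows "\<bar>lead_coeff M\<bar> = 1"
proof -
  obtain p :: "int poly" where p: "evi x p = 0" "lead_coeff p = 1"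
    using x unfolding algebraic_int_altdef_ipoly evi_def by blast
  have M0: "M \<noteq> 0" using M(2) by auto
  obtain a q where aq: "a \<noteq> 0" "smult a p = M * q + pseudo_mod p M"
    using pseudo_mod(1)[OF M0, of p] by blast
  define r where "r = pseudo_mod p M"
  have dr: "degree r \<le> 1" using pseudo_mod(2)[OF M0, of p] M(2) unfolding r_def by auto
  have r: "r = [:coeff r 0, coeff r 1:]"
  proof (rule poly_eqI)
    fix n :: nat
    consider "n = 0" | "n = 1" | "n \<ge> 2" by linarith
    then show "coeff r n = coeff [:coeff r 0, coeff r 1:] n"
    proof cases
      case 3
      then show ?thesis using dr by (simp add: coeff_eq_0 numeral_2_eq_2)
    qed auto
  qed
  have "evi x (smult a p) = evi x (M * q + r)" using aq(2) unfolding r_def by simp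
  then have "evi x r = 0" using p(1) M(1) by (simp add: evi_smult evi_add evi_mult)
  then have "of_int (coeff r 0) + of_int (coeff r 1) * x = 0"
    by (subst (asm) r) (simp add: evi_pCons mult.commute)
  then have "coeff r 0 = 0 \<and> coeff r 1 = 0" by (rule irr)
  then have "r = 0" using r by simp
  then have eq: "smult a p = M * q" using aq(2) unfolding r_def by simp
  have cp: "content p = 1"
  proof -
    have "content p dvd lead_coeff p" by (rule content_dvd_coeff)
    then have "is_unit (content p)" using p(2) by simp
    then have "normalize (content p) = 1" by (rule is_unit_normalize)
    then show ?thesis by (rule trans[OF normalize_content[symmetric]])
  qed
  have "content (smult a p) = content M * content q" unfolding eq by (rule content_mult)
  then have cq: "content q = \<bar>a\<bar>" using cp M(3) by simp
  have "a dvd coeff q (degree q)"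
  proof -
    have "content q dvd coeff q (degree q)" by (rule content_dvd_coeff)
    then show ?thesis unfolding cq by simp
  qed
  then obtain t where t: "lead_coeff q = a * t" by (elim dvdE)
  have "a * lead_coeff p = lead_coeff M * lead_coeff q"
    using arg_cong[OF eq, of lead_coeff] by (simp only: lead_coeff_smult lead_coeff_mult)
  then have "a * 1 = a * (lead_coeff M * t)" using p(2) t by (simp add: mult_ac)
  then have "lead_coeff M * t = 1" using aq(1) by simp
  then show ?thesis by (metis dvd_triv_left zdvd1_eq)
qed

lemma square_dvd_69:
  fixes d w :: int
  assumes "d > 0" "d * d dvd 69 * (w * w)"
  shows "d dvd w"
proof -
  define g where "g = gcd d w"
  have g0: "g > 0" using assms(1) by (simp add: g_def)
  have "g dvd d" "g dvd w" by (simp_all add: g_def)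
  then obtain d' w' where d': "d = g * d'" and w': "w = g * w'" by (elim dvdE)
  have "gcd d' w' = 1"
  proof -
    have "gcd (g * d') (g * w') = g" unfolding d'[symmetric] w'[symmetric] by (simp add: g_def)
    then have "g * gcd d' w' = g * 1" using gcd_mult_distrib_int[of g d' w'] g0 by simp
    then show ?thesis using g0 by (simp only: mult_cancel_left) simp
  qed
  then have cop: "coprime d' w'" by (simp add: coprime_iff_gcd_eq_1)
  have "g * g * (d' * d') dvd g * g * (69 * (w' * w'))" using assms(2) unfolding d' w' by (simp add: mult_ac)
  then have dd: "d' * d' dvd 69 * (w' * w')" using g0 by simp
  have "coprime (d' * d') (w' * w')" using cop by simp
  then have "d' * d' dvd 69" using dd coprime_dvd_mult_left_iff by blast
  moreover have d'0: "d' > 0" using assms(1) d' g0 by (simp add: zero_less_mult_iff)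
  ultimately have "d' * d' \<le> 69" by (simp add: zdvd_imp_le)
  have "d' \<le> 8"
  proof (rule ccontr)
    assume "\<not> d' \<le> 8"
    then have "9 * 9 \<le> d' * d'" by (intro mult_mono) auto
    then show False using \<open>d' * d' \<le> 69\<close> by simp
  qed
  then have "d' = 1 \<or> d' = 2 \<or> d' = 3 \<or> d' = 4 \<or> d' = 5 \<or> d' = 6 \<or> d' = 7 \<or> d' = 8" using d'0 by linarith
  then have "d' = 1" using \<open>d' * d' dvd 69\<close> by auto
  then show ?thesis using d' w' by simp
qed

text \<open>
  With \<open>x = (m + n rt) / d\<close>, the polynomial \<open>(d t - m)\<^sup>2 - 69 n\<^sup>2\<close> is \<open>d\<^sup>2\<close> times a primitive one by Gauss's lemma. So
  \<open>d\<close> divides \<open>2 m\<close> and \<open>2 n\<close>, as 69 is squarefree; the constant coefficient gives the parity condition.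
\<close>

lemma algebraic_int_ZK:
  assumes "x \<in> KK" "algebraic_int x"
  shows "x \<in> ZK"
proof -
  obtain A B where AB: "A \<in> \<rat>" "B \<in> \<rat>" "x = A + B * rt" using assms(1) by (rule KK_E)
  show ?thesis
  proof (cases "B = 0")
    case True
    then have "x \<in> \<int>" using rational_algebraic_int_is_int[OF assms(2)] AB by simp
    then show ?thesis by (elim Ints_cases) (simp add: ZK_int)
  next
    case False
    obtain m n d :: int where d: "d > 0" "A = of_int m / of_int d" "B = of_int n / of_int d"
      using common_denominator_23[OF AB(1,2)] by blast
    have n0: "n \<noteq> 0" using False d by auto
    have irr: "r0 = 0 \<and> r1 = 0" if "of_int r0 + of_int r1 * x = 0" for r0 r1 :: int
    proof -
      have "(of_int r0 + of_int r1 * A) + (of_int r1 * B) * rt = 0" using that by (simp add: AB(3) algebra_simps)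
      then have "of_int r0 + of_int r1 * A = 0 \<and> of_int r1 * B = 0" by (intro rt_irrational) (use AB in auto)
      then show ?thesis using False by auto
    qed
    define P where "P = [:m * m - 69 * (n * n), - 2 * m * d, d * d:]"
    define M where "M = primitive_part P"
    define k where "k = content P"
    have P: "P = smult k M" by (simp add: M_def k_def)
    have P0: "P \<noteq> 0" using d(1) by (simp add: P_def)
    have k0: "k \<noteq> 0" using P0 by (simp add: k_def)
    have dx: "of_int d * x = of_int m + of_int n * rt" using d by (simp add: AB(3) distrib_left)
    have "evi x P = (of_int d * x - of_int m) * (of_int d * x - of_int m) - 69 * (of_int n * of_int n)"
      by (simp add: P_def evi_pCons algebra_simps)
    also have "\<dots> = 0" unfolding dx by (simp add: algebra_simps)
    finally have M1: "evi x M = 0" using k0 unfolding P by (simp add: evi_smult)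
    have M2: "degree M = 2" using d(1) unfolding M_def by (simp add: P_def)
    have M3: "content M = 1" using P0 unfolding M_def by simp
    have lM: "\<bar>lead_coeff M\<bar> = 1"
      by (rule primitive_quadratic_monic[OF assms(2) _ M1 M2 M3]) (rule irr)
    have "lead_coeff P = d * d" using d(1) by (simp add: P_def)
    moreover have "lead_coeff P = k * lead_coeff M" unfolding P by simp
    ultimately have "d * d = k * lead_coeff M" by simp
    then have "\<bar>d * d\<bar> = \<bar>k\<bar>" using lM by (simp only: abs_mult mult_1_right)
    then have "\<bar>k\<bar> = d * d" by simp
    then have "d * d dvd \<bar>k\<bar>" by simp
    then have dk: "d * d dvd k" by simp
    have kP: "k dvd coeff P i" for i unfolding k_def by (rule content_dvd_coeff)
    have "d * d dvd coeff P 1" using dk kP dvd_trans by blast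
    then have "d * d dvd (2 * m) * d" by (simp add: P_def)
    then have "d dvd 2 * m" using d(1) by simp
    then obtain k1 where k1: "2 * m = d * k1" by (elim dvdE)
    have "d * d dvd coeff P 0" using dk kP dvd_trans by blast
    then obtain k2 where k2: "m * m - 69 * (n * n) = d * d * k2" by (auto simp: P_def elim: dvdE)
    have e1: "69 * ((2 * n) * (2 * n)) = (2 * m) * (2 * m) - 4 * (m * m - 69 * (n * n))" by simp
    also have "\<dots> = d * d * (k1 * k1 - 4 * k2)" unfolding k1 k2 by (simp add: algebra_simps)
    finally have e2: "69 * ((2 * n) * (2 * n)) = d * d * (k1 * k1 - 4 * k2)" .
    then have "d * d dvd 69 * ((2 * n) * (2 * n))" by simp
    then have "d dvd 2 * n" by (rule square_dvd_69[OF d(1)])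
    then obtain k3 where k3: "2 * n = d * k3" by (elim dvdE)
    have "d * d * (69 * (k3 * k3)) = d * d * (k1 * k1 - 4 * k2)" using e2 unfolding k3 by (simp add: mult_ac)
    then have e3: "69 * (k3 * k3) = k1 * k1 - 4 * k2" using d(1) by simp
    have "even (k1 * k1 - 69 * (k3 * k3))" using e3 by simp
    then have ev: "even (k1 + k3)" by auto
    have "of_int d * (2 * A) = of_int d * (of_int k1 :: real)" using d k1 by (simp flip: of_int_mult)
    then have A: "A = of_int k1 / 2" using d(1) by simp
    have "of_int d * (2 * B) = of_int d * (of_int k3 :: real)" using d k3 by (simp flip: of_int_mult)
    then have B: "B = of_int k3 / 2" using d(1) by simp
    have "x = (of_int k1 + of_int k3 * rt) / 2" unfolding AB(3) A B by (simp add: add_divide_distrib)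
    then show ?thesis using ZK_I[OF ev] by (simp only:)
  qed
qed

lemma ZK_algebraic_int:
  assumes "x \<in> ZK"
  shows "algebraic_int x"
proof -
  obtain a b where ab: "even (a + b)" "x = (of_int a + of_int b * rt) / 2" using assms by (rule ZK_E)
  obtain n :: int where n: "nm x = of_int n" using assms by (rule nm_ZK)
  have cjx: "cj x = of_int a - x" unfolding ab(2) cj_ZK_eq by (simp add: field_simps)
  have "x * (of_int a - x) = of_int n" using n by (simp add: nm_def cjx)
  then have "poly [:of_int n, - of_int a, 1:] x = 0" by (simp add: algebra_simps)
  moreover have "\<forall>i. coeff [:of_int n, - of_int a, 1 :: real:] i \<in> \<int>"
    by (auto simp: coeff_pCons split: nat.split)
  ultimately show ?thesis by (intro algebraic_int.intros[of "[:of_int n, - of_int a, 1:]"]) auto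
qed

lemma ring_of_integers_KK: "ring_of_integers KK = ZK"
  unfolding ring_of_integers_def using algebraic_int_ZK ZK_algebraic_int ZK_KK by blast

abbreviation RR :: "real ring" where "RR \<equiv> int_ring KK"

lemma RR_simps [simp]:
  "carrier RR = ZK" "x \<otimes>\<^bsub>RR\<^esub> y = x * y" "x \<oplus>\<^bsub>RR\<^esub> y = x + y" "\<one>\<^bsub>RR\<^esub> = 1" "\<zero>\<^bsub>RR\<^esub> = 0"
  by (simp_all add: int_ring_def ring_of_type_algebra_def ring_of_integers_KK)

lemma cring_RR: "cring RR"
proof (rule cringI)
  show "abelian_group RR"
  proof (rule abelian_groupI)
    show "\<exists>y\<in>carrier RR. y \<oplus>\<^bsub>RR\<^esub> x = \<zero>\<^bsub>RR\<^esub>" if "x \<in> carrier RR" for x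
      using ZK_minus[of x] that by (intro bexI[of _ "- x"]) simp_all
  qed (simp_all add: ZK_add)
  show "Group.comm_monoid RR"
    by (rule Group.comm_monoidI) (simp_all add: ZK_mult)
qed (simp add: distrib_right)

interpretation RR: cring RR by (rule cring_RR)

definition prin :: "real \<Rightarrow> real set" where "prin a = (*) a ` ZK"

lemma prin_I: "x \<in> ZK \<Longrightarrow> a * x \<in> prin a"
  unfolding prin_def by (rule imageI)

lemma prin_iff: "y \<in> prin a \<longleftrightarrow> (\<exists>x\<in>ZK. y = a * x)"
  by (auto simp: prin_def)

lemma idealD:
  assumes "ideal I RR"
  shows "I \<subseteq> ZK" "0 \<in> I" "\<And>x y. x \<in> I \<Longrightarrow> y \<in> I \<Longrightarrow> x + y \<in> I" "\<And>x. x \<in> I \<Longrightarrow> - x \<in> I"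
    "\<And>x y. x \<in> I \<Longrightarrow> y \<in> ZK \<Longrightarrow> y * x \<in> I"
proof -
  interpret ideal I RR by fact
  show 1: "I \<subseteq> ZK" using a_subset by simp
  show "0 \<in> I" using zero_closed by simp
  show "x + y \<in> I" if "x \<in> I" "y \<in> I" for x y using a_closed[OF that] by simp
  show 5: "y * x \<in> I" if "x \<in> I" "y \<in> ZK" for x y using I_l_closed[OF that(1), of y] that(2) by simp
  show "- x \<in> I" if "x \<in> I" for x using 5[OF that ZK_int[of "- 1"]] by simp
qed

lemma idealI_RR:
  assumes "I \<subseteq> ZK" "0 \<in> I" "\<And>x y. x \<in> I \<Longrightarrow> y \<in> I \<Longrightarrow> x + y \<in> I" "\<And>x y. x \<in> I \<Longrightarrow> y \<in> ZK \<Longrightarrow> y * x \<in> I"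
  shows "ideal I RR"
proof (rule idealI)
  show "ring RR" by (rule RR.ring_axioms)
  have m: "- x \<in> I" if "x \<in> I" for x using assms(4)[OF that ZK_int[of "- 1"]] by simp
  have ainv: "\<ominus>\<^bsub>RR\<^esub> x = - x" if "x \<in> ZK" for x
    using RR.minus_equality[of "- x" x] that ZK_minus[of x] by simp
  show "subgroup I (add_monoid RR)"
  proof (rule subgroup.intro)
    show "I \<subseteq> carrier (add_monoid RR)" using assms(1) by simp
    show "\<And>x y. x \<in> I \<Longrightarrow> y \<in> I \<Longrightarrow> x \<otimes>\<^bsub>add_monoid RR\<^esub> y \<in> I" using assms(3) by simp
    show "\<one>\<^bsub>add_monoid RR\<^esub> \<in> I" using assms(2) by simp
    show "inv\<^bsub>add_monoid RR\<^esub> x \<in> I" if "x \<in> I" for x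
      using m[OF that] ainv[of x] that assms(1) unfolding a_inv_def by auto
  qed
  show "x \<otimes>\<^bsub>RR\<^esub> a \<in> I" "a \<otimes>\<^bsub>RR\<^esub> x \<in> I" if "a \<in> I" "x \<in> carrier RR" for a x
    using assms(4)[OF that(1), of x] that(2) by (simp_all add: mult.commute[of a x])
qed

lemma prin_ideal: assumes "a \<in> ZK" shows "ideal (prin a) RR"
proof (rule idealI_RR)
  show "prin a \<subseteq> ZK" using assms by (auto simp: prin_iff ZK_mult)
  show "0 \<in> prin a" unfolding prin_iff by (rule bexI[of _ 0]) simp_all
  show "x + y \<in> prin a" if xy: "x \<in> prin a" "y \<in> prin a" for x y
  proof -
    obtain x' y' where "x' \<in> ZK" "x = a * x'" "y' \<in> ZK" "y = a * y'" using xy unfolding prin_iff by blast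
    then show ?thesis unfolding prin_iff by (intro bexI[of _ "x' + y'"]) (simp_all add: ZK_add distrib_left)
  qed
  show "y * x \<in> prin a" if xy: "x \<in> prin a" "y \<in> ZK" for x y
  proof -
    obtain x' where "x' \<in> ZK" "x = a * x'" using xy unfolding prin_iff by blast
    then show ?thesis unfolding prin_iff using xy(2) by (intro bexI[of _ "y * x'"]) (simp_all add: ZK_mult mult_ac)
  qed
qed

section \<open>The Euclidean property and principal ideals\<close>

text \<open>
  Off the two critical classes the upper bound \<open>kap < 1\<close> applies, and at the critical points the minimum is \<open>25 / c\<close>.
\<close>

lemma F_euclidean:
  assumes "c > 25" "z \<in> KK"
  shows "\<exists>q\<in>ZK. F c (z - q) < 1"
proof -
  have c: "c > 0" "c \<ge> 23" using assms(1) by linarith+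
  have less: "25 / c < 1" using assms(1) by simp
  consider "z - s \<in> ZK" | "z + s \<in> ZK" | "z - s \<notin> ZK" "z + s \<notin> ZK" by blast
  then show ?thesis
  proof cases
    case 1
    then have "z - s + 1 \<in> ZK" by (intro ZK_add) simp_all
    moreover have "z - (z - s + 1) = s - 1" by simp
    ultimately show ?thesis using F_critical_1[OF c(1)] less by (intro bexI[of _ "z - s + 1"]) simp_all
  next
    case 2
    then have "z + s - 1 \<in> ZK" by (intro ZK_diff) simp_all
    moreover have "z - (z + s - 1) = - (s - 1)" by simp
    moreover have "F c (- (s - 1)) = 25 / c"
      using F_critical_1[OF c(1)] F_minus[OF c(1) KK_diff[OF s_KK ZK_KK[OF ZK_1]]] by simp
    ultimately show ?thesis using less by (intro bexI[of _ "z + s - 1"]) (simp_all only:)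
  next
    case 3
    then obtain q where "q \<in> ZK" "F c (z - q) < kap" using norm_covering[OF assms(2) c(2)] by blast
    then show ?thesis using kap_bounds by (intro bexI[of _ q]) auto
  qed
qed

text \<open>
  For \<open>c > 1\<close> a bound for \<open>c ^ v * \<bar>m\<bar>\<close> bounds both the exponent \<open>v\<close> and \<open>m\<close>.
\<close>

lemma finite_small_wz:
  assumes "c > 1"
  shows "finite {n. wz c n \<le> y}"
proof -
  obtain V where V: "y < c ^ V" using real_arch_pow[OF assms] by blast
  define B where "B = \<lceil>23 ^ V * \<bar>y\<bar>\<rceil>"
  have "n \<in> {- B..B}" if n: "wz c n \<le> y" for n
  proof (cases "n = 0")
    case True
    have "0 \<le> 23 ^ V * \<bar>y\<bar>" by simp
    then have "0 \<le> real_of_int B" unfolding B_def using le_of_int_ceiling order_trans by blast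
    then have "0 \<le> B" by linarith
    then show ?thesis using True by simp
  next
    case False
    define v where "v = multiplicity 23 n"
    have "23 ^ v dvd n" unfolding v_def by (rule multiplicity_dvd)
    then obtain m where m: "n = 23 ^ v * m" by (elim dvdE)
    have w: "wz c n = \<bar>of_int m\<bar> * c ^ v"
      unfolding wz_def v_def[symmetric] by (subst m) (simp add: abs_mult power_divide)
    have "m \<noteq> 0" using m False by auto
    then have m1: "1 \<le> \<bar>of_int m :: real\<bar>" by linarith
    have c1: "1 \<le> c ^ v" using assms by simp
    have "1 * c ^ v \<le> \<bar>of_int m\<bar> * c ^ v" using m1 assms by (intro mult_right_mono) auto
    then have "c ^ v \<le> y" using n w by linarith
    then have "c ^ v < c ^ V" using V by linarith
    then have vV: "v \<le> V" using assms power_strict_increasing_iff[of c v V] by simp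
    have "\<bar>of_int m\<bar> * 1 \<le> \<bar>of_int m\<bar> * c ^ v" using c1 by (intro mult_left_mono) auto
    then have my: "\<bar>of_int m\<bar> \<le> \<bar>y\<bar>" using n w by linarith
    have "(23::real) ^ v * \<bar>of_int m\<bar> \<le> 23 ^ V * \<bar>y\<bar>"
      using vV my by (intro mult_mono power_increasing) auto
    moreover have "\<bar>of_int n :: real\<bar> = 23 ^ v * \<bar>of_int m\<bar>" by (subst m) (simp add: abs_mult)
    ultimately have "\<bar>of_int n :: real\<bar> \<le> 23 ^ V * \<bar>y\<bar>" by simp
    then have "\<bar>of_int n :: real\<bar> \<le> of_int B" unfolding B_def by linarith
    then have "\<bar>n\<bar> \<le> B" by linarith
    then show ?thesis by auto
  qed
  then have "{n. wz c n \<le> y} \<subseteq> {- B..B}" by blast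
  then show ?thesis by (rule finite_subset) simp
qed

lemma F_ZK: assumes "c > 0" "x \<in> ZK" obtains n :: int where "nm x = of_int n" "F c x = wz c n"
proof -
  obtain n :: int where n: "nm x = of_int n" using assms(2) by (rule nm_ZK)
  then have "F c x = wz c n" using W_int[OF assms(1)] by (simp add: F_def)
  with n show ?thesis by (rule that)
qed

lemma finite_F_values:
  assumes "c > 1"
  shows "finite (F c ` ZK \<inter> {0..y})"
proof -
  have "F c ` ZK \<inter> {0..y} \<subseteq> wz c ` {n. wz c n \<le> y}"
  proof
    fix w assume "w \<in> F c ` ZK \<inter> {0..y}"
    then obtain x where x: "x \<in> ZK" "w = F c x" "w \<le> y" by auto
    have "c > 0" using assms by simp
    then obtain n where "F c x = wz c n" using F_ZK x(1) by metis
    then show "w \<in> wz c ` {n. wz c n \<le> y}" using x by auto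
  qed
  then show ?thesis using finite_small_wz[OF assms] finite_subset by blast
qed

text \<open>
  An element of smallest nonzero weight generates the ideal; a smallest one exists because only finitely many values of
  the weight are below any bound.
\<close>

theorem ideal_principal:
  assumes "ideal I RR" "I \<noteq> {0}"
  shows "\<exists>b\<in>ZK. b \<noteq> 0 \<and> I = prin b"
proof -
  note I = idealD[OF assms(1)]
  obtain x0 where x0: "x0 \<in> I" "x0 \<noteq> 0" using assms(2) I(2) by blast
  \<comment> \<open>any weight in the Euclidean window will do\<close>
  define c where "c = (26::real)"
  have c: "c > 0" "c > 1" "c > 25" by (simp_all add: c_def)
  define V where "V = F c ` {x \<in> I. x \<noteq> 0} \<inter> {0..F c x0}"
  have nn: "0 \<le> F c x" if "x \<in> I" for x using F_nonneg[OF c(1) ZK_KK] I(1) that by blast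
  have "V \<subseteq> F c ` ZK \<inter> {0..F c x0}" unfolding V_def using I(1) by blast
  then have fin: "finite V" using finite_F_values[OF c(2)] finite_subset by blast
  have x0V: "F c x0 \<in> V" unfolding V_def using x0 nn by auto
  then have "Min V \<in> V" using fin Min_in by blast
  then obtain b where b: "b \<in> I" "b \<noteq> 0" "F c b = Min V" unfolding V_def by auto
  have min: "F c b \<le> F c x" if "x \<in> I" "x \<noteq> 0" for x
  proof (cases "F c x \<le> F c x0")
    case True
    then have "F c x \<in> V" unfolding V_def using that nn by auto
    then show ?thesis using fin b(3) by simp
  next
    case False
    then show ?thesis using Min_le[OF fin x0V] b(3) by simp
  qed
  have bZ: "b \<in> ZK" using b(1) I(1) by blast
  have "x \<in> prin b" if x: "x \<in> I" for x
  proof -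
    have xZ: "x \<in> ZK" using x I(1) by blast
    obtain q where q: "q \<in> ZK" "F c (x / b - q) < 1"
      using F_euclidean[OF c(3) KK_divide[OF ZK_KK[OF xZ] ZK_KK[OF bZ]]] by blast
    have "b * (x / b - q) = x - q * b" using b(2) by (simp add: right_diff_distrib mult.commute)
    then have "F c (x - q * b) = F c b * F c (x / b - q)"
      using F_mult[OF c(1) ZK_KK[OF bZ], of "x / b - q"] KK_diff KK_divide ZK_KK xZ bZ q(1) by metis
    also have "\<dots> < F c b * 1"
    proof (rule mult_strict_left_mono[OF q(2)])
      have "F c b \<noteq> 0" using F_eq_0_iff[OF c(1) ZK_KK[OF bZ]] b(2) by simp
      then show "0 < F c b" using nn[OF b(1)] by simp
    qed
    finally have lt: "F c (x - q * b) < F c b" by simp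
    have "x - q * b \<in> I" using I(3)[OF x I(4)[OF I(5)[OF b(1) q(1)]]] by simp
    then have "x - q * b = 0" using min lt by force
    then have "x = b * q" by (simp add: mult.commute)
    then show ?thesis using prin_I[OF q(1)] by simp
  qed
  moreover have "prin b \<subseteq> I"
  proof
    fix y assume "y \<in> prin b"
    then obtain x where "x \<in> ZK" "y = b * x" unfolding prin_iff by blast
    then show "y \<in> I" using I(5)[OF b(1), of x] by (simp only: mult.commute[of b x])
  qed
  ultimately show ?thesis using bZ b(2) by blast
qed

lemma unit_inverse:
  assumes "x \<in> ZK" "\<bar>nm x\<bar> = 1"
  shows "\<exists>y\<in>ZK. x * y = 1"
proof -
  consider "nm x = 1" | "nm x = - 1" using assms(2) by linarith
  then show ?thesis
  proof cases
    case 1 then show ?thesis using ZK_cj[OF assms(1)] by (auto simp: nm_def)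
  next
    case 2 then show ?thesis using ZK_minus[OF ZK_cj[OF assms(1)]] by (intro bexI[of _ "- cj x"]) (auto simp: nm_def)
  qed
qed

lemma inverse_unit:
  assumes "x \<in> ZK" "y \<in> ZK" "x * y = 1"
  shows "\<bar>nm x\<bar> = 1"
proof -
  obtain m :: int where m: "nm x = of_int m" using assms(1) by (rule nm_ZK)
  obtain n :: int where n: "nm y = of_int n" using assms(2) by (rule nm_ZK)
  have "nm (x * y) = 1" unfolding assms(3) by (simp add: nm_def cj_rat)
  then have "of_int (m * n) = (1::real)" using nm_mult[OF ZK_KK[OF assms(1)] ZK_KK[OF assms(2)]] m n by simp
  then have "m * n = 1" by (simp only: of_int_eq_1_iff)
  then have "\<bar>m\<bar> = 1" using zdvd1_eq dvd_triv_left by metis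
  then show ?thesis using m by simp
qed

lemma prin_unit: assumes "u \<in> ZK" "\<bar>nm u\<bar> = 1" shows "prin u = ZK"
proof -
  obtain y where y: "y \<in> ZK" "u * y = 1" using unit_inverse[OF assms] by blast
  have "x \<in> prin u" if "x \<in> ZK" for x
  proof -
    have "u * (y * x) = x" using y(2) by (simp flip: mult.assoc)
    then show ?thesis using prin_I[OF ZK_mult[OF y(1) that], of u] by (simp only:)
  qed
  moreover have "prin u \<subseteq> ZK" using idealD(1)[OF prin_ideal[OF assms(1)]] .
  ultimately show ?thesis by blast
qed

lemma prin_eq_imp:
  assumes "a \<noteq> 0" "prin a = prin b"
  shows "\<exists>u\<in>ZK. \<bar>nm u\<bar> = 1 \<and> b = a * u"
proof -
  have "b \<in> prin a" "a \<in> prin b" using assms(2) prin_I[OF ZK_1, of a] prin_I[OF ZK_1, of b] by simp_all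
  then obtain x y where xy: "x \<in> ZK" "b = a * x" "y \<in> ZK" "a = b * y" unfolding prin_iff by blast
  have "a * 1 = a * (x * y)" using xy(4)[unfolded xy(2)] unfolding mult.assoc mult_1_right .
  then have "x * y = 1" using assms(1) by simp
  then show ?thesis using inverse_unit[OF xy(1,3)] xy(1,2) by blast
qed

lemma prime_idealE:
  assumes "\<qq> \<in> prime_ideals KK"
  obtains \<rho> where "\<rho> \<in> ZK" "\<rho> \<noteq> 0" "\<qq> = prin \<rho>" "1 \<notin> prin \<rho>"
    "\<And>x y. x \<in> ZK \<Longrightarrow> y \<in> ZK \<Longrightarrow> x * y \<in> prin \<rho> \<Longrightarrow> x \<in> prin \<rho> \<or> y \<in> prin \<rho>"
proof -
  have q: "primeideal \<qq> RR" "\<qq> \<noteq> {0}" using assms unfolding prime_ideals_def by auto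
  interpret primeideal \<qq> RR by (rule q(1))
  obtain \<rho> where r: "\<rho> \<in> ZK" "\<rho> \<noteq> 0" "\<qq> = prin \<rho>" using ideal_principal[OF is_ideal q(2)] by blast
  have "1 \<notin> \<qq>"
  proof
    assume 1: "1 \<in> \<qq>"
    have "ZK \<subseteq> \<qq>" using idealD(5)[OF is_ideal 1] by auto
    then have "\<qq> = carrier RR" using a_subset by auto
    then show False using I_notcarr by simp
  qed
  then show ?thesis using that[OF r] I_prime unfolding r(3) by simp
qed

text \<open>
  A generator of the prime ideal above 23, of norm \<open>- 23\<close>.
\<close>

definition ppi :: real where "ppi = (of_int 23 + of_int 3 * rt) / 2"

lemma ppi_ZK: "ppi \<in> ZK" unfolding ppi_def by (rule ZK_I) simp

lemma nm_ppi: "nm ppi = of_int (- 23)" unfolding ppi_def nm_ZK_eq by simp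

lemma Idl_eq_prin_ppi: "Idl\<^bsub>RR\<^esub> {23, rt} = prin ppi"
proof
  have sub: "{23, rt} \<subseteq> carrier RR" by (simp add: ZK_rt)
  show "Idl\<^bsub>RR\<^esub> {23, rt} \<subseteq> prin ppi"
  proof (rule RR.genideal_minimal[OF prin_ideal[OF ppi_ZK]])
    have "23 = ppi * (- cj ppi)" using nm_ppi by (simp add: nm_def)
    moreover have "- cj ppi \<in> ZK" by (intro ZK_minus ZK_cj ppi_ZK)
    ultimately have 1: "23 \<in> prin ppi" unfolding prin_iff by blast
    have "(of_int 9 + of_int (- 1) * rt) / 2 \<in> ZK" by (rule ZK_I) simp
    moreover have "rt = ppi * ((of_int 9 + of_int (- 1) * rt) / 2)" unfolding ppi_def by (simp only: times_divide_times_eq quad_mult) simp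
    ultimately have "rt \<in> prin ppi" unfolding prin_iff by blast
    with 1 show "{23, rt} \<subseteq> prin ppi" by simp
  qed
  have id: "ideal (Idl\<^bsub>RR\<^esub> {23, rt}) RR" by (rule RR.genideal_ideal[OF sub])
  have mem: "23 \<in> Idl\<^bsub>RR\<^esub> {23, rt}" "rt \<in> Idl\<^bsub>RR\<^esub> {23, rt}" using RR.genideal_self[OF sub] by blast+
  note I = idealD[OF id]
  have w: "(of_int 1 + of_int 1 * rt) / 2 \<in> ZK" by (rule ZK_I) simp
  have e: "ppi = (of_int 1 + of_int 1 * rt) / 2 * 23 + (- 10) * rt" unfolding ppi_def by (simp add: add_divide_distrib)
  have m: "(- 10) * rt \<in> Idl\<^bsub>RR\<^esub> {23, rt}" using I(5)[OF mem(2) ZK_int[of "- 10"]] by simp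
  have ppi: "ppi \<in> Idl\<^bsub>RR\<^esub> {23, rt}" unfolding e by (rule I(3)[OF I(5)[OF mem(1) w] m])
  show "prin ppi \<subseteq> Idl\<^bsub>RR\<^esub> {23, rt}"
  proof
    fix y assume "y \<in> prin ppi"
    then obtain x where "x \<in> ZK" "y = ppi * x" unfolding prin_iff by blast
    then show "y \<in> Idl\<^bsub>RR\<^esub> {23, rt}" using I(5)[OF ppi, of x] by (simp only: mult.commute[of ppi x])
  qed
qed

lemma nm_dvd_23_imp:
  assumes "x \<in> ZK" "nm x = of_int n" "23 dvd n"
  shows "x \<in> prin ppi"
proof -
  obtain a b where ab: "even (a + b)" "x = (of_int a + of_int b * rt) / 2" using assms(1) by (rule ZK_E)
  have "(of_int (a * a - 69 * (b * b)) :: real) = of_int (4 * n)"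
    using assms(2) unfolding ab(2) nm_ZK_eq by simp
  then have "a * a - 69 * (b * b) = 4 * n" by (simp only: of_int_eq_iff)
  then have "a * a = 4 * n + 23 * (3 * (b * b))" by simp
  moreover have "23 dvd 4 * n + 23 * (3 * (b * b))" using assms(3) by (intro dvd_add dvd_mult dvd_triv_left)
  ultimately have "23 dvd a * a" by (simp only:)
  then have "23 dvd a" using prime_dvd_mult_iff[OF prime_23] by blast
  then obtain k where k: "a = 23 * k" by (elim dvdE)
  have "even (b - k)" using ab(1) k by simp
  then obtain j where j: "b - k = 2 * j" by (elim evenE)
  have b: "b = k + 2 * j" using j by simp
  have "x = ppi * ((of_int (9 * j - 7 * k) + of_int (k - j) * rt) / 2)"
    unfolding ab(2) k b ppi_def by (simp only: times_divide_times_eq quad_mult) (simp add: algebra_simps add_divide_distrib)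
  moreover have "even ((9 * j - 7 * k) + (k - j))" by simp
  ultimately show ?thesis using prin_I[OF ZK_I] by metis
qed

section \<open>Absolute norms\<close>

text \<open>
  A set of representatives of the residue classes modulo the principal ideal of \<open>a\<close>.
\<close>

definition residue_system :: "real set \<Rightarrow> real \<Rightarrow> bool" where
  "residue_system T a \<longleftrightarrow> T \<subseteq> ZK \<and> (\<forall>x\<in>ZK. \<exists>t\<in>T. x - t \<in> prin a) \<and>
     (\<forall>t\<in>T. \<forall>t'\<in>T. t - t' \<in> prin a \<longrightarrow> t = t')"

lemma prin_0 [simp]: "0 \<in> prin a"
  unfolding prin_iff by (rule bexI[of _ 0]) simp_all

lemma prin_add: "x \<in> prin a \<Longrightarrow> y \<in> prin a \<Longrightarrow> x + y \<in> prin a"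
  unfolding prin_iff by (metis ZK_add distrib_left)

lemma prin_minus: "x \<in> prin a \<Longrightarrow> - x \<in> prin a"
  unfolding prin_iff by (metis ZK_minus mult_minus_right)

lemma prin_diff: "x \<in> prin a \<Longrightarrow> y \<in> prin a \<Longrightarrow> x - y \<in> prin a"
  using prin_add[of x a "- y"] prin_minus[of y a] by simp

lemma prin_mult: "x \<in> prin a \<Longrightarrow> y \<in> ZK \<Longrightarrow> x * y \<in> prin a"
  unfolding prin_iff by (metis ZK_mult mult.assoc)

lemma abs_norm_residue_system:
  assumes "residue_system T a"
  shows "abs_norm KK (prin a) = card T"
proof -
  define co where "co x = (\<lambda>h. h + x) ` prin a" for x
  have coset: "prin a +>\<^bsub>RR\<^esub> x = co x" for x
    unfolding a_r_coset_def' co_def RR_simps by (rule UNION_singleton_eq_range)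
  have car: "carrier (RR Quot prin a) = co ` ZK"
    unfolding FactRing_def A_RCOSETS_def' coset RR_simps partial_object.simps by (rule UNION_singleton_eq_range)
  have sub: "co x \<subseteq> co y" if "x - y \<in> prin a" for x y
  proof
    fix w assume "w \<in> co x"
    then obtain h where h: "h \<in> prin a" "w = h + x" unfolding co_def by blast
    have "w = (h + (x - y)) + y" using h(2) by simp
    then show "w \<in> co y" unfolding co_def using prin_add[OF h(1) that] by (rule image_eqI)
  qed
  have co_eq: "co x = co y" if "x - y \<in> prin a" for x y
    using sub[OF that] sub[of y x] prin_minus[OF that] by simp
  have co_eqD: "x - y \<in> prin a" if "co x = co y" for x y
  proof -
    have "0 + x \<in> co x" unfolding co_def by (rule imageI) simp
    then have "x \<in> co y" using that by simp
    then obtain h where "h \<in> prin a" "x = h + y" unfolding co_def by blast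
    then show ?thesis by simp
  qed
  have T: "T \<subseteq> ZK" "\<forall>x\<in>ZK. \<exists>t\<in>T. x - t \<in> prin a" "\<forall>t\<in>T. \<forall>t'\<in>T. t - t' \<in> prin a \<longrightarrow> t = t'"
    using assms unfolding residue_system_def by blast+
  have "co ` ZK = co ` T"
  proof
    show "co ` T \<subseteq> co ` ZK" using T(1) by (rule image_mono)
    show "co ` ZK \<subseteq> co ` T"
    proof
      fix w assume "w \<in> co ` ZK"
      then obtain x where x: "x \<in> ZK" "w = co x" by blast
      obtain t where "t \<in> T" "x - t \<in> prin a" using T(2) x(1) by blast
      then show "w \<in> co ` T" using co_eq[of x t] x(2) by simp
    qed
  qed
  moreover have "inj_on co T"
  proof (rule inj_onI)
    fix x y assume "x \<in> T" "y \<in> T" "co x = co y"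
    then show "x = y" using T(3) co_eqD[of x y] by simp
  qed
  ultimately show ?thesis unfolding abs_norm_def car by (simp add: card_image)
qed

lemma residue_system_exists: "\<exists>T. residue_system T a"
proof -
  define r where "r x = (SOME t. t \<in> ZK \<and> x - t \<in> prin a)" for x
  have r: "r x \<in> ZK \<and> x - r x \<in> prin a" if "x \<in> ZK" for x
    unfolding r_def by (rule someI[of _ x]) (simp add: that)
  have r_eq: "r x = r y" if "x - y \<in> prin a" for x y
  proof -
    have "x - t \<in> prin a \<longleftrightarrow> y - t \<in> prin a" for t
    proof
      show "y - t \<in> prin a" if t: "x - t \<in> prin a" using prin_diff[OF t \<open>x - y \<in> prin a\<close>] by simp
      show "x - t \<in> prin a" if t: "y - t \<in> prin a" using prin_add[OF t \<open>x - y \<in> prin a\<close>] by simp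
    qed
    then show ?thesis unfolding r_def by simp
  qed
  have "r x = r y" if "x \<in> ZK" "y \<in> ZK" "r x - r y \<in> prin a" for x y
  proof -
    have "(x - r x) + (r x - r y) - (y - r y) \<in> prin a" 
      using prin_diff[OF prin_add[OF conjunct2[OF r[OF that(1)]] that(3)] conjunct2[OF r[OF that(2)]]] .
    then have "x - y \<in> prin a" by simp
    then show ?thesis by (rule r_eq)
  qed
  moreover have "r ` ZK \<subseteq> ZK" using r by blast
  moreover have "\<exists>t\<in>r ` ZK. x - t \<in> prin a" if "x \<in> ZK" for x
    by (rule bexI[of _ "r x"]) (use r[OF that] that in simp_all)
  ultimately have "residue_system (r ` ZK) a" unfolding residue_system_def by (simp add: Ball_def image_iff) metis
  then show ?thesis ..
qed

lemma residue_system_mult: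
  assumes "a \<in> ZK" "a \<noteq> 0" "b \<in> ZK" "residue_system T a" "residue_system S b"
  shows "\<exists>U. residue_system U (a * b) \<and> card U = card T * card S"
proof -
  have T: "T \<subseteq> ZK" "\<forall>x\<in>ZK. \<exists>t\<in>T. x - t \<in> prin a" "\<forall>t\<in>T. \<forall>t'\<in>T. t - t' \<in> prin a \<longrightarrow> t = t'"
    using assms(4) unfolding residue_system_def by blast+
  have S: "S \<subseteq> ZK" "\<forall>x\<in>ZK. \<exists>t\<in>S. x - t \<in> prin b" "\<forall>t\<in>S. \<forall>t'\<in>S. t - t' \<in> prin b \<longrightarrow> t = t'"
    using assms(5) unfolding residue_system_def by blast+
  have eq: "t = t' \<and> s' = s''"
    if st: "t \<in> T" "t' \<in> T" "s' \<in> S" "s'' \<in> S" and m: "(t + a * s') - (t' + a * s'') \<in> prin (a * b)" for t t' s' s''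
  proof -
    obtain z where z: "z \<in> ZK" "(t + a * s') - (t' + a * s'') = a * b * z" using m unfolding prin_iff by blast
    have m: "a * (s' - s'') \<in> prin a" using st S(1) by (intro prin_I ZK_diff) blast+
    have bZ: "a * (b * z) = (t - t') + a * (s' - s'')" using z(2) by (simp add: algebra_simps)
    have h: "a * (b * z) \<in> prin a" using assms(3) z(1) by (intro prin_I ZK_mult)
    have "(t - t') + a * (s' - s'') - a * (s' - s'') \<in> prin a" by (rule prin_diff[OF h[unfolded bZ] m])
    then have tt: "t = t'" using T(3) st by simp
    have "a * (s' - s'') = a * (b * z)" unfolding bZ tt by simp
    then have "s' - s'' = b * z" using assms(2) by simp
    then have "s' - s'' \<in> prin b" using prin_I[OF z(1)] by simp
    then show ?thesis using tt S(3) st by blast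
  qed
  define f where "f = (\<lambda>(t, s'). t + a * s')"
  have "inj_on f (T \<times> S)" using eq unfolding f_def by (intro inj_onI) auto
  then have "card (f ` (T \<times> S)) = card T * card S" by (simp add: card_image card_cartesian_product)
  moreover have "residue_system (f ` (T \<times> S)) (a * b)" unfolding residue_system_def
  proof (intro conjI ballI impI)
    show "f ` (T \<times> S) \<subseteq> ZK" unfolding f_def using T(1) S(1) assms(1) by (auto intro!: ZK_add ZK_mult)
    show "\<exists>u\<in>f ` (T \<times> S). x - u \<in> prin (a * b)" if x: "x \<in> ZK" for x
    proof -
      obtain t where t: "t \<in> T" "x - t \<in> prin a" using T(2) x by blast
      obtain y where y: "y \<in> ZK" "x - t = a * y" using t(2) unfolding prin_iff by blast
      obtain s' where s': "s' \<in> S" "y - s' \<in> prin b" using S(2) y by blast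
      obtain z where z: "z \<in> ZK" "y - s' = b * z" using s'(2) unfolding prin_iff by blast
      have "x - (t + a * s') = a * (y - s')" using y(2) by (simp add: right_diff_distrib)
      then have "x - (t + a * s') = a * b * z" unfolding z(2) by (simp only: mult.assoc)
      then have "x - f (t, s') \<in> prin (a * b)" using prin_I[OF z(1), of "a * b"] by (simp add: f_def)
      then show ?thesis using t(1) s'(1) by blast
    qed
    fix u u' assume "u \<in> f ` (T \<times> S)" "u' \<in> f ` (T \<times> S)" "u - u' \<in> prin (a * b)"
    then obtain t s' t' s'' where "t \<in> T" "s' \<in> S" "t' \<in> T" "s'' \<in> S" "u = t + a * s'" "u' = t' + a * s''"
      "(t + a * s') - (t' + a * s'') \<in> prin (a * b)" unfolding f_def by auto
    with eq[of t t' s' s''] show "u = u'" by simp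
  qed
  ultimately show ?thesis by blast
qed

lemma residue_system_int:
  fixes N :: int assumes "N > 0"
  shows "\<exists>T. residue_system T (of_int N) \<and> card T = nat N * nat N"
proof -
  define om :: real where "om = (of_int 1 + of_int 1 * rt) / 2"
  define g where "g = (\<lambda>(i::int, j::int). of_int i + of_int j * om)"
  have om: "om \<in> ZK" unfolding om_def by (rule ZK_I) simp
  have gZ: "g p \<in> ZK" for p unfolding g_def by (cases p) (auto intro!: ZK_add ZK_mult ZK_int om)
  have ex: "\<exists>i j. x = g (i, j)" if x: "x \<in> ZK" for x
  proof -
    obtain a b where ab: "even (a + b)" "x = (of_int a + of_int b * rt) / 2" using x by (rule ZK_E)
    have "even (a - b)" using ab(1) by simp
    then obtain k where k: "a - b = 2 * k" by (elim evenE)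
    have a: "a = b + 2 * k" using k by simp
    have "x = g (k, b)" unfolding ab(2) a g_def om_def by (simp add: add_divide_distrib algebra_simps)
    then show ?thesis by blast
  qed
  have inj: "i = 0 \<and> j = 0" if "g (i, j) = 0" for i j
  proof -
    have "(of_int i + of_int j / 2) + (of_int j / 2) * rt = 0"
      using that unfolding g_def om_def by (simp add: add_divide_distrib algebra_simps)
    then have "of_int i + of_int j / 2 = (0::real) \<and> of_int j / 2 = (0::real)"
      by (intro rt_irrational) auto
    then show ?thesis by simp
  qed
  have lin: "g (i, j) - g (k, l) = g (i - k, j - l)" "of_int N * g (i, j) = g (N * i, N * j)" for i j k l
    unfolding g_def by (simp_all add: algebra_simps)
  have eq: "i = k \<and> j = l"
    if ijkl: "g (i, j) - g (k, l) \<in> prin (of_int N)" "i \<in> {0..<N}" "j \<in> {0..<N}" "k \<in> {0..<N}" "l \<in> {0..<N}" for i j k l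
  proof -
    obtain z where z: "z \<in> ZK" "g (i, j) - g (k, l) = of_int N * z" using ijkl(1) unfolding prin_iff by blast
    obtain m n where mn: "z = g (m, n)" using ex[OF z(1)] by blast
    have e: "g (i - k, j - l) = g (N * m, N * n)" using z(2) unfolding mn lin .
    have "g (i - k - N * m, j - l - N * n) = 0"
      unfolding lin(1)[of "i - k" "j - l" "N * m" "N * n", symmetric] e by simp
    then have "i - k - N * m = 0 \<and> j - l - N * n = 0" by (rule inj)
    then have "i = k + N * m" "j = l + N * n" by simp_all
    then have "i mod N = k mod N" "j mod N = l mod N" by simp_all
    then show ?thesis using ijkl by simp
  qed
  let ?R = "{0..<N} \<times> {0..<N}"
  have "inj_on g ?R"
  proof (rule inj_onI)
    fix p q assume pq: "p \<in> ?R" "q \<in> ?R" "g p = g q"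
    then show "p = q" using eq[of "fst p" "snd p" "fst q" "snd q"] by (cases p; cases q) simp
  qed
  then have "card (g ` ?R) = nat N * nat N" by (simp add: card_image card_cartesian_product)
  moreover have "residue_system (g ` ?R) (of_int N)" unfolding residue_system_def
  proof (intro conjI ballI impI)
    show "g ` ?R \<subseteq> ZK" using gZ by blast
    show "\<exists>t\<in>g ` ?R. x - t \<in> prin (of_int N)" if x: "x \<in> ZK" for x
    proof -
      obtain i j where ij: "x = g (i, j)" using ex[OF x] by blast
      have e: "x - g (i mod N, j mod N) = of_int N * g (i div N, j div N)"
        unfolding ij lin by (simp add: minus_mod_eq_mult_div)
      have "x - g (i mod N, j mod N) \<in> prin (of_int N)" unfolding e by (rule prin_I[OF gZ])
      moreover have "(i mod N, j mod N) \<in> ?R" using assms by simp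
      ultimately show ?thesis by blast
    qed
    fix t t' assume "t \<in> g ` ?R" "t' \<in> g ` ?R" "t - t' \<in> prin (of_int N)"
    then obtain i j k l where "t = g (i, j)" "t' = g (k, l)" "g (i, j) - g (k, l) \<in> prin (of_int N)"
      "i \<in> {0..<N}" "j \<in> {0..<N}" "k \<in> {0..<N}" "l \<in> {0..<N}" by auto
    with eq[of i j k l] show "t = t'" by simp
  qed
  ultimately show ?thesis by blast
qed

lemma residue_system_cj:
  assumes "a \<in> ZK" "residue_system T a"
  shows "residue_system (cj ` T) (cj a)" "card (cj ` T) = card T"
proof -
  have T: "T \<subseteq> ZK" "\<forall>x\<in>ZK. \<exists>t\<in>T. x - t \<in> prin a" "\<forall>t\<in>T. \<forall>t'\<in>T. t - t' \<in> prin a \<longrightarrow> t = t'"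
    using assms(2) unfolding residue_system_def by blast+
  have cc: "cj (cj x) = x" if "x \<in> ZK" for x using cj_cj[OF ZK_KK[OF that]] .
  have cj_prin: "cj x \<in> prin (cj b)" if "x \<in> prin b" "b \<in> ZK" for x b
  proof -
    obtain y where "y \<in> ZK" "x = b * y" using \<open>x \<in> prin b\<close> unfolding prin_iff by blast
    then show ?thesis using cj_mult[OF ZK_KK[OF \<open>b \<in> ZK\<close>] ZK_KK, of y] prin_I[OF ZK_cj, of y] by simp
  qed
  have cd: "cj (x - y) = cj x - cj y" if "x \<in> ZK" "y \<in> ZK" for x y using cj_diff ZK_KK that by blast
  show "card (cj ` T) = card T"
    by (rule card_image, rule inj_onI) (metis T(1) cc subsetD)
  show "residue_system (cj ` T) (cj a)" unfolding residue_system_def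
  proof (intro conjI ballI impI)
    show "cj ` T \<subseteq> ZK" using T(1) ZK_cj by blast
    show "\<exists>t\<in>cj ` T. x - t \<in> prin (cj a)" if x: "x \<in> ZK" for x
    proof -
      obtain t where t: "t \<in> T" "cj x - t \<in> prin a" using T(2) ZK_cj[OF x] by blast
      have "cj (cj x - t) \<in> prin (cj a)" by (rule cj_prin[OF t(2) assms(1)])
      then have "x - cj t \<in> prin (cj a)" using cd[OF ZK_cj[OF x], of t] T(1) t(1) cc[OF x] by auto
      then show ?thesis using t(1) by blast
    qed
    fix t t' assume "t \<in> cj ` T" "t' \<in> cj ` T" and d: "t - t' \<in> prin (cj a)"
    then obtain u u' where u: "u \<in> T" "u' \<in> T" "t = cj u" "t' = cj u'" by blast
    then have uZ: "u \<in> ZK" "u' \<in> ZK" using T(1) by blast+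
    have "cj (t - t') \<in> prin (cj (cj a))" by (rule cj_prin[OF d ZK_cj[OF assms(1)]])
    then have "u - u' \<in> prin a" unfolding u cd[OF ZK_cj[OF uZ(1)] ZK_cj[OF uZ(2)]] cc[OF uZ(1)] cc[OF uZ(2)] cc[OF assms(1)] .
    then show "t = t'" using T(3) u by blast
  qed
qed

text \<open>
  The absolute norm is multiplicative on principal ideals, invariant under conjugation, and equal to \<open>N\<^sup>2\<close> for a rational
  integer \<open>N\<close>. As \<open>a * cj a\<close> is the rational integer \<open>nm a\<close>, the square of the absolute norm is \<open>(nm a)\<^sup>2\<close>.
\<close>

theorem abs_norm_prin:
  assumes "a \<in> ZK" "a \<noteq> 0"
  shows "real (abs_norm KK (prin a)) = \<bar>nm a\<bar>"
proof -
  obtain n :: int where n: "nm a = of_int n" using assms(1) by (rule nm_ZK)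
  have n0: "n \<noteq> 0" using nm_eq_0_iff[OF ZK_KK[OF assms(1)]] assms(2) n by auto
  obtain T where T: "residue_system T a" using residue_system_exists by blast
  obtain U where U: "residue_system U (a * cj a)" "card U = card T * card (cj ` T)"
    using residue_system_mult[OF assms ZK_cj[OF assms(1)] T residue_system_cj(1)[OF assms(1) T]] by blast
  obtain V where V: "residue_system V (of_int \<bar>n\<bar>)" "card V = nat \<bar>n\<bar> * nat \<bar>n\<bar>"
    using residue_system_int[of "\<bar>n\<bar>"] n0 by auto
  have sgn: "prin (- x) = prin x" for x
    unfolding prin_def by (force simp: image_iff intro: ZK_minus bexI[of _ "- y" for y])
  have "prin (a * cj a) = prin (of_int \<bar>n\<bar>)" using n sgn[of "of_int n"] unfolding nm_def[symmetric] by (cases "n \<ge> 0") simp_all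
  then have "card U = card V" using abs_norm_residue_system[OF U(1)] abs_norm_residue_system[OF V(1)] by simp
  then have "card T * card T = nat \<bar>n\<bar> * nat \<bar>n\<bar>" using U(2) V(2) residue_system_cj(2)[OF assms(1) T] by simp
  then have "card T = nat \<bar>n\<bar>" by (metis power2_eq_square power2_eq_imp_eq zero_le)
  then show ?thesis using abs_norm_residue_system[OF T] n by simp
qed

section \<open>Prime ideals and the weighted norm\<close>

text \<open>
  A prime element whose norm is divisible by 23 is divisible by \<open>ppi\<close>, hence associated to it.
\<close>

lemma weight_of_prime:
  assumes "c > 0" "prin \<rho> \<in> prime_ideals KK" "\<rho> \<in> ZK" "\<rho> \<noteq> 0"
  shows "F c \<rho> = (if prin \<rho> = prin ppi then c else real (abs_norm KK (prin \<rho>)))"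
proof (cases "prin \<rho> = prin ppi")
  case True
  have "ppi \<noteq> 0" using nm_ppi by (auto simp: nm_def)
  then obtain u where u: "u \<in> ZK" "\<bar>nm u\<bar> = 1" "\<rho> = ppi * u" using prin_eq_imp[OF _ True[symmetric]] by blast
  have "F c ppi = c" unfolding F_def nm_ppi W_int[OF assms(1)] using wz_23[OF assms(1)] by simp
  then have "F c \<rho> = c" unfolding u(3) using F_mult[OF assms(1) ZK_KK[OF ppi_ZK] ZK_KK[OF u(1)]] F_unit[OF assms(1) u(2)] by simp
  then show ?thesis using True by simp
next
  case False
  have P: "x \<in> prin \<rho> \<or> y \<in> prin \<rho>" if "x \<in> ZK" "y \<in> ZK" "x * y \<in> prin \<rho>" for x y
    using assms(2) that unfolding prime_ideals_def by (auto dest: primeideal.I_prime)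
  obtain n where n: "nm \<rho> = of_int n" "F c \<rho> = wz c n" using F_ZK[OF assms(1,3)] by blast
  have "\<not> 23 dvd n"
  proof
    assume "23 dvd n"
    then have in_ppi: "\<rho> \<in> prin ppi" using nm_dvd_23_imp[OF assms(3) n(1)] by blast
    then obtain y where y: "y \<in> ZK" "\<rho> = ppi * y" unfolding prin_iff by blast
    have "\<rho> * 1 \<in> prin \<rho>" by (rule prin_I) simp
    then have "ppi * y \<in> prin \<rho>" using y(2) by simp
    then consider "ppi \<in> prin \<rho>" | "y \<in> prin \<rho>" using P[OF ppi_ZK y(1)] by blast
    then show False
    proof cases
      case 1
      have "prin \<rho> \<subseteq> prin ppi" using prin_mult[OF in_ppi] unfolding prin_iff[of _ \<rho>] subset_iff by blast
      moreover have "prin ppi \<subseteq> prin \<rho>" using prin_mult[OF 1] unfolding prin_iff[of _ ppi] subset_iff by blast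
      ultimately show False using False by blast
    next
      case 2
      then obtain z where z: "z \<in> ZK" "y = \<rho> * z" unfolding prin_iff by blast
      have "\<rho> = \<rho> * (ppi * z)" using y(2) z(2) by (metis mult.left_commute)
      then have "ppi * z = 1" using assms(4) by simp
      then have "\<bar>nm ppi\<bar> = 1" using inverse_unit[OF ppi_ZK z(1)] by blast
      then show False unfolding nm_ppi by simp
    qed
  qed
  then have "F c \<rho> = \<bar>of_int n\<bar>" using n(2) wz_not_dvd by simp
  then show ?thesis using False abs_norm_prin[OF assms(3,4)] n(1) by simp
qed

lemma nm_less:
  assumes "x \<in> ZK" "y \<in> ZK" "y \<noteq> 0" "x \<noteq> 0" "\<bar>nm x\<bar> \<noteq> 1"
  shows "nat \<lfloor>\<bar>nm y\<bar>\<rfloor> < nat \<lfloor>\<bar>nm (x * y)\<bar>\<rfloor>"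
proof -
  obtain m :: int where m: "nm x = of_int m" using assms(1) by (rule nm_ZK)
  obtain n :: int where n: "nm y = of_int n" using assms(2) by (rule nm_ZK)
  have "n \<noteq> 0" using nm_eq_0_iff[OF ZK_KK[OF assms(2)]] assms(3) n by auto
  have "m \<noteq> 0" using nm_eq_0_iff[OF ZK_KK[OF assms(1)]] assms(4) m by auto
  then have "\<bar>m\<bar> > 1" using assms(5) m by (simp flip: of_int_abs)
  then have "1 * \<bar>n\<bar> < \<bar>m\<bar> * \<bar>n\<bar>" using \<open>n \<noteq> 0\<close> by (intro mult_strict_right_mono) auto
  then have "\<bar>n\<bar> < \<bar>m * n\<bar>" by (simp add: abs_mult)
  moreover have "nm (x * y) = of_int (m * n)" using nm_mult[OF ZK_KK[OF assms(1)] ZK_KK[OF assms(2)]] m n by simp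
  ultimately show ?thesis using n by (simp only: of_int_abs[symmetric] floor_of_int)
qed

text \<open>
  A non-unit divisor of smallest norm is prime, because the ideal that it generates together with an element outside its
  own ideal is principal; its generator is a proper divisor, hence a unit.
\<close>

lemma prime_divisor:
  assumes "\<alpha> \<in> ZK" "\<alpha> \<noteq> 0" "\<bar>nm \<alpha>\<bar> \<noteq> 1"
  shows "\<exists>\<rho>\<in>ZK. \<exists>\<beta>\<in>ZK. \<alpha> = \<rho> * \<beta> \<and> prin \<rho> \<in> prime_ideals KK \<and> \<bar>nm \<rho>\<bar> \<noteq> 1"
proof -
  define S where "S \<rho> \<longleftrightarrow> \<rho> \<in> ZK \<and> (\<exists>\<beta>\<in>ZK. \<alpha> = \<rho> * \<beta>) \<and> \<bar>nm \<rho>\<bar> \<noteq> 1" for \<rho>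
  have "S \<alpha>" unfolding S_def using assms(1,3) by (auto intro!: bexI[of _ 1])
  then obtain \<rho> where r: "S \<rho>" and min: "\<And>y. S y \<Longrightarrow> nat \<lfloor>\<bar>nm \<rho>\<bar>\<rfloor> \<le> nat \<lfloor>\<bar>nm y\<bar>\<rfloor>"
    using ex_has_least_nat[of S \<alpha> "\<lambda>x. nat \<lfloor>\<bar>nm x\<bar>\<rfloor>"] by blast
  obtain \<beta> where b: "\<rho> \<in> ZK" "\<beta> \<in> ZK" "\<alpha> = \<rho> * \<beta>" "\<bar>nm \<rho>\<bar> \<noteq> 1" using r unfolding S_def by blast
  have r0: "\<rho> \<noteq> 0" using assms(2) b(3) by auto
  have P: "y \<in> prin \<rho>" if xy: "x \<in> ZK" "y \<in> ZK" "x * y \<in> prin \<rho>" "x \<notin> prin \<rho>" for x y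
  proof -
    define J where "J = {x * u + \<rho> * v | u v. u \<in> ZK \<and> v \<in> ZK}"
    have JI: "x * u + \<rho> * v \<in> J" if "u \<in> ZK" "v \<in> ZK" for u v unfolding J_def using that by blast
    have "ideal J RR"
    proof (rule idealI_RR)
      show "J \<subseteq> ZK" unfolding J_def using xy(1) b(1) by (auto intro!: ZK_add ZK_mult)
      show "0 \<in> J" using JI[of 0 0] by simp
      show "z + w \<in> J" if zw: "z \<in> J" "w \<in> J" for z w
      proof -
        obtain u v u' v' where *: "u \<in> ZK" "v \<in> ZK" "z = x * u + \<rho> * v" "u' \<in> ZK" "v' \<in> ZK" "w = x * u' + \<rho> * v'"
          using zw unfolding J_def by blast
        have "z + w = x * (u + u') + \<rho> * (v + v')" unfolding * by (simp add: distrib_left)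
        then show ?thesis using JI[OF ZK_add[OF *(1,4)] ZK_add[OF *(2,5)]] by simp
      qed
      show "w * z \<in> J" if zw: "z \<in> J" "w \<in> ZK" for z w
      proof -
        obtain u v where *: "u \<in> ZK" "v \<in> ZK" "z = x * u + \<rho> * v" using zw unfolding J_def by blast
        have "w * z = x * (w * u) + \<rho> * (w * v)" unfolding * by (simp add: algebra_simps)
        then show ?thesis using JI[OF ZK_mult[OF zw(2) *(1)] ZK_mult[OF zw(2) *(2)]] by simp
      qed
    qed
    moreover have rJ: "\<rho> \<in> J" and xJ: "x \<in> J" using JI[of 0 1] JI[of 1 0] by simp_all
    moreover have "J \<noteq> {0}" using rJ r0 by blast
    ultimately obtain d where d: "d \<in> ZK" "d \<noteq> 0" "J = prin d" using ideal_principal by blast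
    obtain e where e: "e \<in> ZK" "\<rho> = d * e" using rJ unfolding d(3) prin_iff by blast
    obtain f where f: "f \<in> ZK" "x = d * f" using xJ unfolding d(3) prin_iff by blast
    have e0: "e \<noteq> 0" using e(2) r0 by auto
    have "\<bar>nm d\<bar> = 1"
    proof (rule ccontr)
      assume nd: "\<bar>nm d\<bar> \<noteq> 1"
      have "\<alpha> = d * (e * \<beta>)" using b(3) e(2) by simp
      then have "S d" unfolding S_def using d(1) nd ZK_mult[OF e(1) b(2)] by blast
      then have le: "nat \<lfloor>\<bar>nm \<rho>\<bar>\<rfloor> \<le> nat \<lfloor>\<bar>nm d\<bar>\<rfloor>" by (rule min)
      have "\<bar>nm e\<bar> = 1"
      proof (rule ccontr)
        assume "\<bar>nm e\<bar> \<noteq> 1"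
        then have "nat \<lfloor>\<bar>nm d\<bar>\<rfloor> < nat \<lfloor>\<bar>nm (e * d)\<bar>\<rfloor>" by (intro nm_less) (use e d e0 in auto)
        then show False using le unfolding e(2) mult.commute[of e d] by (metis not_le)
      qed
      then obtain e' where e': "e' \<in> ZK" "e * e' = 1" using unit_inverse[OF e(1)] by blast
      have "\<rho> * (e' * f) = d * (e * e') * f" unfolding e(2) by (simp only: mult.assoc)
      then have "\<rho> * (e' * f) = x" using e'(2) f(2) by simp
      then show False using xy(4) prin_I[OF ZK_mult[OF e'(1) f(1)], of \<rho>] by simp
    qed
    then have "J = ZK" using prin_unit[OF d(1)] d(3) by simp
    then have "1 \<in> J" by simp
    then obtain u v where uv: "u \<in> ZK" "v \<in> ZK" "1 = x * u + \<rho> * v" unfolding J_def by blast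
    have "y = y * (x * u + \<rho> * v)" using uv(3) by simp
    also have "\<dots> = x * y * u + \<rho> * (v * y)" by (simp add: algebra_simps)
    finally have "y = x * y * u + \<rho> * (v * y)" .
    moreover have "x * y * u + \<rho> * (v * y) \<in> prin \<rho>"
      using prin_add[OF prin_mult[OF xy(3) uv(1)] prin_I[OF ZK_mult[OF uv(2) xy(2)]]] .
    ultimately show ?thesis by (simp only:)
  qed
  have "primeideal (prin \<rho>) RR"
  proof (rule primeidealI)
    show "ideal (prin \<rho>) RR" by (rule prin_ideal[OF b(1)])
    show "cring RR" by (rule cring_RR)
    show "carrier RR \<noteq> prin \<rho>"
    proof
      assume "carrier RR = prin \<rho>"
      then have "1 \<in> prin \<rho>" using ZK_1 by (simp only: RR_simps)
      then obtain y where "y \<in> ZK" "1 = \<rho> * y" unfolding prin_iff by blast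
      then show False using inverse_unit[OF b(1), of y] b(4) by simp
    qed
    show "x \<in> prin \<rho> \<or> y \<in> prin \<rho>" if "x \<in> carrier RR" "y \<in> carrier RR" "x \<otimes>\<^bsub>RR\<^esub> y \<in> prin \<rho>" for x y
      using P[of x y] that by auto
  qed
  moreover have "prin \<rho> \<noteq> {0}" using prin_I[OF ZK_1, of \<rho>] r0 by auto
  ultimately have "prin \<rho> \<in> prime_ideals KK" unfolding prime_ideals_def by simp
  then show ?thesis using b by blast
qed

lemma KK_fraction:
  assumes "x \<in> KK"
  shows "\<exists>b\<in>ZK. \<exists>d\<in>ZK. d \<noteq> 0 \<and> x = b / d"
proof -
  obtain A B where AB: "A \<in> \<rat>" "B \<in> \<rat>" "x = A + B * rt" using assms by (rule KK_E)
  obtain m n d :: int where d: "d > 0" "A = of_int m / of_int d" "B = of_int n / of_int d"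
    using common_denominator_23[OF AB(1,2)] by blast
  have "x = (of_int m + of_int n * rt) / of_int d" unfolding AB(3) d by (simp add: add_divide_distrib)
  moreover have "of_int m + of_int n * rt \<in> ZK" by (intro ZK_add ZK_mult ZK_int ZK_rt)
  moreover have "real_of_int d \<noteq> 0" using d(1) by simp
  ultimately show ?thesis using ZK_int[of d] by blast
qed

lemma fractional_ideals_KK: "fractional_ideals KK = {prin a | a. a \<in> KK \<and> a \<noteq> 0}"
proof -
  have div: "(\<lambda>x. x / d) ` prin b = prin (b / d)" for b d
    unfolding prin_def image_image by (rule image_cong) simp_all
  have "I \<in> fractional_ideals KK \<longleftrightarrow> (\<exists>a. I = prin a \<and> a \<in> KK \<and> a \<noteq> 0)" for I
  proof
    assume "I \<in> fractional_ideals KK"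
    then obtain J d where J: "ideal J RR" "J \<noteq> {0}" "d \<in> ZK" "d \<noteq> 0" "I = (\<lambda>x. x / d) ` J"
      unfolding fractional_ideals_def ring_of_integers_KK by blast
    obtain b where b: "b \<in> ZK" "b \<noteq> 0" "J = prin b" using ideal_principal[OF J(1,2)] by blast
    have "I = prin (b / d)" unfolding J(5) b(3) by (rule div)
    moreover have "b / d \<in> KK" "b / d \<noteq> 0" using b J KK_divide ZK_KK by auto
    ultimately show "\<exists>a. I = prin a \<and> a \<in> KK \<and> a \<noteq> 0" by blast
  next
    assume "\<exists>a. I = prin a \<and> a \<in> KK \<and> a \<noteq> 0"
    then obtain a where a: "I = prin a" "a \<in> KK" "a \<noteq> 0" by blast
    obtain b d where bd: "b \<in> ZK" "d \<in> ZK" "d \<noteq> 0" "a = b / d" using KK_fraction[OF a(2)] by blast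
    have "I = (\<lambda>x. x / d) ` prin b" unfolding a(1) bd(4) by (rule div[symmetric])
    moreover have "prin b \<noteq> {0}" using prin_I[OF ZK_1, of b] bd(4) a(3) by auto
    ultimately show "I \<in> fractional_ideals KK"
      unfolding fractional_ideals_def ring_of_integers_KK using prin_ideal[OF bd(1)] bd(2,3) by blast
  qed
  then show ?thesis by blast
qed

lemma ideal_prod_prin: "ideal_prod RR (prin a) (prin b) = prin (a * b)"
proof
  show "ideal_prod RR (prin a) (prin b) \<subseteq> prin (a * b)"
  proof
    fix x assume "x \<in> ideal_prod RR (prin a) (prin b)"
    then show "x \<in> prin (a * b)"
    proof induction
      case (prod i j)
      then obtain u v where uv: "u \<in> ZK" "v \<in> ZK" "i = a * u" "j = b * v" unfolding prin_iff by blast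
      have "i * j = a * b * (u * v)" unfolding uv by simp
      then show ?case using prin_I[OF ZK_mult[OF uv(1,2)], of "a * b"] by simp
    next
      case (sum s1 s2)
      then show ?case by (simp add: prin_add)
    qed
  qed
  show "prin (a * b) \<subseteq> ideal_prod RR (prin a) (prin b)"
  proof
    fix x assume "x \<in> prin (a * b)"
    then obtain u where u: "u \<in> ZK" "x = a * b * u" unfolding prin_iff by blast
    have "(a * 1) \<otimes>\<^bsub>RR\<^esub> (b * u) \<in> ideal_prod RR (prin a) (prin b)"
      using prin_I[OF ZK_1] prin_I[OF u(1)] by (rule ideal_prod.prod)
    then show "x \<in> ideal_prod RR (prin a) (prin b)" using u(2) by (simp add: mult.assoc)
  qed
qed

lemma weight_extension_exists:
  assumes "c > 0"
  shows "\<exists>\<phi>. weight_extension KK (prin ppi) c \<phi>"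
proof -
  define \<phi> where "\<phi> I = F c (SOME a. a \<in> KK \<and> a \<noteq> 0 \<and> I = prin a)" for I
  have phi: "\<phi> (prin a) = F c a" if a: "a \<in> KK" "a \<noteq> 0" for a
  proof -
    define b where "b = (SOME b. b \<in> KK \<and> b \<noteq> 0 \<and> prin a = prin b)"
    have "b \<in> KK \<and> b \<noteq> 0 \<and> prin a = prin b" unfolding b_def by (rule someI[of _ a]) (simp add: a)
    then obtain u where u: "u \<in> ZK" "\<bar>nm u\<bar> = 1" "b = a * u" using prin_eq_imp[OF a(2)] by blast
    have "F c b = F c a" unfolding u(3) using F_mult[OF assms a(1) ZK_KK[OF u(1)]] F_unit[OF assms u(2)] by simp
    then show ?thesis unfolding \<phi>_def b_def .
  qed
  have pos: "F c a > 0" if "a \<in> KK" "a \<noteq> 0" for a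
    using F_nonneg[OF assms that(1)] F_eq_0_iff[OF assms that(1)] that(2) by simp
  have "\<phi> \<in> hom (fractional_ideal_group KK) pos_real_group"
  proof (rule homI)
    show "\<phi> I \<in> carrier pos_real_group" if "I \<in> carrier (fractional_ideal_group KK)" for I
      using that phi pos by (auto simp: fractional_ideal_group_def pos_real_group_def fractional_ideals_KK)
    show "\<phi> (I \<otimes>\<^bsub>fractional_ideal_group KK\<^esub> J) = \<phi> I \<otimes>\<^bsub>pos_real_group\<^esub> \<phi> J"
      if "I \<in> carrier (fractional_ideal_group KK)" "J \<in> carrier (fractional_ideal_group KK)" for I J
      using that phi KK_mult F_mult[OF assms]
      by (auto simp: fractional_ideal_group_def pos_real_group_def fractional_ideals_KK ideal_prod_prin)
  qed
  moreover have "\<phi> \<qq> = (if \<qq> = prin ppi then c else real (abs_norm KK \<qq>))" if q: "\<qq> \<in> prime_ideals KK" for \<qq>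
  proof -
    obtain \<rho> where r: "\<rho> \<in> ZK" "\<rho> \<noteq> 0" "\<qq> = prin \<rho>" using q by (rule prime_idealE)
    show ?thesis using weight_of_prime[OF assms q[unfolded r(3)] r(1,2)] phi[OF ZK_KK[OF r(1)] r(2)] unfolding r(3) by simp
  qed
  ultimately show ?thesis unfolding weight_extension_def by blast
qed

lemma weight_extension_unique:
  assumes c: "c > 0" and w: "weight_extension KK (prin ppi) c \<phi>" and a: "a \<in> KK" "a \<noteq> 0"
  shows "\<phi> (prin a) = F c a"
proof -
  have hom: "\<phi> \<in> hom (fractional_ideal_group KK) pos_real_group" using w unfolding weight_extension_def by blast
  have prime: "\<phi> \<qq> = (if \<qq> = prin ppi then c else real (abs_norm KK \<qq>))" if "\<qq> \<in> prime_ideals KK" for \<qq>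
    using w that unfolding weight_extension_def by blast
  have car: "prin x \<in> carrier (fractional_ideal_group KK)" if "x \<in> KK" "x \<noteq> 0" for x
    using that by (auto simp: fractional_ideal_group_def fractional_ideals_KK)
  have mult: "\<phi> (prin (x * y)) = \<phi> (prin x) * \<phi> (prin y)" if "x \<in> KK" "x \<noteq> 0" "y \<in> KK" "y \<noteq> 0" for x y
    using hom_mult[OF hom car[OF that(1,2)] car[OF that(3,4)]]
    by (simp add: fractional_ideal_group_def pos_real_group_def ideal_prod_prin)
  have pos: "\<phi> (prin x) > 0" if "x \<in> KK" "x \<noteq> 0" for x
    using hom_in_carrier[OF hom car[OF that]] by (simp add: pos_real_group_def)
  have one: "\<phi> ZK = 1"
  proof -
    have "prin 1 = ZK" unfolding prin_def by simp
    then show ?thesis using mult[of 1 1] pos[of 1] ZK_KK[OF ZK_1] by simp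
  qed
  have int: "\<phi> (prin x) = F c x" if "x \<in> ZK" "x \<noteq> 0" for x
    using that
  proof (induction "nat \<lfloor>\<bar>nm x\<bar>\<rfloor>" arbitrary: x rule: less_induct)
    case less
    show ?case
    proof (cases "\<bar>nm x\<bar> = 1")
      case True
      then show ?thesis using prin_unit[OF less.prems(1) True] one F_unit[OF c True] by simp
    next
      case False
      obtain \<rho> \<beta> where r: "\<rho> \<in> ZK" "\<beta> \<in> ZK" "x = \<rho> * \<beta>" "prin \<rho> \<in> prime_ideals KK" "\<bar>nm \<rho>\<bar> \<noteq> 1"
        using prime_divisor[OF less.prems False] by blast
      have r0: "\<rho> \<noteq> 0" "\<beta> \<noteq> 0" using less.prems(2) r(3) by auto
      have "\<phi> (prin \<beta>) = F c \<beta>"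
        by (rule less.hyps) (use nm_less[OF r(1,2) r0(2,1) r(5)] r r0 in auto)
      moreover have "\<phi> (prin \<rho>) = F c \<rho>" using prime[OF r(4)] weight_of_prime[OF c r(4,1) r0(1)] by simp
      ultimately show ?thesis unfolding r(3)
        using mult[OF ZK_KK[OF r(1)] r0(1) ZK_KK[OF r(2)] r0(2)] F_mult[OF c ZK_KK[OF r(1)] ZK_KK[OF r(2)]] by simp
    qed
  qed
  obtain b d where bd: "b \<in> ZK" "d \<in> ZK" "d \<noteq> 0" "a = b / d" using KK_fraction[OF a(1)] by blast
  have b: "b = a * d" "b \<noteq> 0" using bd a(2) by auto
  have "\<phi> (prin a) * F c d = F c a * F c d"
    using mult[OF a ZK_KK[OF bd(2)] bd(3)] int[OF bd(1) b(2)] int[OF bd(2,3)] F_mult[OF c a(1) ZK_KK[OF bd(2)]] b(1) by simp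
  moreover have "F c d \<noteq> 0" using F_eq_0_iff[OF c ZK_KK[OF bd(2)]] bd(3) by simp
  ultimately show ?thesis by simp
qed

text \<open>
  The extension of the weights exists, as \<open>F c\<close> does not change when a generator is multiplied by a unit. It is unique by
  induction on the norm, splitting off prime divisors.
\<close>

theorem weighted_norm_eq_F:
  assumes "c > 0" "\<alpha> \<in> KK"
  shows "weighted_norm KK (prin ppi) c \<alpha> = F c \<alpha>"
proof (cases "\<alpha> = 0")
  case True
  then show ?thesis using F_eq_0_iff[OF assms] by (simp add: weighted_norm_def)
next
  case False
  have "(THE x. \<exists>\<phi>. weight_extension KK (prin ppi) c \<phi> \<and> x = \<phi> (prin \<alpha>)) = F c \<alpha>"
  proof (rule the_equality)
    show "\<exists>\<phi>. weight_extension KK (prin ppi) c \<phi> \<and> F c \<alpha> = \<phi> (prin \<alpha>)"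
      using weight_extension_exists[OF assms(1)] weight_extension_unique[OF assms(1) _ assms(2) False] by metis
    show "x = F c \<alpha>" if "\<exists>\<phi>. weight_extension KK (prin ppi) c \<phi> \<and> x = \<phi> (prin \<alpha>)" for x
      using that weight_extension_unique[OF assms(1) _ assms(2) False] by blast
  qed
  then show ?thesis using False unfolding weighted_norm_def ring_of_integers_KK prin_def by simp
qed

section \<open>Euclidean minima\<close>

abbreviation wn :: "real \<Rightarrow> real \<Rightarrow> real" where "wn \<equiv> weighted_norm KK (prin ppi)"

lemma euclidean_min_at_F:
  assumes "c > 0" "z \<in> KK"
  shows "euclidean_min_at KK (wn c) z = Inf {\<kappa>. \<exists>q\<in>ZK. F c (z - q) < \<kappa>}"
proof -
  have "wn c (z - q) = F c (z - q)" if "q \<in> ZK" for q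
    by (rule weighted_norm_eq_F[OF assms(1) KK_diff[OF assms(2) ZK_KK[OF that]]])
  then have "{\<kappa>. \<exists>q\<in>ZK. wn c (z - q) < \<kappa>} = {\<kappa>. \<exists>q\<in>ZK. F c (z - q) < \<kappa>}" by simp
  then show ?thesis unfolding euclidean_min_at_def ring_of_integers_KK by simp
qed

lemma euclidean_min_at_le:
  assumes "c > 0" "z \<in> KK" "q \<in> ZK"
  shows "euclidean_min_at KK (wn c) z \<le> F c (z - q)"
proof (rule dense_ge)
  fix \<kappa> assume k: "F c (z - q) < \<kappa>"
  have "bdd_below {\<kappa>. \<exists>q\<in>ZK. F c (z - q) < \<kappa>}"
  proof (rule bdd_belowI)
    fix x assume "x \<in> {\<kappa>. \<exists>q\<in>ZK. F c (z - q) < \<kappa>}"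
    then obtain q where "q \<in> ZK" "F c (z - q) < x" by blast
    then show "0 \<le> x" using F_nonneg[OF assms(1) KK_diff[OF assms(2) ZK_KK], of q] by simp
  qed
  then show "euclidean_min_at KK (wn c) z \<le> \<kappa>"
    unfolding euclidean_min_at_F[OF assms(1,2)] using k assms(3) by (intro cInf_lower) blast+
qed

lemma euclidean_min_at_ge:
  assumes "c > 0" "z \<in> KK" "\<And>q. q \<in> ZK \<Longrightarrow> L \<le> F c (z - q)"
  shows "L \<le> euclidean_min_at KK (wn c) z"
  unfolding euclidean_min_at_F[OF assms(1,2)]
proof (rule cInf_greatest)
  have "F c (z - 0) < F c (z - 0) + 1" by simp
  then show "{\<kappa>. \<exists>q\<in>ZK. F c (z - q) < \<kappa>} \<noteq> {}" using ZK_0 by blast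
  fix x assume "x \<in> {\<kappa>. \<exists>q\<in>ZK. F c (z - q) < \<kappa>}"
  then obtain q where "q \<in> ZK" "F c (z - q) < x" by blast
  then show "L \<le> x" using assms(3)[of q] by simp
qed

definition critical :: "real \<Rightarrow> bool" where "critical z \<longleftrightarrow> z - s \<in> ZK \<or> z + s \<in> ZK"

lemma critical_cong: assumes "z - w \<in> ZK" "critical w" shows "critical z"
proof -
  have "z - s = (z - w) + (w - s)" "z + s = (z - w) + (w + s)" by simp_all
  then show ?thesis using assms ZK_add unfolding critical_def by metis
qed

lemma euclidean_min_at_critical:
  assumes "c > 0" "z \<in> KK" "critical z"
  shows "euclidean_min_at KK (wn c) z = 25 / c"
proof (rule antisym)
  have xq: "s - q \<in> KK" if "q \<in> ZK" for q using KK_diff[OF s_KK ZK_KK[OF that]] .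
  consider "z - s \<in> ZK" | "z + s \<in> ZK" using assms(3) unfolding critical_def by blast
  then have *: "(\<exists>q\<in>ZK. F c (z - q) = 25 / c) \<and> (\<forall>q\<in>ZK. 25 / c \<le> F c (z - q))"
  proof cases
    case 1
    have "F c (z - (z - s + 1)) = 25 / c" using F_critical_1[OF assms(1)] by simp
    moreover have "25 / c \<le> F c (z - q)" if q: "q \<in> ZK" for q
      using F_critical_ge[OF assms(1) ZK_diff[OF q 1]] by simp
    ultimately show ?thesis using ZK_add[OF 1 ZK_1] by blast
  next
    case 2
    have eq: "F c (z - q) = F c (s - (z + s - q))" if q: "q \<in> ZK" for q
      using F_minus[OF assms(1) xq[OF ZK_diff[OF 2 q]]] by simp
    have "F c (z - (z + s - 1)) = 25 / c"
      using eq[OF ZK_diff[OF 2 ZK_1]] F_critical_1[OF assms(1)] by simp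
    moreover have "25 / c \<le> F c (z - q)" if q: "q \<in> ZK" for q
      using F_critical_ge[OF assms(1) ZK_diff[OF 2 q]] unfolding eq[OF q] .
    ultimately show ?thesis using ZK_diff[OF 2 ZK_1] by blast
  qed
  then obtain q where "q \<in> ZK" "F c (z - q) = 25 / c" by blast
  then show "euclidean_min_at KK (wn c) z \<le> 25 / c" using euclidean_min_at_le[OF assms(1,2), of q] by simp
  show "25 / c \<le> euclidean_min_at KK (wn c) z" using euclidean_min_at_ge[OF assms(1,2), of "25 / c"] * by blast
qed

lemma euclidean_min_at_less_kap:
  assumes "c \<ge> 23" "z \<in> KK" "\<not> critical z"
  shows "euclidean_min_at KK (wn c) z < kap"
proof -
  have c: "c > 0" using assms(1) by linarith
  obtain q where "q \<in> ZK" "F c (z - q) < kap"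
    using norm_covering[OF assms(2,1)] assms(3) unfolding critical_def by blast
  then show ?thesis using euclidean_min_at_le[OF c assms(2), of q] by linarith
qed

lemma euclidean_min_at_near_kap:
  assumes "c \<ge> 25" "\<kappa> < kap"
  shows "\<exists>z\<in>KK. \<not> critical z \<and> \<kappa> < euclidean_min_at KK (wn c) z"
proof -
  have c: "c > 0" and d: "(kap - \<kappa>) / 2 > 0" using assms by simp_all
  obtain z where z: "z \<in> KK" "\<not> critical z" and ge: "\<And>q. q \<in> ZK \<Longrightarrow> kap - (kap - \<kappa>) / 2 \<le> F c (z - q)"
    using F_critical_lower[OF assms(1) d] unfolding critical_def by blast
  have "kap - (kap - \<kappa>) / 2 \<le> euclidean_min_at KK (wn c) z" by (rule euclidean_min_at_ge[OF c z(1) ge])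
  moreover have "\<kappa> < kap - (kap - \<kappa>) / 2" using assms(2) by (simp add: diff_divide_distrib)
  ultimately show ?thesis using z by (intro bexI[of _ z]) simp_all
qed

lemma critical_s: "critical s" "critical (- s)"
  by (simp_all add: critical_def)

lemma euclidean_min_at_le_min: "z \<in> KK \<Longrightarrow> ereal (euclidean_min_at KK f z) \<le> euclidean_min KK f"
  unfolding euclidean_min_def by (rule SUP_upper)

text \<open>
  For \<open>c < 25\<close> the value \<open>25 / c\<close> is larger than \<open>kap\<close>; for \<open>c \<ge> 25\<close> points near the heteroclinic orbit approach \<open>kap\<close>.
\<close>

lemma euclidean_min_large:
  assumes "c \<ge> 23"
  shows "euclidean_min KK (wn c) = ereal (max (25 / c) kap)"
proof (rule antisym)
  have c: "c > 0" using assms by linarith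
  show "euclidean_min KK (wn c) \<le> ereal (max (25 / c) kap)"
    unfolding euclidean_min_def
  proof (rule SUP_least)
    fix z assume z: "z \<in> KK"
    have "euclidean_min_at KK (wn c) z \<le> max (25 / c) kap"
      using euclidean_min_at_critical[OF c z] euclidean_min_at_less_kap[OF assms z] by (cases "critical z") simp_all
    then show "ereal (euclidean_min_at KK (wn c) z) \<le> ereal (max (25 / c) kap)" by (simp only: ereal_less_eq)
  qed
  have crit: "ereal (25 / c) \<le> euclidean_min KK (wn c)"
    using euclidean_min_at_le_min[OF s_KK, of "wn c"] euclidean_min_at_critical[OF c s_KK critical_s(1)] by simp
  have "ereal kap \<le> euclidean_min KK (wn c)"
  proof (cases "c \<ge> 25")
    case True
    show ?thesis
    proof (rule ccontr)
      assume "\<not> ereal kap \<le> euclidean_min KK (wn c)"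
      then have "euclidean_min KK (wn c) < ereal kap" by simp
      then obtain \<kappa> where k: "euclidean_min KK (wn c) < ereal \<kappa>" "ereal \<kappa> < ereal kap"
        using ereal_dense2 by blast
      obtain z where z: "z \<in> KK" "\<kappa> < euclidean_min_at KK (wn c) z"
        using euclidean_min_at_near_kap[OF True, of \<kappa>] k(2) by auto
      have "ereal \<kappa> < ereal (euclidean_min_at KK (wn c) z)" using z(2) by simp
      also have "\<dots> \<le> euclidean_min KK (wn c)" by (rule euclidean_min_at_le_min[OF z(1)])
      finally show False using k(1) by simp
    qed
  next
    case False
    then have "1 \<le> 25 / c" using c by simp
    then have "ereal kap \<le> ereal (25 / c)" using kap_bounds by simp
    then show ?thesis using crit by (rule order_trans)
  qed
  with crit show "ereal (max (25 / c) kap) \<le> euclidean_min KK (wn c)" by (simp add: max_def)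
qed

lemma euclidean_min_small:
  assumes "0 < c" "c < 23"
  shows "\<exists>z\<in>KK. B \<le> euclidean_min_at KK (wn c) z" "euclidean_min KK (wn c) = \<infinity>"
proof -
  show *: "\<exists>z\<in>KK. B \<le> euclidean_min_at KK (wn c) z" for B
  proof -
    obtain z where z: "z \<in> KK" and ge: "\<And>q. q \<in> ZK \<Longrightarrow> B \<le> F c (z - q)" using F_unbounded[OF assms] by blast
    show ?thesis using euclidean_min_at_ge[OF assms(1) z ge] z by blast
  qed
  show "euclidean_min KK (wn c) = \<infinity>"
  proof (rule ereal_top)
    fix B
    obtain z where z: "z \<in> KK" "B \<le> euclidean_min_at KK (wn c) z" using * by blast
    then have "ereal B \<le> ereal (euclidean_min_at KK (wn c) z)" by simp
    then show "ereal B \<le> euclidean_min KK (wn c)" using euclidean_min_at_le_min[OF z(1)] by (rule order_trans)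
  qed
qed

section \<open>The Euclidean window and isolated minima\<close>

text \<open>
  For \<open>c \<le> 25\<close> the pair \<open>4 rt\<close>, \<open>23\<close>, whose quotient is the critical point, admits no division with smaller remainder.
\<close>

lemma euclidean_window_KK: "euclidean_window KK (prin ppi) = {25<..}"
proof -
  have wn: "wn c x = F c x" if "c > 0" "x \<in> ZK" for c x by (rule weighted_norm_eq_F[OF that(1) ZK_KK[OF that(2)]])
  have scale: "F c (a - b * q) = F c b * F c (a / b - q)"
    if "c > 0" "a \<in> ZK" "b \<in> ZK" "b \<noteq> 0" "q \<in> ZK" for c a b q
  proof -
    have "a - b * q = b * (a / b - q)" using that(4) by (simp add: right_diff_distrib)
    then show ?thesis
      using F_mult[OF that(1) ZK_KK[OF that(3)] KK_diff[OF KK_divide[OF ZK_KK[OF that(2)] ZK_KK[OF that(3)]] ZK_KK[OF that(5)]]]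
      by (simp only:)
  qed
  have Fpos: "0 < F c b" if "c > 0" "b \<in> ZK" "b \<noteq> 0" for c b
    using F_nonneg[OF that(1) ZK_KK[OF that(2)]] F_eq_0_iff[OF that(1) ZK_KK[OF that(2)]] that(3) by simp
  have "c > 25" if c: "c > 0" and E: "euclidean_function_on ZK (wn c)" for c
  proof (rule ccontr)
    assume "\<not> c > 25"
    then have "1 \<le> 25 / c" using c by simp
    \<comment> \<open>a numerator and denominator of the critical point\<close>
    have a: "4 * rt \<in> ZK" by (intro ZK_mult ZK_numeral ZK_rt)
    obtain q where q: "q \<in> ZK" "wn c (4 * rt - 23 * q) < wn c 23"
      using E a unfolding euclidean_function_on_def by (metis ZK_numeral zero_neq_numeral)
    have "F c (4 * rt - 23 * q) < F c 23"
      using q wn[OF c ZK_numeral] wn[OF c ZK_diff[OF a ZK_mult[OF ZK_numeral q(1)]]] by simp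
    then have "F c 23 * F c (s - q) < F c 23 * 1"
      using scale[OF c a ZK_numeral _ q(1), of "num.Bit1 (num.Bit1 (num.Bit1 (num.Bit0 num.One)))"] by (simp add: s_def)
    then have "F c (s - q) < 1" using Fpos[OF c ZK_numeral] by (metis mult_less_cancel_left_pos zero_neq_numeral)
    then show False using F_critical_ge[OF c q(1)] \<open>1 \<le> 25 / c\<close> by linarith
  qed
  moreover have "euclidean_function_on ZK (wn c)" if c25: "c > 25" for c
  proof -
    have c: "c > 0" "c > 1" using c25 by linarith+
    have im: "wn c ` ZK = F c ` ZK" using wn[OF c(1)] by (intro image_cong) simp_all
    have "\<exists>q\<in>ZK. wn c (a - b * q) < wn c b" if ab: "a \<in> ZK" "b \<in> ZK" "b \<noteq> 0" for a b
    proof -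
      obtain q where q: "q \<in> ZK" "F c (a / b - q) < 1"
        using F_euclidean[OF c25 KK_divide[OF ZK_KK[OF ab(1)] ZK_KK[OF ab(2)]]] by blast
      have "F c (a - b * q) < F c b * 1"
        unfolding scale[OF c(1) ab q(1)] by (rule mult_strict_left_mono[OF q(2) Fpos[OF c(1) ab(2,3)]])
      then show ?thesis
        using q(1) wn[OF c(1) ab(2)] wn[OF c(1) ZK_diff[OF ab(1) ZK_mult[OF ab(2) q(1)]]] by (intro bexI[of _ q]) simp_all
    qed
    then show ?thesis
      unfolding euclidean_function_on_def im
      using finite_F_values[OF c(2)] wn[OF c(1)] F_nonneg[OF c(1) ZK_KK] F_eq_0_iff[OF c(1) ZK_KK] by simp
  qed
  moreover have "c > 0" if "c > 25" for c :: real using that by linarith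
  ultimately show ?thesis unfolding euclidean_window_def ring_of_integers_KK by blast
qed

lemma two_s_notin_ZK: "2 * s \<notin> ZK"
proof
  assume "2 * s \<in> ZK"
  then obtain n :: int where "nm (2 * s) = of_int n" by (rule nm_ZK)
  moreover have "nm (2 * s) = - 192 / 23" using nm_quad[of 0 "8 / 23"] by (simp add: s_def)
  ultimately have "real_of_int (23 * n) = real_of_int (- 192)" by simp
  then have "23 * n = - 192" by (simp only: of_int_eq_iff)
  then show False by presburger
qed

lemma isolated_if:
  assumes "c \<ge> 23" "kap < 25 / c"
  shows "isolated_min KK (wn c)"
proof -
  have c: "c > 0" using assms(1) by linarith
  have min: "euclidean_min KK (wn c) = ereal (25 / c)"
    using euclidean_min_large[OF assms(1)] assms(2) by (simp add: max_def)
  have at: "euclidean_min_at KK (wn c) z = 25 / c \<longleftrightarrow> critical z" if "z \<in> KK" for z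
    using euclidean_min_at_critical[OF c that] euclidean_min_at_less_kap[OF assms(1) that] assms(2) by (cases "critical z") auto
  have ne: "\<not> (\<xi> - s \<in> ZK \<and> \<xi> - - s \<in> ZK)" for \<xi>
  proof
    assume "\<xi> - s \<in> ZK \<and> \<xi> - - s \<in> ZK"
    then have "(\<xi> - - s) - (\<xi> - s) \<in> ZK" using ZK_diff by blast
    then show False using two_s_notin_ZK by simp
  qed
  have cr: "critical \<xi> \<longleftrightarrow> \<xi> - s \<in> ZK \<or> \<xi> - - s \<in> ZK" for \<xi> by (simp add: critical_def)
  have "min_representatives KK (wn c) {s, - s}"
    unfolding min_representatives_def ring_of_integers_KK min
  proof (intro conjI ballI impI)
    show "{s, - s} \<subseteq> {\<xi> \<in> KK. ereal (euclidean_min_at KK (wn c) \<xi>) = ereal (25 / c)}"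
      using at[OF s_KK] at[OF KK_minus[OF s_KK]] critical_s s_KK KK_minus[OF s_KK] by simp
    fix \<xi> assume "\<xi> \<in> KK" "ereal (euclidean_min_at KK (wn c) \<xi>) = ereal (25 / c)"
    then have "critical \<xi>" using at by simp
    then show "\<exists>!\<eta>. \<eta> \<in> {s, - s} \<and> \<xi> - \<eta> \<in> ZK" using ne[of \<xi>] unfolding cr by blast
  qed
  moreover have "ereal kap < euclidean_min KK (wn c)" unfolding min using assms(2) by simp
  moreover have "euclidean_min_at KK (wn c) \<xi> \<le> kap" if "\<xi> \<in> KK" "\<forall>\<eta>\<in>{s, - s}. \<xi> - \<eta> \<notin> ZK" for \<xi>
    using euclidean_min_at_less_kap[OF assms(1) that(1)] that(2) cr[of \<xi>] by simp
  ultimately show ?thesis unfolding isolated_min_def ring_of_integers_KK by blast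
qed

text \<open>
  The minima at non-critical points are smaller than \<open>kap\<close> and come arbitrarily close to it.
\<close>

lemma not_isolated_if_large:
  assumes "c \<ge> 23" "25 / c \<le> kap"
  shows "\<not> isolated_min KK (wn c)"
proof
  assume "isolated_min KK (wn c)"
  then obtain C \<kappa> where C: "min_representatives KK (wn c) C" and k: "ereal \<kappa> < euclidean_min KK (wn c)"
    and le: "\<And>\<xi>. \<xi> \<in> KK \<Longrightarrow> \<forall>\<eta>\<in>C. \<xi> - \<eta> \<notin> ZK \<Longrightarrow> euclidean_min_at KK (wn c) \<xi> \<le> \<kappa>"
    unfolding isolated_min_def ring_of_integers_KK by blast
  have c: "c > 0" using assms(1) by linarith
  have "25 / c \<le> 1" using assms(2) kap_bounds by linarith
  then have c25: "c \<ge> 25" using c by simp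
  have min: "euclidean_min KK (wn c) = ereal kap" using euclidean_min_large[OF assms(1)] assms(2) by (simp add: max_def)
  obtain z where z: "z \<in> KK" "\<not> critical z" "\<kappa> < euclidean_min_at KK (wn c) z"
    using euclidean_min_at_near_kap[OF c25, of \<kappa>] k unfolding min by auto
  then obtain \<eta> where eta: "\<eta> \<in> C" "z - \<eta> \<in> ZK" using le[OF z(1)] by (meson not_le)
  have "\<eta> \<in> KK" "euclidean_min_at KK (wn c) \<eta> = kap"
    using C eta(1) unfolding min_representatives_def min by auto
  then have "critical \<eta>" using euclidean_min_at_less_kap[OF assms(1), of \<eta>] by auto
  then show False using critical_cong[OF eta(2)] z(2) by blast
qed

lemma not_isolated_if_small:
  assumes "0 < c" "c < 23"
  shows "\<not> isolated_min KK (wn c)"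
proof
  assume "isolated_min KK (wn c)"
  then obtain C \<kappa> where C: "min_representatives KK (wn c) C"
    and le: "\<And>\<xi>. \<xi> \<in> KK \<Longrightarrow> \<forall>\<eta>\<in>C. \<xi> - \<eta> \<notin> ZK \<Longrightarrow> euclidean_min_at KK (wn c) \<xi> \<le> \<kappa>"
    unfolding isolated_min_def ring_of_integers_KK by blast
  have "C = {}" using C unfolding min_representatives_def euclidean_min_small(2)[OF assms] by auto
  moreover obtain z where z: "z \<in> KK" "\<kappa> + 1 \<le> euclidean_min_at KK (wn c) z" using euclidean_min_small(1)[OF assms] by blast
  ultimately show False using le[of z] by simp
qed

lemma isolated_iff:
  assumes "c > 0"
  shows "isolated_min KK (wn c) \<longleftrightarrow> c \<in> {23..<23 / 15 * (8 + rt)}"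
proof -
  have "kap * (23 / 15 * (8 + rt)) = 25" by (simp add: kap_def algebra_simps diff_divide_distrib)
  moreover have "kap * c < kap * (23 / 15 * (8 + rt)) \<longleftrightarrow> c < 23 / 15 * (8 + rt)"
    using kap_bounds by (intro mult_less_cancel_left_pos) linarith
  moreover have "kap < 25 / c \<longleftrightarrow> kap * c < 25" using assms by (simp add: pos_less_divide_eq)
  ultimately have "kap < 25 / c \<longleftrightarrow> c < 23 / 15 * (8 + rt)" by simp
  then show ?thesis
    using isolated_if[of c] not_isolated_if_large[of c] not_isolated_if_small[OF assms] by (metis atLeastLessThan_iff not_le)
qed

theorem theorem5p1:
  fixes K :: "real set" and \<pp> :: "real set"
  assumes K: "K = {a + b * sqrt 69 | a b. a \<in> \<rat> \<and> b \<in> \<rat>}"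
    and p: "\<pp> = Idl\<^bsub>int_ring K\<^esub> {23, sqrt 69}"
  shows "euclidean_window K \<pp> = {25<..} \<and>
    (\<forall>c\<in>euclidean_window K \<pp>.
       euclidean_min K (weighted_norm K \<pp> c) =
         ereal (max (25 / c) (1 / 23 * (-600 + 75 * sqrt 69)))) \<and>
    (\<forall>c>0. isolated_min K (weighted_norm K \<pp> c) \<longleftrightarrow>
       c \<in> {23..<23 / 15 * (8 + sqrt 69)})"
proof -
  have KK: "K = KK" unfolding K KK_def ..
  have pp: "\<pp> = prin ppi" unfolding p KK by (rule Idl_eq_prin_ppi)
  have kap: "1 / 23 * (-600 + 75 * rt) = kap" by (simp add: kap_def)
  show ?thesis
    unfolding KK pp euclidean_window_KK kap using euclidean_min_large isolated_iff by simp
qed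

end
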